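(* Let $T=(1,2,\ldots,d,t_d,\ldots,t_{\mathsf j},0)$ with $d\ge t_d\ge\cdots\ge t_{\mathsf j}>0$, and let $P$ be a partition of diagonal lengths $T$, with component partitions $P_d,\ldots,P_{\mathsf j}$. Then $$\kappa(P)=\sum_{i=d}^{\mathsf j}\kappa(P_i)-(t_d-t_{\mathsf j})-(\mathsf j-d).$$ Moreover, a minimal set of generators for a generic ideal in the cell $\mathbb V(E_P)$ includes $d+1-t_d$ generators of degree $d$ and $\kappa(P_i)-(\delta_i+1)$ generators of degree $i+1$, for each $i\in[d,\mathsf j]$.
   Context: Let $R=\mathsf k[x,y]$ with its standard grading, $\mathfrak m=(x,y)$, where the field $\mathsf k$ has characteristic zero, or is infinite of characteristic $p>\mathsf j$. For a partition $P=(p_1\ge\cdots\ge p_m)$ let $C_P$ be the set of monomials $x^ay^b$ with $0\le b<m$, $0\le a<p_{b+1}$ (Ferrers diagram: $x$-degree increases to the right, $y$-degree increases downwards), and $E_P$ the set of monomials not in $C_P$, and also the monomial ideal they generate. The diagonal lengths of $P$ is the Hilbert function of $R/E_P$. Put $t_{d-1}=d$, $t_{\mathsf j+1}=0$, $\delta_i=t_{i-1}-t_i$ for $d\le i\le\mathsf j+1$. Monomials of degree $i$ are ordered $x^i<x^{i-1}y<\cdots<y^i$ (lex; "first", "above" mean smaller $y$-degree). The initial monomial of a form is its monomial of highest $y$-degree with nonzero coefficient; $\mathrm{in}(I)$ is generated by the initial monomials of elements of $I$; the Jordan cell $\mathbb V(E_P)$ is the affine variety (an affine space) parametrizing all graded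 ideals $I\subset R$ with $\mathrm{in}(I)=E_P$. $\kappa(P)$ is the minimum number of generators of a generic ideal $I\in\mathbb V(E_P)$ (generic: in a suitable nonempty Zariski-open dense subset). Component partitions. A monomial $x^ay^b\in E_P$ is a horizontal-border monomial if $b>0$ and $x^ay^{b-1}\notin E_P$; it is a vertical-border monomial if $a>0$ and $x^{a-1}y^b\notin E_P$. $A(P)_i$ is the set of degree-$i$ horizontal-border monomials. A degree-$i$ hand monomial is a degree-$i$ monomial $\nu\in C_P$ with $x\nu\in E_P$. For $d\le i\le\mathsf j$: $V_{i1}=A(P)_i$ if $x^i\in C_P$; if $x^i\notin C_P$, $V_{i1}=A(P)_i\cup\{x^ay^b\}$ where $x^ay^b$ is the last (lex) degree-$i$ vertical-border monomial lying above the first (lex) monomial of $A(P)_i$ (the condition "above" being vacuous if $A(P)_i=\emptyset$). $V_{i2}$ is the set of the first (lex) $\delta_{i+1}$ degree-$i$ hand monomials. With $d_i=\delta_i+\delta_{i+1}$, one has $|V_{i1}|=\delta_i+1$, $|V_{i1}\cup V_{i2}|=d_i+1$; let $s_i$ be the unique order-preserving bijection from $V_{i1}\cup V_{i2}$ to the set of degree-$d_i$ monomials of $R$. The component $P_i$ is the unique partition with $E_{P_i}=\langle s_i(V_{i1})\rangle+\mathfrak m^{d_i+1}$; its diagonal lengths are $T_i=(1,2,\ldots,d_i,\delta_{i+1},0)$. If $d_i=0$, then $P_i$ is the empty partition, $E_{P_i}=R$ and $\kappa(P_i)=1$. *)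

theory Defs
  imports
    "HOL-Analysis.Abstract_Topology"
    "HOL-Library.Poly_Mapping"
    "HOL-Library.Product_Plus"
    "HOL-Library.Set_Algebras"
begin

section \<open>The graded ring k[x,y]\<close>

text \<open>The monomial \<open>x\<^sup>a y\<^sup>b\<close> is the exponent pair \<open>(a, b)\<close>, so that k[x,y] is the monoid algebra
  of \<open>nat \<times> nat\<close>, with the convolution product of \<^theory>\<open>HOL-Library.Poly_Mapping\<close>.\<close>

type_synonym monomial = "nat \<times> nat"
type_synonym 'k xy_poly = "monomial \<Rightarrow>\<^sub>0 'k"

definition mdeg :: "monomial \<Rightarrow> nat" where
  "mdeg m = fst m + snd m"

definition monomials_of_degree :: "nat \<Rightarrow> monomial set" where
  "monomials_of_degree n = {m. mdeg m = n}"

definition mono_poly :: "monomial \<Rightarrow> 'k::field xy_poly" where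
  "mono_poly m = Poly_Mapping.single m 1"

definition const_scale :: "'k::field \<Rightarrow> 'k xy_poly \<Rightarrow> 'k xy_poly" where
  "const_scale c f = Poly_Mapping.single 0 c * f"

text \<open>Ideals are the submodules of the ring over itself: \<open>ideal.subspace I\<close> says that \<open>I\<close> is an
  ideal, and \<open>ideal.span G\<close> is the ideal generated by \<open>G\<close>.\<close>

global_interpretation ideal: module "(*) :: 'a::comm_ring_1 \<Rightarrow> 'a \<Rightarrow> 'a"
  by standard (simp_all add: algebra_simps)

global_interpretation kvec: vector_space "const_scale :: 'k::field \<Rightarrow> 'k xy_poly \<Rightarrow> 'k xy_poly"
proof
  fix a b :: 'k and f g :: "'k xy_poly"
  show "const_scale a (f + g) = const_scale a f + const_scale a g"
    by (simp add: const_scale_def distrib_left)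
  show "const_scale (a + b) f = const_scale a f + const_scale b f"
    by (simp add: const_scale_def single_add distrib_right)
  show "const_scale a (const_scale b f) = const_scale (a * b) f"
    by (simp add: const_scale_def mult_single mult.assoc[symmetric])
  show "const_scale 1 f = f"
    by (simp add: const_scale_def)
qed

definition forms :: "nat \<Rightarrow> 'k::field xy_poly set" where
  "forms n = {f. \<forall>m\<in>Poly_Mapping.keys f. mdeg m = n}"

definition hom_component :: "nat \<Rightarrow> 'k::field xy_poly \<Rightarrow> 'k xy_poly" where
  "hom_component n f =
     (\<Sum>m\<in>{m \<in> Poly_Mapping.keys f. mdeg m = n}. Poly_Mapping.single m (Poly_Mapping.lookup f m))"

definition graded_ideal :: "'k::field xy_poly set \<Rightarrow> bool" where
  "graded_ideal I \<longleftrightarrow> ideal.subspace I \<and> (\<forall>f\<in>I. \<forall>n. hom_component n f \<in> I)"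

text \<open>The Hilbert function of R/I for a graded ideal \<open>I\<close>, as
  \<open>dim (R/I)\<^sub>n = dim R\<^sub>n - dim I\<^sub>n\<close>.\<close>

definition hilbert_function :: "'k::field xy_poly set \<Rightarrow> nat \<Rightarrow> nat" where
  "hilbert_function I n = kvec.dim (forms n :: 'k xy_poly set) - kvec.dim (I \<inter> forms n)"

definition max_ideal :: "'k::field xy_poly set" where
  "max_ideal = ideal.span {mono_poly (1, 0), mono_poly (0, 1)}"

definition ideal_power :: "'k::field xy_poly set \<Rightarrow> nat \<Rightarrow> 'k xy_poly set" where
  "ideal_power J n = ideal.span {prod_list fs | fs. length fs = n \<and> set fs \<subseteq> J}"

definition min_num_gens :: "'k::field xy_poly set \<Rightarrow> nat" where
  "min_num_gens I = (LEAST n. \<exists>G. finite G \<and> card G = n \<and> ideal.span G = I)"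

definition minimal_homogeneous_gens :: "'k::field xy_poly set \<Rightarrow> 'k xy_poly set \<Rightarrow> bool" where
  "minimal_homogeneous_gens I G \<longleftrightarrow>
     G \<subseteq> (\<Union>n. forms n) \<and> ideal.span G = I \<and> (\<forall>G'. G' \<subset> G \<longrightarrow> ideal.span G' \<noteq> I)"

text \<open>For monomials of the same degree, \<open>lex_less u v\<close> is the order
  \<open>x\<^sup>i < x\<^sup>i\<^sup>-\<^sup>1 y < \<dots> < y\<^sup>i\<close>; it is only used for such pairs.\<close>

definition lex_less :: "monomial \<Rightarrow> monomial \<Rightarrow> bool" where
  "lex_less u v \<longleftrightarrow> snd u < snd v"

definition initial_monomial :: "'k::field xy_poly \<Rightarrow> monomial" where
  "initial_monomial f = (ARG_MAX snd m. m \<in> Poly_Mapping.keys f)"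

definition initial_ideal :: "'k::field xy_poly set \<Rightarrow> 'k xy_poly set" where
  "initial_ideal I =
     ideal.span {mono_poly (initial_monomial f) | f n. f \<in> I \<and> f \<in> forms n \<and> f \<noteq> 0}"


section \<open>Partitions and Jordan cells\<close>

definition is_partition :: "nat list \<Rightarrow> bool" where
  "is_partition P \<longleftrightarrow> sorted_wrt (\<ge>) P \<and> (\<forall>p\<in>set P. p > 0)"

definition C_set :: "nat list \<Rightarrow> monomial set" where
  "C_set P = {(a, b). b < length P \<and> a < P ! b}"

definition E_set :: "nat list \<Rightarrow> monomial set" where
  "E_set P = - C_set P"

definition E_ideal :: "nat list \<Rightarrow> 'k::field xy_poly set" where
  "E_ideal P = ideal.span (mono_poly ` E_set P)"

definition diagonal_lengths :: "'k::field itself \<Rightarrow> nat list \<Rightarrow> nat \<Rightarrow> nat" where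
  "diagonal_lengths _ P = hilbert_function (E_ideal P :: 'k xy_poly set)"

definition cell :: "nat list \<Rightarrow> 'k::field xy_poly set set" where
  "cell P = {I. graded_ideal I \<and> initial_ideal I = E_ideal P}"

text \<open>For \<open>I\<close> in the cell of \<open>P\<close>, the monomials of \<open>C_set P\<close> are a basis of R/I. So for every
  \<open>\<nu> \<in> E_set P\<close> there is exactly one element of \<open>I\<close> of the form \<open>\<nu> + (combination of C_set P)\<close>;
  these elements form the reduced row echelon bases of the graded pieces of \<open>I\<close>. Their coefficients
  at the monomials of \<open>C_set P\<close> are the affine coordinates on the Schubert cells of the Grassmannians
  that contain the points \<open>I\<^sub>n \<subseteq> R\<^sub>n\<close>, and the cell carries the Zariski topology of a subvariety of
  the product of these affine spaces.\<close>

definition reduced_element :: "nat list \<Rightarrow> 'k::field xy_poly set \<Rightarrow> monomial \<Rightarrow> 'k xy_poly" where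
  "reduced_element P I \<nu> =
     (THE f. f \<in> I \<and> Poly_Mapping.lookup f \<nu> = 1 \<and> Poly_Mapping.keys f - {\<nu>} \<subseteq> C_set P)"

text \<open>The polynomial functions in these coordinates (only the values on the cell are used).\<close>

inductive_set regular_functions :: "nat list \<Rightarrow> ('k::field xy_poly set \<Rightarrow> 'k) set"
  for P :: "nat list" where
  const: "(\<lambda>I. c) \<in> regular_functions P"
| coord: "\<nu> \<in> E_set P \<Longrightarrow> \<mu> \<in> C_set P \<Longrightarrow>
    (\<lambda>I. Poly_Mapping.lookup (reduced_element P I \<nu>) \<mu>) \<in> regular_functions P"
| add: "\<phi> \<in> regular_functions P \<Longrightarrow> \<psi> \<in> regular_functions P \<Longrightarrow>
    (\<lambda>I. \<phi> I + \<psi> I) \<in> regular_functions P"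
| mult: "\<phi> \<in> regular_functions P \<Longrightarrow> \<psi> \<in> regular_functions P \<Longrightarrow>
    (\<lambda>I. \<phi> I * \<psi> I) \<in> regular_functions P"

definition cell_topology :: "nat list \<Rightarrow> 'k::field xy_poly set topology" where
  "cell_topology P =
     topology_generated_by ((\<lambda>\<phi>. {I \<in> cell P. \<phi> I \<noteq> 0}) ` regular_functions P)"

definition generic_in_cell :: "nat list \<Rightarrow> ('k::field xy_poly set \<Rightarrow> bool) \<Rightarrow> bool" where
  "generic_in_cell P Q \<longleftrightarrow>
     (\<exists>U. openin (cell_topology P) U \<and> U \<noteq> {} \<and> cell_topology P closure_of U = cell P \<and>
          (\<forall>I\<in>U. Q I))"

definition kappa :: "'k::field itself \<Rightarrow> nat list \<Rightarrow> nat" where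
  "kappa _ P = (THE n. generic_in_cell P (\<lambda>I :: 'k xy_poly set. min_num_gens I = n))"


section \<open>Component partitions\<close>

text \<open>Here \<open>t\<close> is always the sequence of diagonal lengths of \<open>P\<close>, which is non-increasing from
  index \<open>d - 1\<close> on; \<open>delta t i\<close> is used for \<open>i \<ge> d \<ge> 1\<close> only, where the subtraction is exact.\<close>

definition delta :: "(nat \<Rightarrow> nat) \<Rightarrow> nat \<Rightarrow> nat" where
  "delta t i = t (i - 1) - t i"

definition horizontal_border :: "nat list \<Rightarrow> nat \<Rightarrow> monomial set" where
  "horizontal_border P i =
     {(a, b). (a, b) \<in> E_set P \<and> a + b = i \<and> b > 0 \<and> (a, b - 1) \<notin> E_set P}"

definition vertical_border :: "nat list \<Rightarrow> nat \<Rightarrow> monomial set" where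
  "vertical_border P i =
     {(a, b). (a, b) \<in> E_set P \<and> a + b = i \<and> a > 0 \<and> (a - 1, b) \<notin> E_set P}"

definition hand_monomials :: "nat list \<Rightarrow> nat \<Rightarrow> monomial set" where
  "hand_monomials P i = {(a, b). (a, b) \<in> C_set P \<and> a + b = i \<and> (Suc a, b) \<in> E_set P}"

definition lex_first :: "nat \<Rightarrow> monomial set \<Rightarrow> monomial set" where
  "lex_first n A = {v \<in> A. card {u \<in> A. lex_less u v} < n}"

definition lex_last :: "monomial set \<Rightarrow> monomial set" where
  "lex_last A = {v \<in> A. \<forall>u\<in>A. \<not> lex_less v u}"

definition V1 :: "nat list \<Rightarrow> nat \<Rightarrow> monomial set" where
  "V1 P i =
     (if (i, 0) \<in> C_set P then horizontal_border P i
      else horizontal_border P i \<union>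
        lex_last {v \<in> vertical_border P i. \<forall>u\<in>horizontal_border P i. lex_less v u})"

definition V2 :: "(nat \<Rightarrow> nat) \<Rightarrow> nat list \<Rightarrow> nat \<Rightarrow> monomial set" where
  "V2 t P i = lex_first (delta t (i + 1)) (hand_monomials P i)"

definition component_degree :: "(nat \<Rightarrow> nat) \<Rightarrow> nat \<Rightarrow> nat" where
  "component_degree t i = delta t i + delta t (i + 1)"

text \<open>The order-preserving bijection \<open>s\<^sub>i\<close>; extensionality makes it unique as a total function.\<close>

definition component_map :: "(nat \<Rightarrow> nat) \<Rightarrow> nat list \<Rightarrow> nat \<Rightarrow> monomial \<Rightarrow> monomial" where
  "component_map t P i =
     (THE s. s \<in> extensional (V1 P i \<union> V2 t P i) \<and>
        bij_betw s (V1 P i \<union> V2 t P i) (monomials_of_degree (component_degree t i)) \<and>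
        (\<forall>u \<in> V1 P i \<union> V2 t P i. \<forall>v \<in> V1 P i \<union> V2 t P i.
           lex_less u v \<longrightarrow> lex_less (s u) (s v)))"

definition component :: "'k::field itself \<Rightarrow> (nat \<Rightarrow> nat) \<Rightarrow> nat list \<Rightarrow> nat \<Rightarrow> nat list" where
  "component _ t P i =
     (THE Q. is_partition Q \<and>
        (E_ideal Q :: 'k xy_poly set) =
          ideal.span (mono_poly ` component_map t P i ` V1 P i)
          + ideal_power max_ideal (component_degree t i + 1))"

end

theory Submission
  imports Defs "HOL-Computational_Algebra.Polynomial"
begin

text \<open>
  Put \<open>x = 1\<close>. A form of degree \<open>n\<close> becomes a polynomial in \<open>y\<close> of degree at most \<open>n\<close>, and its
  initial monomial becomes the degree of that polynomial. A graded ideal \<open>I\<close> becomes a sequence of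
  subspaces \<open>W n\<close> of \<open>k[y]\<close> such that \<open>W n\<close> and \<open>y W n\<close> are contained in \<open>W (n + 1)\<close>. Let
  \<open>\<rho> b\<close> (\<open>row_degree P b\<close>) be the degree of the first monomial of row \<open>b\<close> outside the diagram of
  \<open>P\<close>. Then \<open>I\<close> lies in the cell of \<open>P\<close> iff, for every \<open>n\<close>, the degrees of the nonzero elements of
  \<open>W n\<close> are exactly the \<open>b\<close> with \<open>\<rho> b \<le> n\<close> (\<open>cell_iff\<close>).

  The cell is irreducible. Choose monic \<open>g b\<close> of degree \<open>b\<close> in \<open>W (\<rho> b)\<close>; then \<open>W n\<close> is spanned by
  the \<open>g b\<close> with \<open>\<rho> b \<le> n\<close>, and \<open>y g b = g (b + 1) + (\<Sum>c. u b c g c)\<close>, where \<open>c\<close> runs over the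
  indices with \<open>c \<le> b\<close> and \<open>\<rho> c \<le> \<rho> b + 1\<close>. Conversely every choice of the coefficients \<open>u b c\<close> gives
  an ideal in the cell (\<open>cell_ideal_in_cell\<close>, \<open>cell_eq_range\<close>). So the cell is the image of an affine
  space, and in its coordinates the regular functions are polynomials. Restricted to the line that
  joins two points of this space, a product of two nonzero functions is a nonzero polynomial in one
  variable over an infinite field. Hence any two nonempty basic open sets of the cell meet
  (\<open>regular_functions_irreducible\<close>), and finitely many generic properties hold together.

  By graded Nakayama, the number of minimal generators of degree \<open>n + 1\<close> is
  \<open>dim W (n + 1) - dim (W n + y W n)\<close> (\<open>card_minimal_gens\<close>, \<open>min_num_gens_eq\<close>). This is the corank
  of the map \<open>W n / W (n - 1) \<rightarrow> W (n + 1) / W n\<close> given by multiplication by \<open>y\<close>. In the bases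
  \<open>g b\<close> with \<open>\<rho> b = n\<close> and \<open>g c\<close> with \<open>\<rho> c = n + 1\<close> its matrix has the free entries \<open>u b c\<close> for
  \<open>c \<le> b\<close>, the entry \<open>1\<close> for \<open>c = b + 1\<close>, and \<open>0\<close> elsewhere. The generic rank of such a staircase
  matrix is a minimum over the thresholds \<open>z\<close>: the rows \<open>b\<close> with \<open>z \<le> b + 1\<close> and the columns
  \<open>c < z\<close> cover all nonzero entries (\<open>staircase_rank\<close>). The bound holds on the whole cell
  (\<open>dim_lower_part_le\<close>), it is attained at a point that comes from an order preserving matching
  (\<open>dim_lower_part_attained\<close>), and it is then attained generically (\<open>generic_dim_lower_part\<close>). So
  \<open>\<kappa>(P)\<close> is the sum over the degrees of the numbers \<open>generic_new_gens P n\<close> (\<open>kappa_formula\<close>).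

  For the component \<open>P\<^sub>i\<close> this sum has at most two nonzero terms, \<open>\<delta>\<^sub>i + 1\<close> generators in degree \<open>d\<^sub>i\<close>
  and a corank in degree \<open>d\<^sub>i + 1\<close>. The theorem therefore says that two staircase ranks agree, one for
  the sets \<open>{b. \<rho> b = i}\<close> and \<open>{c. \<rho> c = i + 1}\<close>, and one for the images of \<open>V\<^sub>i\<^sub>1\<close> and of
  \<open>{c. \<rho> c = i + 1}\<close> after the gaps in their union have been closed. They agree because in every
  maximal interval of \<open>{b. \<rho> b \<le> i}\<close> there are as many elements of \<open>V\<^sub>i\<^sub>1\<close> as there are \<open>b\<close> with
  \<open>\<rho> b = i\<close>, while all \<open>c\<close> lie outside these intervals and one of them directly follows each
  interval (\<open>V1_degrees_counts\<close>, \<open>staircase_rank_compress\<close>). The formula for \<open>\<kappa>(P)\<close> follows since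
  \<open>\<Sum>i=d..j. \<delta>\<^sub>i + 1\<close> telescopes.
\<close>

section \<open>Linear algebra relative to a subspace\<close>

text \<open>
  Linear independence of \<open>T\<close> in the quotient by the span of \<open>U\<close>, expressed without the quotient. The
  span operator is a parameter because this is used for subspaces of \<open>k[x,y]\<close> and of \<open>k[y]\<close>.
\<close>

definition indep_mod :: "('b set \<Rightarrow> 'b set) \<Rightarrow> 'b set \<Rightarrow> 'b set \<Rightarrow> bool" where
  "indep_mod sp U T \<longleftrightarrow> (\<forall>x\<in>T. x \<notin> sp (U \<union> (T - {x})))"

context vector_space
begin

lemma indep_mod_mono:
  assumes "indep_mod span U T" "U' \<subseteq> U" "T' \<subseteq> T"
  shows "indep_mod span U' T'"
  unfolding indep_mod_def
proof (intro ballI notI)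
  fix x assume x: "x \<in> T'" "x \<in> span (U' \<union> (T' - {x}))"
  have "span (U' \<union> (T' - {x})) \<subseteq> span (U \<union> (T - {x}))"
    using assms by (intro span_mono) auto
  with x assms show False unfolding indep_mod_def by blast
qed

lemma indep_mod_Un:
  assumes "independent B" "indep_mod span B T" "finite T"
  shows "independent (B \<union> T) \<and> B \<inter> T = {}"
  using assms(3,2)
proof (induction T rule: finite_induct)
  case (insert x T)
  have "independent (B \<union> T)" "B \<inter> T = {}"
    using insert.IH local.indep_mod_mono[OF insert.prems order_refl] by auto
  moreover have x: "x \<notin> span (B \<union> T)"
    using insert.prems insert.hyps unfolding indep_mod_def by (auto dest!: bspec[of _ _ x])
  moreover have "x \<notin> B" using x span_base by blast
  ultimately show ?case using independent_insertI[OF x] by auto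
qed (use assms in auto)

text \<open>
  Only the span of \<open>U \<union> G\<close> modulo \<open>U\<close> is finite-dimensional, \<open>U\<close> itself need not be. Each element
  of \<open>T\<close> involves only finitely many elements of a basis of \<open>U\<close>, so the usual exchange bound applies to
  a finite part of that basis.
\<close>

lemma indep_mod_card_le:
  assumes U: "subspace U" and T: "finite T" "indep_mod span U T" and G: "finite G" "T \<subseteq> span (U \<union> G)"
  shows "card T \<le> card G"
proof -
  obtain B where B: "B \<subseteq> U" "independent B" "U \<subseteq> span B"
    using maximal_independent_subset by blast
  have "span (U \<union> G) \<subseteq> span (B \<union> G)"
    using B span_mono[of B "B \<union> G"] span_superset[of "B \<union> G"] by (intro span_minimal) auto
  then have "T \<subseteq> span (B \<union> G)" using G by blast
  have "\<exists>F. finite F \<and> F \<subseteq> B \<union> G \<and> x \<in> span F" if "x \<in> T" for x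
  proof -
    have "x \<in> span (B \<union> G)" using that \<open>T \<subseteq> span (B \<union> G)\<close> by blast
    then obtain t r where "finite t" "t \<subseteq> B \<union> G" "x = (\<Sum>a\<in>t. r a *s a)"
      unfolding span_explicit by blast
    moreover from this have "x \<in> span t" by (auto intro: span_sum span_scale span_base)
    ultimately show ?thesis by blast
  qed
  then obtain F where F: "\<And>x. x \<in> T \<Longrightarrow> finite (F x) \<and> F x \<subseteq> B \<union> G \<and> x \<in> span (F x)"
    by metis
  define B0 where "B0 = (\<Union>x\<in>T. F x) \<inter> B"
  have B0: "finite B0" "B0 \<subseteq> B" unfolding B0_def using F T by auto
  have TB: "T \<subseteq> span (B0 \<union> G)"
  proof
    fix x assume x: "x \<in> T"
    have "F x \<subseteq> B0 \<union> G" using F[OF x] x unfolding B0_def by blast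
    then show "x \<in> span (B0 \<union> G)" using F[OF x] span_mono by blast
  qed
  have ind: "independent (B0 \<union> T) \<and> B0 \<inter> T = {}"
    using local.indep_mod_Un[OF independent_mono[OF B(2) B0(2)] local.indep_mod_mono[OF T(2) _ order_refl] T(1)]
      B(1) B0(2) by blast
  have "B0 \<union> T \<subseteq> span (B0 \<union> G)" using TB span_superset[of "B0 \<union> G"] by blast
  then have "card (B0 \<union> T) \<le> card (B0 \<union> G)"
    using independent_span_bound[OF _ conjunct1[OF ind]] B0(1) G(1) by blast
  moreover have "card (B0 \<union> T) = card B0 + card T"
    using ind B0 T by (intro card_Un_disjoint) auto
  ultimately show ?thesis using card_Un_le[of B0 G] by linarith
qed

text \<open>
  Finiteness of \<open>T\<close> is part of the conclusion because a minimal generating set of an ideal is not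
  known to be finite in advance.
\<close>

lemma card_indep_mod_eq_dim_diff:
  assumes U: "subspace U" and T: "indep_mod span U T" and W: "W = span (U \<union> T)"
    and fin: "finite S" "W \<subseteq> span S"
  shows "finite T \<and> card T + dim U = dim W"
proof -
  obtain B where B: "B \<subseteq> U" "independent B" "U \<subseteq> span B" "card B = dim U"
    using basis_exists by blast
  have sp: "span (B \<union> T) = W"
  proof -
    have "U \<union> T \<subseteq> span (B \<union> T)"
      using B span_mono[of B "B \<union> T"] span_superset[of "B \<union> T"] by auto
    then have "W \<subseteq> span (B \<union> T)" unfolding W by (intro span_minimal) auto
    moreover have "span (B \<union> T) \<subseteq> W" unfolding W using B by (intro span_mono) auto
    ultimately show ?thesis by auto
  qed
  have sub: "independent (B \<union> T') \<and> B \<inter> T' = {}" if "finite T'" "T' \<subseteq> T" for T'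
    using that B local.indep_mod_Un[OF B(2) local.indep_mod_mono[OF T B(1) that(2)] that(1)] by blast
  have bd: "finite (B \<union> T') \<and> card (B \<union> T') \<le> card S" if "finite T'" "T' \<subseteq> T" for T'
  proof -
    have "B \<union> T' \<subseteq> span S" using fin sp span_superset[of "B \<union> T"] that by auto
    then show ?thesis using independent_span_bound[OF fin(1)] sub[OF that] by blast
  qed
  have finT: "finite T"
  proof (rule ccontr)
    assume "infinite T"
    then obtain T' where T': "finite T'" "card T' = Suc (card S)" "T' \<subseteq> T"
      using infinite_arbitrarily_large by blast
    have "card T' \<le> card (B \<union> T')" using bd[OF T'(1,3)] by (intro card_mono) auto
    then show False using bd[OF T'(1,3)] T'(2) by linarith
  qed
  have "dim W = card (B \<union> T)" using sub[OF finT order_refl] sp dim_span_eq_card_independent by metis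
  also have "\<dots> = card B + card T"
    using sub[OF finT order_refl] bd[OF finT order_refl] by (intro card_Un_disjoint) auto
  finally show ?thesis using B finT by simp
qed

lemma exists_indep_mod_complement:
  assumes U: "subspace U" and W: "subspace W" "U \<subseteq> W"
  shows "\<exists>T. T \<subseteq> W \<and> indep_mod span U T \<and> span (U \<union> T) = W"
proof -
  obtain B where B: "B \<subseteq> U" "independent B" "U \<subseteq> span B"
    using maximal_independent_subset by blast
  obtain C where C: "B \<subseteq> C" "C \<subseteq> W" "independent C" "W \<subseteq> span C"
    using maximal_independent_subset_extend[of B W] B W by blast
  have "span (U \<union> (C - B)) = W"
  proof
    show "span (U \<union> (C - B)) \<subseteq> W" using C W by (intro span_minimal) auto
    have "C \<subseteq> U \<union> (C - B)" using B by auto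
    then show "W \<subseteq> span (U \<union> (C - B))" using C span_mono by blast
  qed
  moreover have "indep_mod span U (C - B)"
    unfolding indep_mod_def
  proof (intro ballI notI)
    fix x assume x: "x \<in> C - B" "x \<in> span (U \<union> (C - B - {x}))"
    have "U \<union> (C - B - {x}) \<subseteq> span (C - {x})"
      using B C x span_mono[of B "C - {x}"] span_superset[of "C - {x}"] by auto
    then have "x \<in> span (C - {x})" using x span_minimal[OF _ subspace_span] by blast
    then show False using C x unfolding dependent_def by auto
  qed
  ultimately show ?thesis using C by blast
qed

end

global_interpretation kpoly: vector_space "smult :: 'k::field \<Rightarrow> 'k poly \<Rightarrow> 'k poly"
  by standard (simp_all add: smult_add_right smult_add_left)


section \<open>Homogeneous components as polynomials in one variable\<close>

text \<open>
  The homogeneous component of degree \<open>n\<close> with \<open>x\<close> set to \<open>1\<close>, as a polynomial in \<open>y\<close>. On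
  \<open>forms n\<close> nothing is lost, and \<open>homog n\<close> is the inverse map.
\<close>

definition slice :: "nat \<Rightarrow> 'k::field xy_poly \<Rightarrow> 'k poly" where
  "slice n f = (\<Sum>b\<le>n. monom (Poly_Mapping.lookup f (n - b, b)) b)"

definition homog :: "nat \<Rightarrow> 'k::field poly \<Rightarrow> 'k xy_poly" where
  "homog n p = (\<Sum>b\<le>n. Poly_Mapping.single (n - b, b) (coeff p b))"

lemma coeff_slice: "coeff (slice n f) b = (if b \<le> n then Poly_Mapping.lookup f (n - b, b) else 0)"
  by (simp add: slice_def coeff_sum)

lemma degree_slice: "degree (slice n f) \<le> n"
  by (rule degree_le) (simp add: coeff_slice)

lemma lookup_homog:
  "Poly_Mapping.lookup (homog n p) (a, b) = (if a + b = n then coeff p b else 0)"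
proof -
  have "Poly_Mapping.lookup (homog n p) (a, b) = (\<Sum>b'\<le>n. if b' = b then (if a + b = n then coeff p b else 0) else 0)"
    unfolding homog_def lookup_sum
    by (intro sum.cong) (auto simp: lookup_single when_def)
  then show ?thesis by auto
qed

lemma slice_add: "slice n (f + g) = slice n f + slice n g"
  by (rule poly_eqI) (simp add: coeff_slice lookup_add)

lemma slice_diff: "slice n (f - g) = slice n f - slice n g"
  by (rule poly_eqI) (simp add: coeff_slice lookup_minus)

lemma slice_zero [simp]: "slice n 0 = 0"
  by (rule poly_eqI) (simp add: coeff_slice)

lemma slice_sum: "slice n (sum f A) = (\<Sum>x\<in>A. slice n (f x))"
  by (rule poly_eqI) (simp add: coeff_slice lookup_sum coeff_sum)

lemma poly_mapping_eqI_slice: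
  assumes "\<And>n. slice n f = slice n g" shows "f = g"
proof (rule poly_mapping_eqI)
  fix m :: monomial
  obtain a b where m: "m = (a, b)" by force
  have "coeff (slice (a + b) f) b = coeff (slice (a + b) g) b" using assms by simp
  then show "Poly_Mapping.lookup f m = Poly_Mapping.lookup g m" by (simp add: coeff_slice m)
qed

lemma slice_homog: "slice k (homog n p) = (if k = n then (\<Sum>b\<le>n. monom (coeff p b) b) else 0)"
  by (rule poly_eqI) (auto simp: coeff_slice lookup_homog coeff_sum)

lemma slice_homog_same: "degree p \<le> n \<Longrightarrow> slice n (homog n p) = p"
  by (simp add: slice_homog poly_as_sum_of_monoms')

lemma slice_homog_other: "k \<noteq> n \<Longrightarrow> slice k (homog n p) = 0"
  by (simp add: slice_homog)

lemma hom_component_eq: "hom_component n f = homog n (slice n f)"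
proof (rule poly_mapping_eqI)
  fix m :: monomial
  obtain a b where m: "m = (a, b)" by force
  have "Poly_Mapping.lookup (hom_component n f) m
      = (\<Sum>m'\<in>{m' \<in> Poly_Mapping.keys f. mdeg m' = n}. if m' = m then Poly_Mapping.lookup f m else 0)"
    unfolding hom_component_def lookup_sum by (intro sum.cong) (auto simp: lookup_single when_def)
  also have "\<dots> = (if mdeg m = n then Poly_Mapping.lookup f m else 0)"
    by (auto simp: in_keys_iff)
  finally show "Poly_Mapping.lookup (hom_component n f) m = Poly_Mapping.lookup (homog n (slice n f)) m"
    by (auto simp: m lookup_homog coeff_slice mdeg_def)
qed

lemma homog_in_forms: "homog n p \<in> forms n"
  unfolding forms_def by (auto simp: in_keys_iff lookup_homog mdeg_def split: if_splits)

lemma forms_iff: "f \<in> forms n \<longleftrightarrow> (\<forall>k. k \<noteq> n \<longrightarrow> slice k f = 0)"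
proof
  assume f: "f \<in> forms n"
  show "\<forall>k. k \<noteq> n \<longrightarrow> slice k f = 0"
  proof (intro allI impI poly_eqI)
    fix k b assume "k \<noteq> n"
    then have "(k - b, b) \<notin> Poly_Mapping.keys f" if "b \<le> k"
      using f that unfolding forms_def mdeg_def by force
    then show "coeff (slice k f) b = coeff 0 b" by (auto simp: coeff_slice in_keys_iff)
  qed
next
  assume s: "\<forall>k. k \<noteq> n \<longrightarrow> slice k f = 0"
  show "f \<in> forms n" unfolding forms_def
  proof (intro CollectI ballI)
    fix m assume m: "m \<in> Poly_Mapping.keys f"
    obtain a b where ab: "m = (a, b)" by force
    have "coeff (slice (a + b) f) b \<noteq> 0" using m by (simp add: coeff_slice ab in_keys_iff)
    then show "mdeg m = n" using s by (force simp: ab mdeg_def)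
  qed
qed

lemma homog_slice: "f \<in> forms n \<Longrightarrow> homog n (slice n f) = f"
  by (rule poly_mapping_eqI_slice)
     (metis degree_slice slice_homog_same slice_homog_other forms_iff)

lemma inj_on_slice_forms: "inj_on (slice n) (forms n)"
  by (metis homog_slice inj_onI)

lemma homog_add: "homog n (p + q) = homog n p + homog n q"
  by (rule poly_mapping_eqI) (auto simp: lookup_homog lookup_add split: prod.splits)

lemma lookup_single_mult:
  fixes f :: "'k::field xy_poly"
  shows "Poly_Mapping.lookup (Poly_Mapping.single (a, b) c * f) (a', b') =
    (if a \<le> a' \<and> b \<le> b' then c * Poly_Mapping.lookup f (a' - a, b' - b) else 0)"
proof -
  have "Poly_Mapping.lookup (Poly_Mapping.single (a, b) c * f) (a', b')
      = (\<Sum>l. (c when (a, b) = l) * (\<Sum>q. Poly_Mapping.lookup f q when (a', b') = l + q))"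
    by (simp add: lookup_mult lookup_single)
  also have "\<dots> = (\<Sum>l. (c * (\<Sum>q. Poly_Mapping.lookup f q when (a', b') = l + q)) when l = (a, b))"
    by (intro arg_cong[where f = Sum_any] ext) (auto simp: when_def)
  also have "\<dots> = c * (\<Sum>q. Poly_Mapping.lookup f q when (a', b') = (a, b) + q)"
    by simp
  also have "(\<lambda>q. Poly_Mapping.lookup f q when (a', b') = (a, b) + q)
     = (\<lambda>q. (if a \<le> a' \<and> b \<le> b' then Poly_Mapping.lookup f q else 0) when q = (a' - a, b' - b))"
    by (rule ext) (auto simp: when_def)
  finally show ?thesis by simp
qed

lemma poly_mapping_sum_single:
  "f = (\<Sum>m\<in>Poly_Mapping.keys f. Poly_Mapping.single m (Poly_Mapping.lookup f m))"
proof (rule poly_mapping_eqI)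
  fix m
  have "Poly_Mapping.lookup (\<Sum>m\<in>Poly_Mapping.keys f. Poly_Mapping.single m (Poly_Mapping.lookup f m)) m
    = (\<Sum>m'\<in>Poly_Mapping.keys f. if m' = m then Poly_Mapping.lookup f m else 0)"
    unfolding lookup_sum by (intro sum.cong) (auto simp: lookup_single when_def)
  then show "Poly_Mapping.lookup f m = Poly_Mapping.lookup (\<Sum>m\<in>Poly_Mapping.keys f. Poly_Mapping.single m (Poly_Mapping.lookup f m)) m"
    by (auto simp: in_keys_iff)
qed

lemma slice_single_mult:
  "slice n (Poly_Mapping.single (a, b) c * f) =
     (if a + b \<le> n then monom c b * slice (n - (a + b)) f else 0)"
proof (rule poly_eqI)
  fix k
  have e: "n - k - a = n - (a + b) - (k - b)" if "b \<le> k" "k \<le> n" "a \<le> n - k"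
    using that by linarith
  show "coeff (slice n (Poly_Mapping.single (a, b) c * f)) k
     = coeff (if a + b \<le> n then monom c b * slice (n - (a + b)) f else 0) k"
    using e by (auto simp: coeff_slice lookup_single_mult coeff_monom_mult)
qed

lemma slice_const_scale: "slice n (const_scale c f) = smult c (slice n f)"
  using slice_single_mult[of n 0 0 c f] unfolding const_scale_def
  by (simp add: zero_prod_def monom_0)

text \<open>
  Multiplication by the monomial \<open>x\<^sup>a y\<^sup>b\<close> moves the slice of degree \<open>n - (a + b)\<close> to degree \<open>n\<close> and
  multiplies it by \<open>y\<^sup>b\<close>.
\<close>

lemma slice_mult:
  "slice n (h * f) = (\<Sum>m\<in>Poly_Mapping.keys h. if mdeg m \<le> n
     then monom (Poly_Mapping.lookup h m) (snd m) * slice (n - mdeg m) f else 0)"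
proof -
  have "slice n (h * f) = slice n (\<Sum>m\<in>Poly_Mapping.keys h. Poly_Mapping.single m (Poly_Mapping.lookup h m) * f)"
    by (subst poly_mapping_sum_single[of h]) (simp add: sum_distrib_right)
  also have "\<dots> = (\<Sum>m\<in>Poly_Mapping.keys h. slice n (Poly_Mapping.single m (Poly_Mapping.lookup h m) * f))"
    by (rule slice_sum)
  also have "\<dots> = (\<Sum>m\<in>Poly_Mapping.keys h. if mdeg m \<le> n
     then monom (Poly_Mapping.lookup h m) (snd m) * slice (n - mdeg m) f else 0)"
    by (intro sum.cong refl) (auto simp: slice_single_mult mdeg_def split: prod.splits)
  finally show ?thesis .
qed


section \<open>Graded ideals as systems of slices\<close>

text \<open>
  The two closure conditions are closure of the corresponding ideal under multiplication by \<open>x\<close> and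
  by \<open>y\<close>.
\<close>

definition slice_system :: "(nat \<Rightarrow> 'k::field poly set) \<Rightarrow> bool" where
  "slice_system W \<longleftrightarrow> (\<forall>n. kpoly.subspace (W n) \<and>
     (\<forall>p\<in>W n. degree p \<le> n \<and> p \<in> W (Suc n) \<and> pCons 0 p \<in> W (Suc n)))"

definition ideal_of_slices :: "(nat \<Rightarrow> 'k::field poly set) \<Rightarrow> 'k xy_poly set" where
  "ideal_of_slices W = {f. \<forall>n. slice n f \<in> W n}"

abbreviation slices :: "'k::field xy_poly set \<Rightarrow> nat \<Rightarrow> 'k poly set" where
  "slices I n \<equiv> slice n ` I"

lemma slice_systemD:
  assumes "slice_system W"
  shows "kpoly.subspace (W n)" "p \<in> W n \<Longrightarrow> degree p \<le> n" "p \<in> W n \<Longrightarrow> p \<in> W (Suc n)"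
    "p \<in> W n \<Longrightarrow> pCons 0 p \<in> W (Suc n)"
  using assms unfolding slice_system_def by auto

lemma monom_mult_Suc: "monom c (Suc b) * p = pCons 0 (monom c b * p)"
  by (simp add: monom_Suc)

lemma slice_system_monom_mult:
  assumes W: "slice_system W" and p: "p \<in> W k"
  shows "monom c b * p \<in> W (k + b + a)"
proof -
  have "monom c b * p \<in> W (k + b)"
  proof (induction b)
    case 0
    show ?case using kpoly.subspace_scale[OF slice_systemD(1)[OF W] p, of c] by (simp add: monom_0)
  next
    case (Suc b)
    then show ?case using slice_systemD(4)[OF W] by (simp add: monom_mult_Suc)
  qed
  then show ?thesis by (induction a) (use slice_systemD(3)[OF W] in auto)
qed

lemma slice_mult_in_slices:
  assumes W: "slice_system W" and f: "\<And>k. slice k f \<in> W k"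
  shows "slice n (h * f) \<in> W n"
  unfolding slice_mult
proof (rule kpoly.subspace_sum[OF slice_systemD(1)[OF W]])
  fix m :: monomial
  obtain a b where m: "m = (a, b)" by force
  show "(if mdeg m \<le> n then monom (Poly_Mapping.lookup h m) (snd m) * slice (n - mdeg m) f else 0) \<in> W n"
  proof (cases "mdeg m \<le> n")
    case True
    have "n - mdeg m + b + a = n" using True by (simp add: m mdeg_def)
    then show ?thesis
      using slice_system_monom_mult[OF W f[of "n - mdeg m"], of "Poly_Mapping.lookup h m" b a] True
      by (simp add: m)
  qed (use kpoly.subspace_0[OF slice_systemD(1)[OF W]] in auto)
qed

lemma slices_ideal_of_slices:
  assumes "slice_system W" shows "slices (ideal_of_slices W) n = W n"
proof
  show "W n \<subseteq> slices (ideal_of_slices W) n"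
  proof
    fix p assume p: "p \<in> W n"
    have "slice k (homog n p) \<in> W k" for k
      using p slice_systemD(2)[OF assms p] kpoly.subspace_0[OF slice_systemD(1)[OF assms, of k]]
      by (cases "k = n") (auto simp: slice_homog_same slice_homog_other)
    then have "homog n p \<in> ideal_of_slices W" by (simp add: ideal_of_slices_def)
    then show "p \<in> slices (ideal_of_slices W) n"
      using slice_homog_same[OF slice_systemD(2)[OF assms p]] by force
  qed
qed (auto simp: ideal_of_slices_def)

lemma graded_ideal_of_slices:
  assumes W: "slice_system W" shows "graded_ideal (ideal_of_slices W)"
  unfolding graded_ideal_def
proof (intro conjI ballI allI)
  show "ideal.subspace (ideal_of_slices W)"
    by (rule ideal.subspaceI)
      (auto simp: ideal_of_slices_def slice_add slice_mult_in_slices[OF W]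
        kpoly.subspace_0[OF slice_systemD(1)[OF W]] kpoly.subspace_add[OF slice_systemD(1)[OF W]])
next
  fix f n assume "f \<in> ideal_of_slices W"
  then have "slice k (homog n (slice n f)) \<in> W k" for k
    using kpoly.subspace_0[OF slice_systemD(1)[OF W, of k]]
    by (cases "k = n") (auto simp: ideal_of_slices_def slice_homog_same[OF degree_slice] slice_homog_other)
  then show "hom_component n f \<in> ideal_of_slices W"
    by (simp add: ideal_of_slices_def hom_component_eq)
qed

lemma graded_ideal_subspaces:
  assumes "graded_ideal I"
  shows "kvec.subspace I" "ideal.subspace I"
    "f \<in> I \<Longrightarrow> homog n (slice n f) \<in> I"
    "p \<in> slices I n \<Longrightarrow> homog n p \<in> I"
proof -
  show *: "ideal.subspace I" using assms by (simp add: graded_ideal_def)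
  show "kvec.subspace I"
    by (rule kvec.subspaceI)
      (auto simp: const_scale_def intro: ideal.subspace_0[OF *] ideal.subspace_add[OF *] ideal.subspace_scale[OF *])
  show **: "homog n (slice n f) \<in> I" if "f \<in> I" for f n
    using assms that unfolding graded_ideal_def hom_component_eq[symmetric] by blast
  show "p \<in> slices I n \<Longrightarrow> homog n p \<in> I" using ** by auto
qed

lemma sum_hom_components:
  obtains N where "f = (\<Sum>n\<le>N. homog n (slice n f))"
proof -
  obtain N where N: "\<And>m. m \<in> Poly_Mapping.keys f \<Longrightarrow> mdeg m \<le> N"
    using finite_nat_set_iff_bounded_le[of "mdeg ` Poly_Mapping.keys f"] by auto
  have "slice k f = 0" if "k > N" for k
  proof (rule poly_eqI)
    fix b
    have "(k - b, b) \<notin> Poly_Mapping.keys f" if "b \<le> k"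
      using N[of "(k - b, b)"] that \<open>k > N\<close> by (auto simp: mdeg_def)
    then show "coeff (slice k f) b = coeff 0 b" by (auto simp: coeff_slice in_keys_iff)
  qed
  then have "slice k f = slice k (\<Sum>n\<le>N. homog n (slice n f))" for k
  proof -
    have "slice k (\<Sum>n\<le>N. homog n (slice n f)) = (\<Sum>n\<le>N. if n = k then slice k f else 0)"
      unfolding slice_sum
      by (intro sum.cong) (auto simp: slice_homog_same[OF degree_slice] slice_homog_other)
    then show ?thesis using \<open>\<And>k. k > N \<Longrightarrow> slice k f = 0\<close>[of k] by auto
  qed
  then show ?thesis using that poly_mapping_eqI_slice by blast
qed

text \<open>
  Together with \<open>slices_ideal_of_slices\<close> this is a bijection between graded ideals and slice systems;
  all later arguments take place on the side of the slices.
\<close>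

lemma graded_ideal_slices:
  assumes I: "graded_ideal I"
  shows "slice_system (slices I)" and "ideal_of_slices (slices I) = I"
proof -
  note J = graded_ideal_subspaces[OF I]
  have lin: "kpoly.subspace (slices I n)" for n
    unfolding kpoly.subspace_def
  proof (intro conjI ballI allI)
    show "0 \<in> slices I n" using kvec.subspace_0[OF J(1)] by (metis image_eqI slice_zero)
  next
    fix p q assume "p \<in> slices I n" "q \<in> slices I n"
    then show "p + q \<in> slices I n"
      using kvec.subspace_add[OF J(1)] by (auto simp: slice_add[symmetric])
  next
    fix c p assume "p \<in> slices I n"
    then show "smult c p \<in> slices I n"
      using kvec.subspace_scale[OF J(1)] by (auto simp: slice_const_scale[symmetric])
  qed
  have step: "p \<in> slices I (Suc n)" "pCons 0 p \<in> slices I (Suc n)" if p: "p \<in> slices I n" for p n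
  proof -
    have deg: "degree p \<le> n" using p degree_slice by auto
    have "Poly_Mapping.single (1, 0) 1 * homog n p \<in> I" "Poly_Mapping.single (0, 1) 1 * homog n p \<in> I"
      using J(4)[OF p] ideal.subspace_scale[OF J(2)] by auto
    moreover have "slice (Suc n) (Poly_Mapping.single (1, 0) 1 * homog n p) = p"
      "slice (Suc n) (Poly_Mapping.single (0, 1) 1 * homog n p) = pCons 0 p"
      using slice_homog_same[OF deg] monom_mult_Suc[of 1 0 p] by (simp_all add: slice_single_mult)
    ultimately show "p \<in> slices I (Suc n)" "pCons 0 p \<in> slices I (Suc n)" by force+
  qed
  show "slice_system (slices I)" unfolding slice_system_def
    using lin step degree_slice by (metis imageE)
  show "ideal_of_slices (slices I) = I"
  proof
    show "I \<subseteq> ideal_of_slices (slices I)" by (auto simp: ideal_of_slices_def)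
    show "ideal_of_slices (slices I) \<subseteq> I"
    proof
      fix f assume f: "f \<in> ideal_of_slices (slices I)"
      obtain N where N: "f = (\<Sum>n\<le>N. homog n (slice n f))" by (rule sum_hom_components)
      have "(\<Sum>n\<le>N. homog n (slice n f)) \<in> I"
        using f J(4) unfolding ideal_of_slices_def by (intro kvec.subspace_sum[OF J(1)]) auto
      then show "f \<in> I" using N by simp
    qed
  qed
qed


section \<open>Monomial ideals, initial ideals and cells\<close>

text \<open>
  The degree of the first monomial in row \<open>b\<close> that lies outside the diagram of \<open>P\<close>. As \<open>P ! b\<close> is
  only meaningful below \<open>length P\<close>, rows beyond the diagram are treated as empty.
\<close>

definition row_degree :: "nat list \<Rightarrow> nat \<Rightarrow> nat" where
  "row_degree P b = b + (if b < length P then P ! b else 0)"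

text \<open>
  The \<open>y\<close>-degrees of the monomials of degree \<open>n\<close> in \<open>E_set P\<close>.
\<close>

definition lead_set :: "nat list \<Rightarrow> nat \<Rightarrow> nat set" where
  "lead_set P n = {b. row_degree P b \<le> n}"

definition leading_degrees :: "'k::field poly set \<Rightarrow> nat set" where
  "leading_degrees V = degree ` (V - {0})"

lemma E_set_iff: "(a, b) \<in> E_set P \<longleftrightarrow> row_degree P b \<le> a + b"
  by (auto simp: E_set_def C_set_def row_degree_def)

lemma row_degree_ge: "b \<le> row_degree P b"
  by (simp add: row_degree_def)

lemma lead_set_le: "b \<in> lead_set P n \<Longrightarrow> b \<le> n"
  using row_degree_ge[of b P] by (simp add: lead_set_def)

lemma finite_lead_set [simp]: "finite (lead_set P n)"
  by (rule finite_subset[of _ "{..n}"]) (auto dest: lead_set_le)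

lemma row_degree_Suc:
  assumes "is_partition P" shows "row_degree P (Suc b) \<le> Suc (row_degree P b)"
proof (cases "Suc b < length P")
  case True
  then have "P ! Suc b \<le> P ! b"
    using assms unfolding is_partition_def sorted_wrt_iff_nth_less by auto
  then show ?thesis using True by (simp add: row_degree_def)
qed (simp add: row_degree_def)

lemma lead_set_mono: "b \<in> lead_set P n \<Longrightarrow> n \<le> n' \<Longrightarrow> b \<in> lead_set P n'"
  by (simp add: lead_set_def)

lemma lead_set_Suc: "is_partition P \<Longrightarrow> b \<in> lead_set P n \<Longrightarrow> Suc b \<in> lead_set P (Suc n)"
  using row_degree_Suc[of P b] by (simp add: lead_set_def)

definition upward_closed :: "monomial set \<Rightarrow> bool" where
  "upward_closed S \<longleftrightarrow> (\<forall>m\<in>S. \<forall>m'. m + m' \<in> S)"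

lemma upward_closedI:
  assumes "\<And>a b. (a, b) \<in> S \<Longrightarrow> (Suc a, b) \<in> S" "\<And>a b. (a, b) \<in> S \<Longrightarrow> (a, Suc b) \<in> S"
  shows "upward_closed S"
proof -
  have 1: "(a + c, b) \<in> S" if "(a, b) \<in> S" for a b c
    using that by (induction c) (auto intro: assms)
  have "(a + c, b + e) \<in> S" if "(a, b) \<in> S" for a b c e
    using 1[OF that, of c] by (induction e) (auto intro: assms)
  then show ?thesis by (auto simp: upward_closed_def)
qed

lemma upward_closed_E_set:
  assumes "is_partition P" shows "upward_closed (E_set P)"
proof (rule upward_closedI)
  fix a b assume "(a, b) \<in> E_set P"
  then show "(Suc a, b) \<in> E_set P" "(a, Suc b) \<in> E_set P"
    using row_degree_Suc[OF assms, of b] by (auto simp: E_set_iff)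
qed

lemma keys_mono_poly [simp]: "Poly_Mapping.keys (mono_poly m :: 'k::field xy_poly) = {m}"
  by (simp add: mono_poly_def)

text \<open>
  An upward closed set contains every multiple of its elements, so the ideal it generates is just its
  \<open>k\<close>-linear span.
\<close>

lemma span_monomials:
  assumes "upward_closed S"
  shows "ideal.span (mono_poly ` S) = {f :: 'k::field xy_poly. Poly_Mapping.keys f \<subseteq> S}"
proof
  show "ideal.span (mono_poly ` S) \<subseteq> {f :: 'k xy_poly. Poly_Mapping.keys f \<subseteq> S}"
  proof (rule ideal.span_minimal)
    show "ideal.subspace {f :: 'k xy_poly. Poly_Mapping.keys f \<subseteq> S}"
    proof (rule ideal.subspaceI)
      fix f g :: "'k xy_poly"
      assume "f \<in> {f. Poly_Mapping.keys f \<subseteq> S}" "g \<in> {f. Poly_Mapping.keys f \<subseteq> S}"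
      then show "f + g \<in> {f. Poly_Mapping.keys f \<subseteq> S}" using keys_add[of f g] by auto
    next
      fix c f :: "'k xy_poly"
      assume f: "f \<in> {f. Poly_Mapping.keys f \<subseteq> S}"
      show "c * f \<in> {f. Poly_Mapping.keys f \<subseteq> S}"
      proof (intro CollectI subsetI)
        fix m assume "m \<in> Poly_Mapping.keys (c * f)"
        then obtain u v where "m = u + v" "v \<in> Poly_Mapping.keys f" using keys_mult[of c f] by blast
        then show "m \<in> S" using f assms unfolding upward_closed_def by (metis add.commute mem_Collect_eq subsetD)
      qed
    qed simp
  qed auto
  show "{f :: 'k xy_poly. Poly_Mapping.keys f \<subseteq> S} \<subseteq> ideal.span (mono_poly ` S)"
  proof
    fix f :: "'k xy_poly" assume f: "f \<in> {f. Poly_Mapping.keys f \<subseteq> S}"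
    have "Poly_Mapping.single m (Poly_Mapping.lookup f m) = Poly_Mapping.single 0 (Poly_Mapping.lookup f m) * mono_poly m" for m
      by (simp add: mono_poly_def mult_single)
    then have "Poly_Mapping.single m (Poly_Mapping.lookup f m) \<in> ideal.span (mono_poly ` S)"
      if "m \<in> Poly_Mapping.keys f" for m
      using that f by (metis (no_types, lifting) ideal.span_base ideal.span_scale imageI mem_Collect_eq subsetD)
    then show "f \<in> ideal.span (mono_poly ` S)"
      by (subst poly_mapping_sum_single) (auto intro!: ideal.span_sum)
  qed
qed

lemma span_monomials_eq_iff:
  assumes "upward_closed S" "upward_closed S'"
  shows "(ideal.span (mono_poly ` S) :: 'k::field xy_poly set) = ideal.span (mono_poly ` S') \<longleftrightarrow> S = S'"
proof
  assume e: "(ideal.span (mono_poly ` S) :: 'k xy_poly set) = ideal.span (mono_poly ` S')"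
  have "m \<in> S \<longleftrightarrow> (mono_poly m :: 'k xy_poly) \<in> ideal.span (mono_poly ` S)" for m
    by (simp add: span_monomials[OF assms(1)])
  moreover have "m \<in> S' \<longleftrightarrow> (mono_poly m :: 'k xy_poly) \<in> ideal.span (mono_poly ` S')" for m
    by (simp add: span_monomials[OF assms(2)])
  ultimately show "S = S'" using e by blast
qed simp

text \<open>
  For monomials of the same degree, the highest \<open>y\<close>-degree is the degree of the dehomogenized
  polynomial.
\<close>

lemma initial_monomial_form:
  assumes f: "f \<in> forms n" "f \<noteq> 0"
  shows "initial_monomial f = (n - degree (slice n f), degree (slice n f))"
proof -
  define p where "p = slice n f"
  have "p \<noteq> 0"
    using f homog_slice[OF f(1)] unfolding p_def by (metis forms_iff poly_mapping_eqI_slice slice_zero)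
  have deg: "degree p \<le> n" by (simp add: p_def degree_slice)
  have keys: "m \<in> Poly_Mapping.keys f \<longleftrightarrow> mdeg m = n \<and> coeff p (snd m) \<noteq> 0" for m
  proof -
    obtain a b where m: "m = (a, b)" by force
    show ?thesis
      using lookup_homog[of n p a b] homog_slice[OF f(1)] unfolding p_def[symmetric]
      by (auto simp: m in_keys_iff mdeg_def)
  qed
  have k: "(n - degree p, degree p) \<in> Poly_Mapping.keys f"
    using deg \<open>p \<noteq> 0\<close> by (simp add: keys mdeg_def)
  show ?thesis
    unfolding initial_monomial_def p_def[symmetric]
  proof (rule arg_maxI[where P = "\<lambda>m. m \<in> Poly_Mapping.keys f", OF k])
    fix m assume "m \<in> Poly_Mapping.keys f"
    then show "\<not> snd (n - degree p, degree p) < snd m" using le_degree[of p] by (force simp: keys)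
  next
    fix m assume m: "m \<in> Poly_Mapping.keys f" "\<forall>y. y \<in> Poly_Mapping.keys f \<longrightarrow> \<not> snd m < snd y"
    then have "snd m = degree p" using k le_degree[of p "snd m"] keys[of m] by fastforce
    then show "m = (n - degree p, degree p)" using m keys[of m] by (cases m) (auto simp: mdeg_def)
  qed
qed

lemma initial_monomials_graded_ideal:
  fixes I :: "'k::field xy_poly set"
  assumes I: "graded_ideal I"
  shows "{mono_poly (initial_monomial f) | f n. f \<in> I \<and> f \<in> forms n \<and> f \<noteq> 0}
     = (mono_poly ` {(a, b). b \<in> leading_degrees (slices I (a + b))} :: 'k xy_poly set)"
proof (intro set_eqI iffI)
  fix g assume "g \<in> {mono_poly (initial_monomial f) | f n. f \<in> I \<and> f \<in> forms n \<and> f \<noteq> 0}"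
  then obtain f n where f: "g = mono_poly (initial_monomial f)" "f \<in> I" "f \<in> forms n" "f \<noteq> 0" by blast
  have "slice n f \<noteq> 0" using f homog_slice[OF f(3)] by (metis forms_iff poly_mapping_eqI_slice slice_zero)
  then show "g \<in> mono_poly ` {(a, b). b \<in> leading_degrees (slices I (a + b))}"
    using f degree_slice[of n f] by (auto simp: initial_monomial_form leading_degrees_def)
next
  fix g :: "'k xy_poly" assume "g \<in> mono_poly ` {(a, b). b \<in> leading_degrees (slices I (a + b))}"
  then obtain a b where ab: "g = mono_poly (a, b)" "b \<in> leading_degrees (slices I (a + b))" by auto
  then obtain p where p: "p \<in> slices I (a + b)" "p \<noteq> 0" "degree p = b" unfolding leading_degrees_def by force
  then obtain f where "f \<in> I" "p = slice (a + b) f" by blast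
  with p ab(1) have f: "g = mono_poly (a, b)" "f \<in> I" "slice (a + b) f \<noteq> 0" "degree (slice (a + b) f) = b"
    by auto
  define h where "h = homog (a + b) (slice (a + b) f)"
  have h: "h \<in> I" "h \<in> forms (a + b)" "slice (a + b) h = slice (a + b) f"
    using graded_ideal_subspaces(3)[OF I f(2)] slice_homog_same[OF degree_slice]
    by (auto simp: h_def homog_in_forms)
  then have "h \<noteq> 0" using f by (metis slice_zero)
  then have "initial_monomial h = (a, b)" using initial_monomial_form[OF h(2)] h f by simp
  then show "g \<in> {mono_poly (initial_monomial f) | f n. f \<in> I \<and> f \<in> forms n \<and> f \<noteq> 0}"
    using h f \<open>h \<noteq> 0\<close> by (metis (mono_tags, lifting) mem_Collect_eq)
qed

lemma leading_degrees_slice_system: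
  assumes W: "slice_system W" and b: "b \<in> leading_degrees (W n)"
  shows "b \<le> n" "b \<in> leading_degrees (W (Suc n))" "Suc b \<in> leading_degrees (W (Suc n))"
proof -
  obtain p where p: "p \<in> W n" "p \<noteq> 0" "degree p = b" using b unfolding leading_degrees_def by auto
  show "b \<le> n" using slice_systemD(2)[OF W p(1)] p by simp
  show "b \<in> leading_degrees (W (Suc n))" using slice_systemD(3)[OF W p(1)] p unfolding leading_degrees_def by blast
  have "degree (pCons 0 p) = Suc b" "pCons 0 p \<noteq> 0" using p by auto
  then show "Suc b \<in> leading_degrees (W (Suc n))" using slice_systemD(4)[OF W p(1)] unfolding leading_degrees_def by force
qed

text \<open>
  The initial ideal and \<open>E_ideal P\<close> are generated by upward closed sets of monomials, so they are
  equal iff these sets are; the two sets are compared degree by degree.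
\<close>

lemma cell_iff:
  fixes I :: "'k::field xy_poly set"
  assumes P: "is_partition P"
  shows "I \<in> cell P \<longleftrightarrow> graded_ideal I \<and> (\<forall>n. leading_degrees (slices I n) = lead_set P n)"
proof (cases "graded_ideal I")
  case True
  define S where "S = {(a, b). b \<in> leading_degrees (slices I (a + b))}"
  have W: "slice_system (slices I)" by (rule graded_ideal_slices[OF True])
  have "upward_closed S"
    by (rule upward_closedI) (auto simp: S_def leading_degrees_slice_system(2,3)[OF W])
  moreover have "initial_ideal I = ideal.span (mono_poly ` S)"
    unfolding initial_ideal_def S_def initial_monomials_graded_ideal[OF True] ..
  ultimately have "I \<in> cell P \<longleftrightarrow> S = E_set P"
    using True span_monomials_eq_iff[OF _ upward_closed_E_set[OF P]]
    by (simp add: cell_def E_ideal_def)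
  also have "\<dots> \<longleftrightarrow> (\<forall>n. leading_degrees (slices I n) = lead_set P n)"
  proof
    assume S: "S = E_set P"
    show "\<forall>n. leading_degrees (slices I n) = lead_set P n"
    proof (intro allI set_eqI)
      fix n b
      have "b \<in> leading_degrees (slices I n) \<longleftrightarrow> b \<le> n \<and> (n - b, b) \<in> S"
        using leading_degrees_slice_system(1)[OF W] by (auto simp: S_def)
      also have "\<dots> \<longleftrightarrow> b \<in> lead_set P n"
        using row_degree_ge[of b P] by (auto simp: S E_set_iff lead_set_def)
      finally show "b \<in> leading_degrees (slices I n) \<longleftrightarrow> b \<in> lead_set P n" .
    qed
  next
    assume "\<forall>n. leading_degrees (slices I n) = lead_set P n"
    then show "S = E_set P" by (auto simp: S_def E_set_iff lead_set_def)
  qed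
  finally show ?thesis using True by simp
qed (simp add: cell_def)

lemma kvec_dim_keys:
  fixes S :: "monomial set"
  assumes "finite S"
  shows "kvec.dim {f :: 'k::field xy_poly. Poly_Mapping.keys f \<subseteq> S} = card S"
proof -
  let ?B = "(mono_poly :: monomial \<Rightarrow> 'k xy_poly) ` S"
  have inj: "inj (mono_poly :: monomial \<Rightarrow> 'k xy_poly)"
    by (rule injI) (metis keys_mono_poly singleton_inject)
  have sub: "kvec.subspace {f :: 'k xy_poly. Poly_Mapping.keys f \<subseteq> T}" for T
  proof (rule kvec.subspaceI)
    fix f g :: "'k xy_poly"
    assume "f \<in> {f. Poly_Mapping.keys f \<subseteq> T}" "g \<in> {f. Poly_Mapping.keys f \<subseteq> T}"
    then show "f + g \<in> {f. Poly_Mapping.keys f \<subseteq> T}" using keys_add[of f g] by auto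
  next
    fix c and f :: "'k xy_poly"
    assume f: "f \<in> {f. Poly_Mapping.keys f \<subseteq> T}"
    have "Poly_Mapping.lookup (const_scale c f) (a, b) = c * Poly_Mapping.lookup f (a, b)" for a b
      using lookup_single_mult[of 0 0 c f a b] by (simp add: const_scale_def zero_prod_def)
    then have "Poly_Mapping.keys (const_scale c f) \<subseteq> Poly_Mapping.keys f" by (auto simp: in_keys_iff)
    then show "const_scale c f \<in> {f. Poly_Mapping.keys f \<subseteq> T}" using f by blast
  qed simp
  have "kvec.independent ?B"
    unfolding kvec.dependent_def
  proof safe
    fix m assume m: "m \<in> S" "(mono_poly m :: 'k xy_poly) \<in> kvec.span (?B - {mono_poly m})"
    have "kvec.span (?B - {mono_poly m}) \<subseteq> {f :: 'k xy_poly. Poly_Mapping.keys f \<subseteq> - {m}}"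
      by (rule kvec.span_minimal[OF _ sub]) auto
    then show False using m(2) by auto
  qed
  moreover have "{f :: 'k xy_poly. Poly_Mapping.keys f \<subseteq> S} \<subseteq> kvec.span ?B"
  proof
    fix f :: "'k xy_poly" assume f: "f \<in> {f. Poly_Mapping.keys f \<subseteq> S}"
    have "Poly_Mapping.single m (Poly_Mapping.lookup f m) = const_scale (Poly_Mapping.lookup f m) (mono_poly m)" for m
      by (simp add: mono_poly_def mult_single const_scale_def)
    then have "Poly_Mapping.single m (Poly_Mapping.lookup f m) \<in> kvec.span ?B" if "m \<in> Poly_Mapping.keys f" for m
      using that f by (metis (no_types, lifting) kvec.span_base kvec.span_scale imageI mem_Collect_eq subsetD)
    then show "f \<in> kvec.span ?B" by (subst poly_mapping_sum_single) (auto intro!: kvec.span_sum)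
  qed
  moreover have "?B \<subseteq> {f. Poly_Mapping.keys f \<subseteq> S}" by auto
  ultimately have "card ?B = kvec.dim {f :: 'k xy_poly. Poly_Mapping.keys f \<subseteq> S}"
    by (intro kvec.basis_card_eq_dim)
  then show ?thesis using card_image[of mono_poly S] inj by (metis inj_on_subset subset_UNIV)
qed

lemma diagonal_lengths_eq:
  assumes P: "is_partition P"
  shows "diagonal_lengths TYPE('k::field) P n = Suc n - card (lead_set P n)"
proof -
  let ?i = "\<lambda>b. (n - b, b)"
  have deg: "mdeg (a, b) = n \<longleftrightarrow> b \<le> n \<and> a = n - b" for a b by (auto simp: mdeg_def)
  have "forms n = {f :: 'k xy_poly. Poly_Mapping.keys f \<subseteq> ?i ` {..n}}"
    unfolding forms_def using deg by (auto simp: subset_iff image_iff)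
  moreover have "card (?i ` {..n}) = Suc n" by (subst card_image) (auto simp: inj_on_def)
  ultimately have 1: "kvec.dim (forms n :: 'k xy_poly set) = Suc n"
    using kvec_dim_keys[of "?i ` {..n}"] by simp
  have "m \<in> ?i ` lead_set P n \<longleftrightarrow> m \<in> E_set P \<and> mdeg m = n" for m
  proof -
    obtain a b where m: "m = (a, b)" by force
    show ?thesis using deg[of a b] lead_set_le[of b P n] by (auto simp: m E_set_iff lead_set_def)
  qed
  then have "E_ideal P \<inter> forms n = {f :: 'k xy_poly. Poly_Mapping.keys f \<subseteq> ?i ` lead_set P n}"
    unfolding E_ideal_def span_monomials[OF upward_closed_E_set[OF P]] forms_def by blast
  moreover have "card (?i ` lead_set P n) = card (lead_set P n)" by (subst card_image) (auto simp: inj_on_def)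
  ultimately have "kvec.dim (E_ideal P \<inter> forms n :: 'k xy_poly set) = card (lead_set P n)"
    using kvec_dim_keys[of "?i ` lead_set P n"] by simp
  then show ?thesis by (simp add: diagonal_lengths_def hilbert_function_def 1)
qed


section \<open>Counting generators\<close>

lemma slice_form_other: "f \<in> forms n \<Longrightarrow> k \<noteq> n \<Longrightarrow> slice k f = 0"
  by (simp add: forms_iff)

text \<open>
  The slices of the product of the ideal with the maximal ideal \<open>(x, y)\<close>.
\<close>

definition lower_part :: "(nat \<Rightarrow> 'k::field poly set) \<Rightarrow> nat \<Rightarrow> 'k poly set" where
  "lower_part W n = (case n of 0 \<Rightarrow> {0} | Suc k \<Rightarrow> kpoly.span (W k \<union> pCons 0 ` W k))"

text \<open>
  The dimension of the component of degree \<open>n\<close> of \<open>I / \<mm> I\<close>, where \<open>\<mm> = (x, y)\<close>.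
\<close>

definition num_new_gens :: "(nat \<Rightarrow> 'k::field poly set) \<Rightarrow> nat \<Rightarrow> nat" where
  "num_new_gens W n = kpoly.dim (W n) - kpoly.dim (lower_part W n)"

lemma subspace_lower_part: "kpoly.subspace (lower_part W n)"
  by (cases n) (auto simp: lower_part_def)

lemma lower_part_mono:
  assumes "\<And>k. k < n \<Longrightarrow> W k \<subseteq> W' k" shows "lower_part W n \<subseteq> lower_part W' n"
proof (cases n)
  case (Suc k)
  have "W k \<union> pCons 0 ` W k \<subseteq> W' k \<union> pCons 0 ` W' k" using assms[of k] Suc by blast
  from kpoly.span_mono[OF this] show ?thesis by (simp add: lower_part_def Suc)
qed (simp add: lower_part_def)

lemma lower_part_subset:
  assumes "slice_system W" shows "lower_part W n \<subseteq> W n"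
proof (cases n)
  case (Suc k)
  have "W k \<union> pCons 0 ` W k \<subseteq> W n"
    unfolding Suc using slice_systemD(3,4)[OF assms, of _ k] by blast
  then show ?thesis
    using kpoly.span_minimal[OF _ slice_systemD(1)[OF assms]] by (simp add: lower_part_def Suc)
qed (use kpoly.subspace_0[OF slice_systemD(1)[OF assms]] in \<open>auto simp: lower_part_def\<close>)

lemma subset_span_monoms:
  assumes "slice_system W" shows "W n \<subseteq> kpoly.span (monom 1 ` {..n})"
proof
  fix p assume "p \<in> W n"
  then have "p = (\<Sum>i\<le>n. monom (coeff p i) i)"
    using slice_systemD(2)[OF assms] by (simp add: poly_as_sum_of_monoms')
  also have "\<dots> = (\<Sum>i\<le>n. smult (coeff p i) (monom 1 i))" by (simp add: smult_monom)
  also have "\<dots> \<in> kpoly.span (monom 1 ` {..n})"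
    by (intro kpoly.span_sum kpoly.span_scale kpoly.span_base) auto
  finally show "p \<in> kpoly.span (monom 1 ` {..n})" .
qed

text \<open>
  Modulo \<open>\<mm> I\<close> only the constant term of a multiplier \<open>h\<close> matters. This is why generators of the ideal
  \<open>I\<close> span \<open>I / \<mm> I\<close> over the field.
\<close>

lemma slice_mult_lower_part:
  assumes W: "slice_system W" and f: "\<And>k. k < n \<Longrightarrow> slice k f \<in> W k"
  shows "slice n (h * f) - smult (Poly_Mapping.lookup h 0) (slice n f) \<in> lower_part W n"
proof -
  note sub = subspace_lower_part[of W n]
  let ?t = "\<lambda>m. if mdeg m \<le> n then monom (Poly_Mapping.lookup h m) (snd m) * slice (n - mdeg m) f else 0"
  have *: "?t m \<in> lower_part W n" if m: "m \<noteq> 0" for m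
  proof (cases "mdeg m \<le> n")
    case True
    obtain a b where ab: "m = (a, b)" by force
    with m have pos: "a + b > 0" by (auto simp: zero_prod_def)
    obtain n' where n': "n = Suc n'" using True pos by (cases n) (auto simp: ab mdeg_def)
    let ?c = "Poly_Mapping.lookup h m"
    let ?p = "slice (n - (a + b)) f"
    have p: "?p \<in> W (n - (a + b))" using f pos n' by auto
    have "monom ?c b * ?p \<in> W n' \<union> pCons 0 ` W n'"
    proof (cases b)
      case 0
      then have "n - (a + b) + 0 + (a - 1) = n'" using True pos n' by (simp add: ab mdeg_def)
      then show ?thesis using slice_system_monom_mult[OF W p, of ?c 0 "a - 1"] 0 by simp
    next
      case (Suc b')
      have "n - (a + b) + b' + a = n'" using True pos n' Suc by (simp add: ab mdeg_def)
      then show ?thesis using slice_system_monom_mult[OF W p, of ?c b' a]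
        by (simp add: Suc monom_mult_Suc)
    qed
    then show ?thesis using True by (simp add: ab mdeg_def n' lower_part_def kpoly.span_base)
  qed (simp add: kpoly.subspace_0[OF sub])
  have "slice n (h * f) = ?t 0 + (\<Sum>m\<in>Poly_Mapping.keys h - {0}. ?t m)"
    unfolding slice_mult by (cases "0 \<in> Poly_Mapping.keys h") (simp_all add: sum.remove in_keys_iff)
  moreover have "?t 0 = smult (Poly_Mapping.lookup h 0) (slice n f)"
    by (simp add: mdeg_def monom_0)
  moreover have "(\<Sum>m\<in>Poly_Mapping.keys h - {0}. ?t m) \<in> lower_part W n"
    using * by (intro kpoly.subspace_sum[OF sub]) auto
  ultimately show ?thesis by simp
qed

lemma forms_mult:
  assumes "f \<in> forms i" "g \<in> forms k" shows "f * g \<in> forms (i + k)"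
proof -
  have "mdeg m = i + k" if "m \<in> Poly_Mapping.keys (f * g)" for m
    using that keys_mult[of f g] assms by (force simp: forms_def mdeg_def)
  then show ?thesis by (simp add: forms_def)
qed

lemma graded_ideal_span_forms:
  assumes G: "G \<subseteq> (\<Union>n. forms n)"
  shows "graded_ideal (ideal.span G)"
  unfolding graded_ideal_def
proof (intro conjI ballI allI)
  fix f n assume "f \<in> ideal.span G"
  then show "hom_component n f \<in> ideal.span G"
  proof (induction rule: ideal.span_induct_alt)
    case base
    show ?case by (simp add: hom_component_eq homog_def ideal.span_zero)
  next
    case (step r g y)
    obtain k where k: "g \<in> forms k" using step G by blast
    obtain N where N: "r = (\<Sum>i\<le>N. homog i (slice i r))" by (rule sum_hom_components)
    let ?h = "\<lambda>i. homog i (slice i r) * g"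
    have "homog n (slice n (?h i)) \<in> ideal.span G" for i
    proof (cases "i + k = n")
      case True
      then have "homog n (slice n (?h i)) = ?h i"
        using homog_slice forms_mult[OF homog_in_forms k, of i] by metis
      then show ?thesis using step by (simp add: ideal.span_base ideal.span_scale)
    next
      case False
      then show ?thesis
        using slice_form_other[OF forms_mult[OF homog_in_forms k]] by (simp add: homog_def ideal.span_zero)
    qed
    then have "(\<Sum>i\<le>N. homog n (slice n (?h i))) \<in> ideal.span G" by (intro ideal.span_sum)
    moreover have "homog n (slice n (r * g)) = (\<Sum>i\<le>N. homog n (slice n (?h i)))"
    proof -
      have "r * g = (\<Sum>i\<le>N. homog i (slice i r)) * g" using N by simp
      then have "r * g = (\<Sum>i\<le>N. ?h i)" by (simp only: sum_distrib_right)
      then have "homog n (slice n (r * g)) = homog n (\<Sum>i\<le>N. slice n (?h i))" by (simp add: slice_sum)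
      also have "\<dots> = (\<Sum>i\<le>N. homog n (slice n (?h i)))"
        by (induction N) (simp_all add: homog_add)
      finally show ?thesis .
    qed
    ultimately show ?case using step
      by (simp add: hom_component_eq slice_add homog_add ideal.span_add)
  qed
qed simp

lemma slices_span_forms:
  assumes G: "G \<subseteq> (\<Union>n. forms n)" and W: "W = slices (ideal.span G)"
  shows "W n = kpoly.span (lower_part W n \<union> slice n ` {g \<in> G. g \<in> forms n})"
proof
  let ?S = "kpoly.span (lower_part W n \<union> slice n ` {g \<in> G. g \<in> forms n})"
  have gr: "slice_system W" unfolding W by (rule graded_ideal_slices[OF graded_ideal_span_forms[OF G]])
  show "?S \<subseteq> W n"
    using lower_part_subset[OF gr] slice_systemD(1)[OF gr]
    by (intro kpoly.span_minimal) (auto simp: W ideal.span_base)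
  show "W n \<subseteq> ?S"
  proof
    fix p assume "p \<in> W n"
    then obtain f where f: "f \<in> ideal.span G" "p = slice n f" using W by auto
    from f(1) have "slice n f \<in> ?S"
    proof (induction rule: ideal.span_induct_alt)
      case (step r g y)
      have "slice n (r * g) - smult (Poly_Mapping.lookup r 0) (slice n g) \<in> lower_part W n"
        using step by (intro slice_mult_lower_part[OF gr]) (auto simp: W ideal.span_base)
      then have 1: "slice n (r * g) - smult (Poly_Mapping.lookup r 0) (slice n g)
          \<in> ?S"
        by (simp add: kpoly.span_base)
      have 2: "slice n g \<in> ?S"
      proof (cases "g \<in> forms n")
        case False
        then obtain k where "g \<in> forms k" "k \<noteq> n" using step G by blast
        then show ?thesis using slice_form_other[of g k n] by (simp add: kpoly.span_zero)
      qed (use step in \<open>auto intro!: kpoly.span_base\<close>)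
      show ?case
        using kpoly.span_add[OF kpoly.span_add[OF 1 kpoly.span_scale[OF 2, of "Poly_Mapping.lookup r 0"]] step.IH]
        by (simp add: slice_add)
    qed (simp add: kpoly.span_zero)
    then show "p \<in> ?S" using f by simp
  qed
qed

text \<open>
  Suppose the slice of a generator \<open>g\<close> of degree \<open>n\<close> depends on \<open>\<mm> I\<close> and the other generators of
  degree \<open>n\<close>. The other generators already generate \<open>I\<close> in all degrees below \<open>n\<close>, hence contain
  \<open>(\<mm> I)\<close> in degree \<open>n\<close>, hence generate \<open>g\<close>, against minimality.
\<close>

lemma minimal_gens_indep:
  assumes G: "minimal_homogeneous_gens I G" and W: "W = slices I"
  shows "indep_mod kpoly.span (lower_part W n) (slice n ` {g \<in> G. g \<in> forms n})"
  unfolding indep_mod_def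
proof (intro ballI notI)
  fix p assume "p \<in> slice n ` {g \<in> G. g \<in> forms n}"
  then obtain g where g: "g \<in> G" "g \<in> forms n" "p = slice n g" by blast
  assume p: "p \<in> kpoly.span (lower_part W n \<union> (slice n ` {g \<in> G. g \<in> forms n} - {p}))"
  have Gf: "G \<subseteq> (\<Union>n. forms n)" and I: "I = ideal.span G"
    and min: "\<And>G'. G' \<subset> G \<Longrightarrow> ideal.span G' \<noteq> I"
    using G unfolding minimal_homogeneous_gens_def by auto
  define J where "J = ideal.span (G - {g})"
  have ne: "J \<noteq> I" unfolding J_def using g by (intro min) auto
  have "g \<noteq> 0"
  proof
    assume "g = 0"
    then have "G \<subseteq> J" unfolding J_def using ideal.span_superset[of "G - {g}"] ideal.span_zero by fastforce
    then show False using ne ideal.span_minimal[of G J] ideal.span_mono[of "G - {g}" G] by (auto simp: I J_def)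
  qed
  have grJ: "graded_ideal J" unfolding J_def using Gf by (intro graded_ideal_span_forms) auto
  note sJ = graded_ideal_slices(1)[OF grJ]
  have k: "W k \<subseteq> slices J k" if "k < n" for k
    using that
  proof (induction k rule: less_induct)
    case (less k)
    have "g \<notin> forms k"
    proof
      assume "g \<in> forms k"
      then have "slice i g = slice i 0" for i
        using g(2) less.prems unfolding forms_iff by (cases "i = k") auto
      then show False using \<open>g \<noteq> 0\<close> poly_mapping_eqI_slice by blast
    qed
    then have "slice k ` {g \<in> G. g \<in> forms k} \<subseteq> slices J k"
      unfolding J_def by (auto intro!: imageI ideal.span_base)
    moreover have "lower_part W k \<subseteq> slices J k"
      using lower_part_mono[of k W "slices J"] lower_part_subset[OF sJ, of k] less by fastforce
    ultimately have "kpoly.span (lower_part W k \<union> slice k ` {g \<in> G. g \<in> forms k}) \<subseteq> slices J k"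
      using slice_systemD(1)[OF sJ] by (intro kpoly.span_minimal) auto
    then show ?case using slices_span_forms[OF Gf, of W k] W I by simp
  qed
  have "slice n ` {g \<in> G. g \<in> forms n} - {p} \<subseteq> slices J n"
    unfolding J_def g(3) by (auto intro!: imageI ideal.span_base)
  moreover have "lower_part W n \<subseteq> slices J n"
    using lower_part_mono[of n W "slices J"] lower_part_subset[OF sJ, of n] k by fastforce
  ultimately have "kpoly.span (lower_part W n \<union> (slice n ` {g \<in> G. g \<in> forms n} - {p})) \<subseteq> slices J n"
    using slice_systemD(1)[OF sJ] by (intro kpoly.span_minimal) auto
  then have "slice n g \<in> slices J n" using p g by auto
  then have "g \<in> J" using graded_ideal_subspaces(4)[OF grJ] homog_slice[OF g(2)] by metis
  then have "G \<subseteq> J" unfolding J_def using ideal.span_superset[of "G - {g}"] by blast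
  then show False using ne ideal.span_minimal[of G J] ideal.span_mono[of "G - {g}" G] by (auto simp: I J_def)
qed

lemma card_minimal_gens:
  assumes G: "minimal_homogeneous_gens I G"
  shows "card {g \<in> G. g \<in> forms n} = num_new_gens (slices I) n"
proof -
  let ?W = "slices I" and ?T = "slice n ` {g \<in> G. g \<in> forms n}"
  have Gf: "G \<subseteq> (\<Union>n. forms n)" and I: "I = ideal.span G"
    using G unfolding minimal_homogeneous_gens_def by auto
  have gr: "slice_system ?W" unfolding I by (rule graded_ideal_slices[OF graded_ideal_span_forms[OF Gf]])
  have "card ?T + kpoly.dim (lower_part ?W n) = kpoly.dim (?W n)"
    using kpoly.card_indep_mod_eq_dim_diff[OF subspace_lower_part minimal_gens_indep[OF G refl]
        slices_span_forms[OF Gf] _ subset_span_monoms[OF gr]] I by blast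
  moreover have "card ?T = card {g \<in> G. g \<in> forms n}"
    by (rule card_image) (rule inj_on_subset[OF inj_on_slice_forms], auto)
  ultimately show ?thesis by (simp add: num_new_gens_def)
qed

lemma exists_new_gens:
  assumes W: "slice_system W"
  shows "\<exists>T. T \<subseteq> W n \<and> indep_mod kpoly.span (lower_part W n) T
     \<and> kpoly.span (lower_part W n \<union> T) = W n \<and> finite T \<and> card T = num_new_gens W n"
proof -
  obtain T where T: "T \<subseteq> W n" "indep_mod kpoly.span (lower_part W n) T" "kpoly.span (lower_part W n \<union> T) = W n"
    using kpoly.exists_indep_mod_complement[OF subspace_lower_part slice_systemD(1)[OF W] lower_part_subset[OF W]] by blast
  moreover have "finite T \<and> card T + kpoly.dim (lower_part W n) = kpoly.dim (W n)"
    by (rule kpoly.card_indep_mod_eq_dim_diff[OF subspace_lower_part T(2) T(3)[symmetric] _ subset_span_monoms[OF W]]) simp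
  ultimately show ?thesis unfolding num_new_gens_def by (intro exI[of _ T]) auto
qed

text \<open>
  Lifts of bases of the components of \<open>I / \<mm> I\<close> generate \<open>I\<close>, by induction on the degree. They are
  also independent modulo \<open>\<mm> I\<close>, while an arbitrary generating set, homogeneous or not, spans \<open>I\<close> modulo
  \<open>\<mm> I\<close>; so no generating set is smaller.
\<close>

lemma min_num_gens_eq:
  assumes I: "graded_ideal I" and N: "\<And>n. n > N \<Longrightarrow> num_new_gens (slices I) n = 0"
  shows "min_num_gens I = (\<Sum>n\<le>N. num_new_gens (slices I) n)"
proof -
  define W where "W = slices I"
  have W: "slice_system W" "ideal_of_slices W = I" unfolding W_def by (rule graded_ideal_slices[OF I])+
  obtain T where T: "\<And>n. T n \<subseteq> W n" "\<And>n. indep_mod kpoly.span (lower_part W n) (T n)"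
     "\<And>n. kpoly.span (lower_part W n \<union> T n) = W n" "\<And>n. finite (T n)" "\<And>n. card (T n) = num_new_gens W n"
    using exists_new_gens[OF W(1)] by metis
  have T0: "T n = {}" if "n > N" for n using T(4,5)[of n] N[OF that] by (simp add: W_def)
  have Tdeg: "degree p \<le> n" if "p \<in> T n" for n p
    using that T(1)[of n] slice_systemD(2)[OF W(1), of p n] by blast
  have Tnz: "p \<noteq> 0" if "p \<in> T n" for n p
    using that T(2)[of n] kpoly.span_zero unfolding indep_mod_def by metis
  define H where "H = (\<Union>n\<le>N. homog n ` T n)"
  have finH: "finite H" unfolding H_def using T(4) by auto
  have cardH: "card H = (\<Sum>n\<le>N. num_new_gens W n)"
  proof -
    have "card H = (\<Sum>n\<le>N. card (homog n ` T n))"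
      unfolding H_def
    proof (rule card_UN_disjoint)
      show "\<forall>i\<in>{..N}. \<forall>k\<in>{..N}. i \<noteq> k \<longrightarrow> homog i ` T i \<inter> homog k ` T k = {}"
      proof (intro ballI impI, rule ccontr)
        fix i k assume ik: "i \<noteq> k" "homog i ` T i \<inter> homog k ` T k \<noteq> {}"
        then obtain x where "x \<in> homog i ` T i" "x \<in> homog k ` T k" by blast
        then obtain p q where pq: "p \<in> T i" "q \<in> T k" "homog i p = homog k q" by force
        have "p = slice i (homog i p)" using slice_homog_same[OF Tdeg[OF pq(1)]] by simp
        also have "\<dots> = 0" using pq(3) ik by (simp add: slice_homog_other)
        finally have "p = 0" .
        then show False using Tnz pq by blast
      qed
    qed (use T(4) in auto)
    moreover have "inj_on (homog n) (T n)" for n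
      using Tdeg by (metis inj_onI slice_homog_same)
    ultimately show ?thesis using T(5) by (simp add: card_image)
  qed
  have Hf: "H \<subseteq> (\<Union>n. forms n)" unfolding H_def using homog_in_forms by auto
  have HI: "H \<subseteq> I"
    unfolding H_def using T(1) graded_ideal_subspaces(4)[OF I] by (force simp: W_def)
  have spanH: "ideal.span H = I"
  proof
    show "ideal.span H \<subseteq> I" using HI graded_ideal_subspaces(2)[OF I] by (rule ideal.span_minimal)
    note gr = graded_ideal_span_forms[OF Hf]
    note sH = graded_ideal_slices[OF gr]
    have "W n \<subseteq> slices (ideal.span H) n" for n
    proof (induction n rule: less_induct)
      case (less n)
      have "T n \<subseteq> slices (ideal.span H) n"
      proof
        fix p assume p: "p \<in> T n"
        then have "homog n p \<in> H" using T0 unfolding H_def by (cases "n \<le> N") auto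
        then show "p \<in> slices (ideal.span H) n"
          using slice_homog_same[OF Tdeg[OF p]] ideal.span_base by (metis image_eqI)
      qed
      moreover have "lower_part W n \<subseteq> slices (ideal.span H) n"
        using lower_part_mono[of n W "slices (ideal.span H)"] lower_part_subset[OF sH(1), of n] less by blast
      ultimately show ?case
        using T(3)[of n] kpoly.span_minimal[OF _ slice_systemD(1)[OF sH(1)], of "lower_part W n \<union> T n" n] by blast
    qed
    then have "ideal_of_slices W \<subseteq> ideal_of_slices (slices (ideal.span H))"
      unfolding ideal_of_slices_def by blast
    then show "I \<subseteq> ideal.span H" using W(2) sH(2) by simp
  qed
  have lower: "card H \<le> card G" if G: "finite G" "ideal.span G = I" for G
  proof (rule kvec.indep_mod_card_le[OF _ finH _ G(1)])
    \<comment> \<open>the product of \<open>I\<close> with the maximal ideal\<close>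
    define U where "U = ideal_of_slices (lower_part W)"
    show "kvec.subspace U"
      by (rule kvec.subspaceI) (auto simp: U_def ideal_of_slices_def slice_add slice_const_scale
        intro: kpoly.subspace_0[OF subspace_lower_part] kpoly.subspace_add[OF subspace_lower_part]
          kpoly.subspace_scale[OF subspace_lower_part])
    show "indep_mod kvec.span U H"
      unfolding indep_mod_def
    proof (intro ballI notI)
      fix h assume h: "h \<in> H" "h \<in> kvec.span (U \<union> (H - {h}))"
      then obtain n p where p: "n \<le> N" "p \<in> T n" "h = homog n p" unfolding H_def by auto
      have "slice n f \<in> kpoly.span (lower_part W n \<union> (T n - {p}))" if "f \<in> kvec.span (U \<union> (H - {h}))" for f
        using that
      proof (induction rule: kvec.span_induct_alt)
        case (step c x y)
        have "slice n x \<in> kpoly.span (lower_part W n \<union> (T n - {p}))"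
        proof (cases "x \<in> U")
          case True
          then show ?thesis by (intro kpoly.span_base) (auto simp: U_def ideal_of_slices_def)
        next
          case False
          then obtain k q where q: "q \<in> T k" "x = homog k q" "x \<noteq> h" using step unfolding H_def by auto
          show ?thesis
          proof (cases "k = n")
            case True
            then have "q \<in> T n - {p}" using q p by auto
            then show ?thesis using q True slice_homog_same[OF Tdeg[OF q(1)]] by (auto intro!: kpoly.span_base)
          next
            case False
            then show ?thesis using q by (simp add: slice_homog_other kpoly.span_zero)
          qed
        qed
        then show ?case using step.IH
          by (simp add: slice_add slice_const_scale kpoly.span_add kpoly.span_scale)
      qed (simp add: kpoly.span_zero)
      from this[OF h(2)] have "p \<in> kpoly.span (lower_part W n \<union> (T n - {p}))"
        using p slice_homog_same[OF Tdeg[OF p(2)]] by simp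
      then show False using T(2)[of n] p unfolding indep_mod_def by blast
    qed
    have "f \<in> kvec.span (U \<union> G)" if "f \<in> ideal.span G" for f
      using that
    proof (induction rule: ideal.span_induct_alt)
      case (step r g y)
      have "g \<in> I" using step G by (auto simp: ideal.span_base)
      then have "r * g - const_scale (Poly_Mapping.lookup r 0) g \<in> U"
        unfolding U_def ideal_of_slices_def
        by (auto simp: slice_diff slice_const_scale W_def intro!: slice_mult_lower_part W(1)[unfolded W_def])
      then have "(r * g - const_scale (Poly_Mapping.lookup r 0) g) + const_scale (Poly_Mapping.lookup r 0) g \<in> kvec.span (U \<union> G)"
        using step by (intro kvec.span_add kvec.span_scale) (auto intro: kvec.span_base)
      then show ?case using step.IH kvec.span_add by force
    qed (simp add: kvec.span_zero)
    then show "H \<subseteq> kvec.span (U \<union> G)" using HI G by blast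
  qed
  show ?thesis
    unfolding min_num_gens_def
  proof (rule Least_equality)
    show "\<exists>G. finite G \<and> card G = (\<Sum>n\<le>N. num_new_gens (slices I) n) \<and> ideal.span G = I"
      using finH cardH spanH unfolding W_def by blast
  next
    fix y assume "\<exists>G. finite G \<and> card G = y \<and> ideal.span G = I"
    then show "(\<Sum>n\<le>N. num_new_gens (slices I) n) \<le> y" using lower cardH unfolding W_def by auto
  qed
qed


section \<open>A parametrization of the cell by an affine space\<close>

definition monic_family :: "(nat \<Rightarrow> 'k::field poly) \<Rightarrow> bool" where
  "monic_family g \<longleftrightarrow> (\<forall>b. degree (g b) = b \<and> coeff (g b) b = 1)"

lemma degree_in_span_monic:
  assumes g: "monic_family g" and D: "finite D" and p: "p \<in> kpoly.span (g ` D)" "p \<noteq> 0"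
  shows "degree p \<in> D"
  using D p
proof (induction D arbitrary: p rule: finite_linorder_max_induct)
  case (insert b D)
  obtain k where k: "p - smult k (g b) \<in> kpoly.span (g ` D)"
    using insert.prems(1) kpoly.span_insert[of "g b" "g ` D"] by auto
  define q where "q = p - smult k (g b)"
  have q: "q = 0 \<or> degree q < b" using insert.IH[of q] insert.hyps k unfolding q_def by blast
  show ?case
  proof (cases "k = 0")
    case True
    then show ?thesis using insert.IH[of p] k insert.prems by auto
  next
    case False
    have gb: "degree (smult k (g b)) = b" using False g by (simp add: monic_family_def)
    have "p = q + smult k (g b)" by (simp add: q_def)
    then have "degree p = b" using q gb degree_add_eq_right[of q "smult k (g b)"] by auto
    then show ?thesis by simp
  qed
qed simp

lemma independent_monic:
  assumes g: "monic_family g" and D: "finite D"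
  shows "kpoly.independent (g ` D)" "inj_on g D"
proof -
  show inj: "inj_on g D" using g by (intro inj_onI) (metis monic_family_def)
  show "kpoly.independent (g ` D)"
    unfolding kpoly.dependent_def
  proof safe
    fix b assume b: "b \<in> D" "g b \<in> kpoly.span (g ` D - {g b})"
    have "g ` D - {g b} \<subseteq> g ` (D - {b})" by auto
    then have "g b \<in> kpoly.span (g ` (D - {b}))" using b kpoly.span_mono by blast
    moreover have "g b \<noteq> 0" using g unfolding monic_family_def by (metis coeff_0 zero_neq_one)
    ultimately have "degree (g b) \<in> D - {b}" using degree_in_span_monic[OF g] D by blast
    then show False using g by (simp add: monic_family_def)
  qed
qed

lemma dim_span_monic:
  assumes g: "monic_family g" and D: "finite D"
  shows "kpoly.dim (kpoly.span (g ` D)) = card D"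
  using independent_monic[OF assms] by (metis card_image kpoly.dim_span_eq_card_independent)

lemma leading_degrees_span_monic:
  assumes g: "monic_family g" and D: "finite D"
  shows "leading_degrees (kpoly.span (g ` D)) = D"
proof
  show "leading_degrees (kpoly.span (g ` D)) \<subseteq> D" using degree_in_span_monic[OF g D] by (auto simp: leading_degrees_def)
  show "D \<subseteq> leading_degrees (kpoly.span (g ` D))"
  proof
    fix b assume b: "b \<in> D"
    have "g b \<noteq> 0" using g unfolding monic_family_def by (metis coeff_0 zero_neq_one)
    then have "g b \<in> kpoly.span (g ` D) - {0}" using b by (auto intro: kpoly.span_base)
    then show "b \<in> leading_degrees (kpoly.span (g ` D))"
      using g unfolding leading_degrees_def monic_family_def by (metis image_eqI)
  qed
qed

text \<open>
  Division by leading terms: subtract a multiple of the \<open>g b\<close> that has the same degree.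
\<close>

lemma span_monic_le:
  assumes g: "monic_family g" and V: "kpoly.subspace V" "\<And>b. b \<in> leading_degrees V \<Longrightarrow> g b \<in> V"
    and p: "p \<in> V" "p = 0 \<or> degree p \<le> N"
  shows "p \<in> kpoly.span (g ` {b \<in> leading_degrees V. b \<le> N})"
  using p
proof (induction "if p = 0 then 0 else Suc (degree p)" arbitrary: p rule: less_induct)
  let ?S = "kpoly.span (g ` {b \<in> leading_degrees V. b \<le> N})"
  case less
  show ?case
  proof (cases "p = 0")
    case False
    define b where "b = degree p"
    have b: "b \<in> leading_degrees V" "b \<le> N" using less.prems False unfolding leading_degrees_def b_def by auto
    define q where "q = p - smult (coeff p b) (g b)"
    have qV: "q \<in> V" unfolding q_def using V b less.prems
      by (intro kpoly.subspace_diff kpoly.subspace_scale) auto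
    have "coeff q b = 0" "degree q \<le> b"
      using g unfolding q_def monic_family_def b_def
      by (auto intro!: degree_diff_le degree_smult_le[THEN order_trans])
    then have q: "q = 0 \<or> degree q < b"
      by (metis leading_coeff_0_iff le_neq_implies_less)
    then have "q \<in> ?S"
      using less.hyps[of q] qV False b kpoly.span_zero by (cases "q = 0") (auto simp: b_def)
    moreover have "smult (coeff p b) (g b) \<in> ?S"
      using b by (intro kpoly.span_scale kpoly.span_base) auto
    ultimately have "q + smult (coeff p b) (g b) \<in> ?S"
      by (rule kpoly.span_add)
    then show ?thesis by (simp add: q_def)
  qed (simp add: kpoly.span_zero)
qed

text \<open>
  Up to sign these are the maximal minors of a Hilbert-Burch matrix with \<open>x\<close> set to \<open>1\<close>, and the
  \<open>u b c\<close> are the coefficients of its entries on and above the diagonal. The condition on \<open>row_degree P c\<close>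
  keeps \<open>y\<close> times the polynomial with index \<open>b\<close> in the slice of the next degree, and no equations
  between the \<open>u b c\<close> are needed.
\<close>

function gen_poly :: "nat list \<Rightarrow> (nat \<Rightarrow> nat \<Rightarrow> 'k::field) \<Rightarrow> nat \<Rightarrow> 'k poly" where
  "gen_poly P u 0 = 1"
| "gen_poly P u (Suc b) = pCons 0 (gen_poly P u b)
     - (\<Sum>c\<in>{c. c \<le> b \<and> row_degree P c \<le> Suc (row_degree P b)}. smult (u b c) (gen_poly P u c))"
  by pat_completeness auto
termination by (relation "measure (\<lambda>(P, u, b). b)") auto

declare gen_poly.simps(2) [simp del]

definition cell_slices :: "nat list \<Rightarrow> (nat \<Rightarrow> nat \<Rightarrow> 'k::field) \<Rightarrow> nat \<Rightarrow> 'k poly set" where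
  "cell_slices P u n = kpoly.span (gen_poly P u ` lead_set P n)"

definition cell_ideal :: "nat list \<Rightarrow> (nat \<Rightarrow> nat \<Rightarrow> 'k::field) \<Rightarrow> 'k xy_poly set" where
  "cell_ideal P u = ideal_of_slices (cell_slices P u)"

lemma monic_gen_poly: "monic_family (gen_poly P u)"
proof -
  have "degree (gen_poly P u b) = b \<and> coeff (gen_poly P u b) b = 1" for b
  proof (induction b rule: less_induct)
    case (less b)
    show ?case
    proof (cases b)
      case (Suc b')
      let ?s = "\<Sum>c\<in>{c. c \<le> b' \<and> row_degree P c \<le> Suc (row_degree P b')}. smult (u b' c) (gen_poly P u c)"
      have s: "degree ?s \<le> b'"
      proof (rule degree_sum_le)
        fix c assume "c \<in> {c. c \<le> b' \<and> row_degree P c \<le> Suc (row_degree P b')}"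
        then have "degree (gen_poly P u c) = c" "c \<le> b'" using less Suc by auto
        then show "degree (smult (u b' c) (gen_poly P u c)) \<le> b'"
          using degree_smult_le[of "u b' c" "gen_poly P u c"] by linarith
      qed simp
      have 1: "degree (gen_poly P u b') = b'" "coeff (gen_poly P u b') b' = 1" using less Suc by auto
      then have "gen_poly P u b' \<noteq> 0" by auto
      then have 2: "degree (pCons 0 (gen_poly P u b')) = Suc b'" using 1 by simp
      have "degree (pCons 0 (gen_poly P u b') - ?s) = Suc b'"
        using s 2 degree_add_eq_left[of "- ?s" "pCons 0 (gen_poly P u b')"] by simp
      moreover have "coeff ?s (Suc b') = 0" using s by (intro coeff_eq_0) simp
      ultimately show ?thesis using 1 Suc by (simp add: gen_poly.simps(2))
    qed simp
  qed
  then show ?thesis by (simp add: monic_family_def)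
qed

lemma gen_poly_rec:
  "pCons 0 (gen_poly P u b) = gen_poly P u (Suc b)
     + (\<Sum>c\<in>{c. c \<le> b \<and> row_degree P c \<le> Suc (row_degree P b)}. smult (u b c) (gen_poly P u c))"
  by (simp add: gen_poly.simps(2))

lemma pCons_span:
  assumes "p \<in> kpoly.span S" "\<And>s. s \<in> S \<Longrightarrow> pCons 0 s \<in> V" "kpoly.subspace V"
  shows "pCons 0 p \<in> V"
  using assms(1)
proof (induction rule: kpoly.span_induct_alt)
  case base
  show ?case using kpoly.subspace_0[OF assms(3)] by simp
next
  case (step c x y)
  have "pCons 0 (smult c x + y) = smult c (pCons 0 x) + pCons 0 y" by simp
  also have "\<dots> \<in> V"
    using step assms(2) by (intro kpoly.subspace_add[OF assms(3)] kpoly.subspace_scale[OF assms(3)]) auto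
  finally show ?case .
qed

lemma slice_system_cell_slices:
  assumes P: "is_partition P" shows "slice_system (cell_slices P u)"
  unfolding slice_system_def
proof (intro allI conjI ballI)
  fix n p assume p: "p \<in> cell_slices P u n"
  show "degree p \<le> n"
    using degree_in_span_monic[OF monic_gen_poly finite_lead_set p[unfolded cell_slices_def]] lead_set_le
    by (cases "p = 0") auto
  have "cell_slices P u n \<subseteq> cell_slices P u (Suc n)"
    unfolding cell_slices_def by (intro kpoly.span_mono image_mono) (auto intro: lead_set_mono)
  then show "p \<in> cell_slices P u (Suc n)" using p by auto
  show "pCons 0 p \<in> cell_slices P u (Suc n)"
  proof (rule pCons_span[OF p[unfolded cell_slices_def]])
    fix s assume "s \<in> gen_poly P u ` lead_set P n"
    then obtain b where b: "row_degree P b \<le> n" "s = gen_poly P u b" by (auto simp: lead_set_def)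
    show "pCons 0 s \<in> cell_slices P u (Suc n)"
      unfolding b(2) gen_poly_rec cell_slices_def
      using b(1) row_degree_Suc[OF P, of b]
      by (intro kpoly.span_add kpoly.span_sum kpoly.span_scale kpoly.span_base imageI)
        (auto simp: lead_set_def)
  qed (simp add: cell_slices_def)
qed (simp add: cell_slices_def)

lemma slices_cell_ideal:
  assumes "is_partition P" shows "slices (cell_ideal P u) n = cell_slices P u n"
  unfolding cell_ideal_def by (rule slices_ideal_of_slices[OF slice_system_cell_slices[OF assms]])

lemma cell_ideal_in_cell:
  assumes P: "is_partition P" shows "cell_ideal P u \<in> cell P"
proof -
  have "leading_degrees (cell_slices P u n) = lead_set P n" for n
    unfolding cell_slices_def by (rule leading_degrees_span_monic[OF monic_gen_poly finite_lead_set])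
  then show ?thesis
    using graded_ideal_of_slices[OF slice_system_cell_slices[OF P]]
    by (simp add: cell_iff[OF P] slices_cell_ideal[OF P]) (simp add: cell_ideal_def)
qed

text \<open>
  Choose \<open>g b\<close> monic of degree \<open>b\<close> in the first slice that contains such an element. As
  \<open>row_degree P (Suc b) \<le> Suc (row_degree P b)\<close>, both \<open>y g b\<close> and \<open>g (Suc b)\<close> lie in the next slice; their
  difference has degree at most \<open>b\<close>, and its expansion in the \<open>g c\<close> supplies the coefficients \<open>u b c\<close>.
\<close>

lemma cell_eq_range:
  assumes P: "is_partition P" and I: "I \<in> cell P"
  obtains u where "I = cell_ideal P u"
proof -
  define W where "W = slices I"
  have gr: "graded_ideal I" and degs: "\<And>n. leading_degrees (W n) = lead_set P n"
    using I cell_iff[OF P] by (auto simp: W_def)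
  have W: "slice_system W" "ideal_of_slices W = I" unfolding W_def by (rule graded_ideal_slices[OF gr])+
  have "\<exists>p. p \<in> W (row_degree P b) \<and> degree p = b \<and> coeff p b = 1" for b
  proof -
    have "b \<in> leading_degrees (W (row_degree P b))" by (simp add: degs lead_set_def)
    then obtain p where p: "p \<in> W (row_degree P b)" "p \<noteq> 0" "degree p = b" unfolding leading_degrees_def by auto
    then have "smult (inverse (coeff p b)) p \<in> W (row_degree P b)"
      using kpoly.subspace_scale[OF slice_systemD(1)[OF W(1)]] by blast
    then show ?thesis using p by (intro exI[of _ "smult (inverse (coeff p b)) p"]) auto
  qed
  then obtain g where g: "\<And>b. g b \<in> W (row_degree P b)" "\<And>b. degree (g b) = b \<and> coeff (g b) b = 1"
    by metis
  have mg: "monic_family g" using g(2) by (simp add: monic_family_def)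
  have mono: "W m \<subseteq> W n" if "m \<le> n" for m n
    using that by (induction rule: dec_induct) (auto intro: slice_systemD(3)[OF W(1)])
  have gW: "g b \<in> W n" if "b \<in> lead_set P n" for b n
    using g(1)[of b] mono[of "row_degree P b" n] that by (auto simp: lead_set_def)
  have sp: "p \<in> kpoly.span (g ` {b \<in> lead_set P n. b \<le> N})" if "p \<in> W n" "p = 0 \<or> degree p \<le> N" for p n N
    using span_monic_le[OF mg slice_systemD(1)[OF W(1)] _ that] gW by (simp add: degs)
  have "\<exists>v. pCons 0 (g b) - g (Suc b) =
      (\<Sum>c\<in>{c. c \<le> b \<and> row_degree P c \<le> Suc (row_degree P b)}. smult (v c) (g c))" for b
  proof -
    let ?q = "pCons 0 (g b) - g (Suc b)" and ?C = "{c. c \<le> b \<and> row_degree P c \<le> Suc (row_degree P b)}"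
    have C: "?C = {c \<in> lead_set P (Suc (row_degree P b)). c \<le> b}" by (auto simp: lead_set_def)
    have "?q \<in> W (Suc (row_degree P b))"
      using slice_systemD(4)[OF W(1) g(1)[of b]] gW[of "Suc b" "Suc (row_degree P b)"] row_degree_Suc[OF P, of b]
      by (intro kpoly.subspace_diff[OF slice_systemD(1)[OF W(1)]]) (auto simp: lead_set_def)
    moreover have "degree ?q \<le> b"
    proof (rule degree_le, intro allI impI)
      fix i assume "b < i"
      show "coeff ?q i = 0"
      proof (cases "i = Suc b")
        case True
        then show ?thesis using g(2)[of b] g(2)[of "Suc b"] by simp
      next
        case False
        then obtain i' where i': "i = Suc i'" "b < i'" using \<open>b < i\<close> by (cases i) auto
        then show ?thesis using g(2)[of b] g(2)[of "Suc b"] coeff_eq_0[of "g (Suc b)" i] coeff_eq_0[of "g b" i']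
          by simp
      qed
    qed
    ultimately have "?q \<in> kpoly.span (g ` ?C)" using sp[of ?q _ b] unfolding C by blast
    then obtain w where w: "?q = (\<Sum>v\<in>g ` ?C. smult (w v) v)" by (auto simp: kpoly.span_finite)
    have "(\<Sum>v\<in>g ` ?C. smult (w v) v) = (\<Sum>c\<in>?C. smult (w (g c)) (g c))"
      using independent_monic(2)[OF mg, of ?C] by (subst sum.reindex) (auto simp: C)
    then show ?thesis using w by (intro exI[of _ "\<lambda>c. w (g c)"]) simp
  qed
  then obtain u where u: "\<And>b. pCons 0 (g b) - g (Suc b) =
      (\<Sum>c\<in>{c. c \<le> b \<and> row_degree P c \<le> Suc (row_degree P b)}. smult (u b c) (g c))" by metis
  have gen: "gen_poly P u b = g b" for b
  proof (induction b rule: less_induct)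
    case (less b)
    show ?case
    proof (cases b)
      case 0
      have "degree (g 0) = 0" "coeff (g 0) 0 = 1" using g(2) by auto
      then have "g 0 = 1" by (metis degree_0_id one_pCons)
      then show ?thesis using 0 by simp
    next
      case (Suc b')
      have "gen_poly P u (Suc b') = pCons 0 (g b') - (pCons 0 (g b') - g (Suc b'))"
        unfolding gen_poly.simps(2) u using less Suc by (intro arg_cong2[where f = minus] sum.cong) auto
      then show ?thesis using Suc by simp
    qed
  qed
  have "cell_slices P u n = W n" for n
  proof
    show "cell_slices P u n \<subseteq> W n"
      unfolding cell_slices_def gen[THEN ext[where g = g]]
      using gW by (intro kpoly.span_minimal slice_systemD(1)[OF W(1)]) auto
    show "W n \<subseteq> cell_slices P u n"
    proof
      fix p assume p: "p \<in> W n"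
      then have "p \<in> kpoly.span (g ` {b \<in> lead_set P n. b \<le> n})"
        using slice_systemD(2)[OF W(1) p] by (intro sp) auto
      then show "p \<in> cell_slices P u n"
        unfolding cell_slices_def using kpoly.span_mono[of "g ` {b \<in> lead_set P n. b \<le> n}" "gen_poly P u ` lead_set P n"] gen
        by (auto simp: image_def)
    qed
  qed
  then have "I = cell_ideal P u" unfolding cell_ideal_def W(2)[symmetric] ideal_of_slices_def by simp
  then show ?thesis by (rule that)
qed


section \<open>Reduced elements and irreducibility of the cell\<close>

text \<open>
  Gaussian elimination for a family that is triangular with respect to degree; the result is the
  reduced echelon basis. Because the pivots are \<open>1\<close>, the entries stay polynomial in those of \<open>g\<close>.
\<close>

function reduce :: "(nat \<Rightarrow> 'k::field poly) \<Rightarrow> nat set \<Rightarrow> nat \<Rightarrow> 'k poly" where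
  "reduce g D b = g b - (\<Sum>c\<in>{c. c < b \<and> c \<in> D}. smult (coeff (g b) c) (reduce g D c))"
  by pat_completeness auto
termination by (relation "measure (\<lambda>(g, D, b). b)") auto

declare reduce.simps [simp del]

lemma coeff_reduce:
  assumes g: "monic_family g" and b: "b \<in> D" and c: "c \<in> D"
  shows "coeff (reduce g D b) c = (if c = b then 1 else 0)"
  using b
proof (induction b rule: less_induct)
  case (less b)
  have "coeff (reduce g D b) c = coeff (g b) c - (\<Sum>c'\<in>{c. c < b \<and> c \<in> D}. coeff (g b) c' * coeff (reduce g D c') c)"
    by (subst reduce.simps) (simp add: coeff_sum)
  also have "(\<Sum>c'\<in>{c. c < b \<and> c \<in> D}. coeff (g b) c' * coeff (reduce g D c') c)
      = (\<Sum>c'\<in>{c. c < b \<and> c \<in> D}. if c' = c then coeff (g b) c else 0)"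
    using less.IH by (intro sum.cong) auto
  also have "\<dots> = (if c < b then coeff (g b) c else 0)" using c by auto
  also have "coeff (g b) c - \<dots> = (if c = b then 1 else 0)"
    using g coeff_eq_0[of "g b" c] by (auto simp: monic_family_def)
  finally show ?case .
qed

lemma reduce_in_span:
  assumes "b \<in> D" shows "reduce g D b \<in> kpoly.span (g ` D)"
  using assms
proof (induction b rule: less_induct)
  case (less b)
  then show ?case
    by (subst reduce.simps)
      (auto intro!: kpoly.span_diff kpoly.span_sum kpoly.span_scale intro: kpoly.span_base)
qed

text \<open>
  Uniqueness: the difference of two candidates lies in \<open>I\<close> and involves only monomials of
  \<open>C_set P\<close>, but the leading monomial of each nonzero slice of an element of \<open>I\<close> is in \<open>E_set P\<close>.
\<close>

lemma reduced_element_eq: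
  assumes P: "is_partition P" and I: "I \<in> cell P" and b: "b \<in> lead_set P n"
    and p: "p \<in> slices I n" "\<And>c. c \<in> lead_set P n \<Longrightarrow> coeff p c = (if c = b then 1 else 0)"
  shows "reduced_element P I (n - b, b) = homog n p"
proof -
  have gr: "graded_ideal I" and degs: "\<And>n. leading_degrees (slices I n) = lead_set P n"
    using I cell_iff[OF P] by auto
  have bn: "b \<le> n" using b by (rule lead_set_le)
  have 1: "homog n p \<in> I" by (rule graded_ideal_subspaces(4)[OF gr p(1)])
  have 2: "Poly_Mapping.lookup (homog n p) (n - b, b) = 1" using bn b p(2) by (simp add: lookup_homog)
  have 3: "Poly_Mapping.keys (homog n p) - {(n - b, b)} \<subseteq> C_set P"
  proof
    fix m assume m: "m \<in> Poly_Mapping.keys (homog n p) - {(n - b, b)}"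
    obtain a c where ac: "m = (a, c)" by force
    have "a + c = n" "coeff p c \<noteq> 0" "c \<noteq> b"
      using m by (auto simp: ac in_keys_iff lookup_homog split: if_splits)
    then have "(a, c) \<notin> E_set P" using p(2)[of c] by (auto simp: E_set_iff lead_set_def)
    then show "m \<in> C_set P" by (simp add: ac E_set_def)
  qed
  show ?thesis
    unfolding reduced_element_def
  proof (rule the_equality)
    fix f assume f: "f \<in> I \<and> Poly_Mapping.lookup f (n - b, b) = 1 \<and> Poly_Mapping.keys f - {(n - b, b)} \<subseteq> C_set P"
    define h where "h = f - homog n p"
    have hI: "h \<in> I" unfolding h_def using f 1 graded_ideal_subspaces(1)[OF gr] kvec.subspace_diff by blast
    have hC: "Poly_Mapping.keys h \<subseteq> C_set P"
    proof
      fix m assume m: "m \<in> Poly_Mapping.keys h"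
      then have "m \<noteq> (n - b, b)" using f 2 by (auto simp: h_def in_keys_iff lookup_minus)
      moreover have "m \<in> Poly_Mapping.keys f \<union> Poly_Mapping.keys (homog n p)"
        using m keys_diff[of f "homog n p"] unfolding h_def by blast
      ultimately show "m \<in> C_set P" using f 3 by blast
    qed
    have "slice k h = 0" for k
    proof (rule ccontr)
      assume nz: "slice k h \<noteq> 0"
      define c where "c = degree (slice k h)"
      have "c \<in> lead_set P k" unfolding degs[symmetric] c_def leading_degrees_def using nz hI by (intro imageI) simp
      then have "c \<le> k" "(k - c, c) \<in> E_set P" using lead_set_le[of c P k] by (auto simp: E_set_iff lead_set_def)
      moreover have "coeff (slice k h) c \<noteq> 0" using nz by (simp add: c_def)
      ultimately have "(k - c, c) \<in> Poly_Mapping.keys h" by (simp add: coeff_slice in_keys_iff)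
      then show False using hC \<open>(k - c, c) \<in> E_set P\<close> by (auto simp: E_set_def)
    qed
    then have "h = 0" using poly_mapping_eqI_slice[of h 0] by simp
    then show "f = homog n p" by (simp add: h_def)
  qed (use 1 2 3 in auto)
qed

lemma reduced_element_cell_ideal:
  assumes P: "is_partition P" and b: "b \<in> lead_set P n"
  shows "reduced_element P (cell_ideal P u) (n - b, b) = homog n (reduce (gen_poly P u) (lead_set P n) b)"
proof (rule reduced_element_eq[OF P cell_ideal_in_cell[OF P] b])
  show "reduce (gen_poly P u) (lead_set P n) b \<in> slices (cell_ideal P u) n"
    unfolding slices_cell_ideal[OF P] cell_slices_def by (rule reduce_in_span[OF b])
qed (rule coeff_reduce[OF monic_gen_poly b])

definition polynomial_fun :: "('k::field \<Rightarrow> 'k) \<Rightarrow> bool" where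
  "polynomial_fun f \<longleftrightarrow> (\<exists>q. \<forall>s. f s = poly q s)"

lemma polynomial_fun_const: "polynomial_fun (\<lambda>s. c)"
  unfolding polynomial_fun_def by (intro exI[of _ "[:c:]"]) simp

lemma polynomial_fun_add: "polynomial_fun f \<Longrightarrow> polynomial_fun g \<Longrightarrow> polynomial_fun (\<lambda>s. f s + g s)"
  unfolding polynomial_fun_def by (metis poly_add)

lemma polynomial_fun_diff: "polynomial_fun f \<Longrightarrow> polynomial_fun g \<Longrightarrow> polynomial_fun (\<lambda>s. f s - g s)"
  unfolding polynomial_fun_def by (metis poly_diff)

lemma polynomial_fun_mult: "polynomial_fun f \<Longrightarrow> polynomial_fun g \<Longrightarrow> polynomial_fun (\<lambda>s. f s * g s)"
  unfolding polynomial_fun_def by (metis poly_mult)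

lemma polynomial_fun_sum:
  "(\<And>x. x \<in> A \<Longrightarrow> polynomial_fun (f x)) \<Longrightarrow> polynomial_fun (\<lambda>s. \<Sum>x\<in>A. f x s)"
  by (induction A rule: infinite_finite_induct) (auto intro: polynomial_fun_const polynomial_fun_add)

lemma polynomial_fun_line: "polynomial_fun (\<lambda>s. a + s * b)"
  unfolding polynomial_fun_def by (intro exI[of _ "[:a, b:]"]) simp

lemma polynomial_fun_gen_poly:
  assumes "\<And>b c. polynomial_fun (\<lambda>s. U s b c)"
  shows "polynomial_fun (\<lambda>s. coeff (gen_poly P (U s) b) k)"
proof (induction b arbitrary: k rule: less_induct)
  case (less b)
  show ?case
  proof (cases b)
    case 0
    then show ?thesis by (simp add: polynomial_fun_const)
  next
    case (Suc b')
    have "polynomial_fun (\<lambda>s. coeff (pCons 0 (gen_poly P (U s) b')) k)"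
      using less Suc by (cases k) (auto intro: polynomial_fun_const)
    then show ?thesis
      unfolding Suc gen_poly.simps(2) coeff_diff coeff_sum coeff_smult
      using less Suc assms
      by (intro polynomial_fun_diff polynomial_fun_sum polynomial_fun_mult) auto
  qed
qed

lemma polynomial_fun_reduce:
  assumes "\<And>b k. polynomial_fun (\<lambda>s. coeff (g s b) k)"
  shows "polynomial_fun (\<lambda>s. coeff (reduce (g s) D b) k)"
proof (induction b arbitrary: k rule: less_induct)
  case (less b)
  then show ?case
    by (subst reduce.simps, unfold coeff_diff coeff_sum coeff_smult)
      (intro polynomial_fun_diff polynomial_fun_sum polynomial_fun_mult assms, auto)
qed

lemma polynomial_fun_regular:
  assumes P: "is_partition P" and U: "\<And>b c. polynomial_fun (\<lambda>s. U s b c)"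
    and \<phi>: "\<phi> \<in> regular_functions P"
  shows "polynomial_fun (\<lambda>s. \<phi> (cell_ideal P (U s)))"
  using \<phi>
proof induction
  case (coord \<nu> \<mu>)
  obtain a b where ab: "\<nu> = (a, b)" by force
  obtain a' b' where ab': "\<mu> = (a', b')" by force
  have b: "b \<in> lead_set P (a + b)" using coord by (simp add: ab E_set_iff lead_set_def)
  have "polynomial_fun (\<lambda>s. coeff (reduce (gen_poly P (U s)) (lead_set P (a + b)) b) b')"
    by (rule polynomial_fun_reduce[OF polynomial_fun_gen_poly[OF U]])
  then show ?case
    by (cases "a' + b' = a + b")
      (simp_all add: ab ab' lookup_homog polynomial_fun_const reduced_element_cell_ideal[OF P b, simplified])
qed (auto intro: polynomial_fun_const polynomial_fun_add polynomial_fun_mult)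

text \<open>
  Pull both functions back to the line through parameter points of \<open>I\<close> and \<open>J\<close>. They become
  polynomials in one variable, nonzero at \<open>0\<close> and at \<open>1\<close> respectively, and their product has only
  finitely many zeros.
\<close>

lemma regular_functions_irreducible:
  fixes \<phi> \<psi> :: "'k::field xy_poly set \<Rightarrow> 'k"
  assumes inf: "infinite (UNIV :: 'k set)" and P: "is_partition P"
    and \<phi>: "\<phi> \<in> regular_functions P" "I \<in> cell P" "\<phi> I \<noteq> 0"
    and \<psi>: "\<psi> \<in> regular_functions P" "J \<in> cell P" "\<psi> J \<noteq> 0"
  shows "\<exists>K\<in>cell P. \<phi> K \<noteq> 0 \<and> \<psi> K \<noteq> 0"
proof -
  obtain u v where u: "I = cell_ideal P u" and v: "J = cell_ideal P v"
    using cell_eq_range[OF P \<phi>(2)] cell_eq_range[OF P \<psi>(2)] by metis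
  \<comment> \<open>the line through \<open>u\<close> (at 0) and \<open>v\<close> (at 1)\<close>
  define U where "U = (\<lambda>s b c. u b c + s * (v b c - u b c))"
  have U: "polynomial_fun (\<lambda>s. U s b c)" for b c unfolding U_def by (rule polynomial_fun_line)
  obtain p where p: "\<And>s. \<phi> (cell_ideal P (U s)) = poly p s"
    using polynomial_fun_regular[where U = U, OF P U \<phi>(1)] unfolding polynomial_fun_def by blast
  obtain q where q: "\<And>s. \<psi> (cell_ideal P (U s)) = poly q s"
    using polynomial_fun_regular[where U = U, OF P U \<psi>(1)] unfolding polynomial_fun_def by blast
  have "U 0 = u" "U 1 = v" by (auto simp: U_def)
  then have "poly p 0 \<noteq> 0" "poly q 1 \<noteq> 0" using p[of 0] q[of 1] \<phi>(3) \<psi>(3) u v by auto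
  then have "p * q \<noteq> 0" by auto
  then have "finite {s. poly (p * q) s = 0}" by (rule poly_roots_finite)
  then obtain s where "poly (p * q) s \<noteq> 0" using inf by (metis (mono_tags, lifting) UNIV_eq_I mem_Collect_eq)
  then show ?thesis using p q cell_ideal_in_cell[OF P] by (intro bexI[of _ "cell_ideal P (U s)"]) auto
qed


section \<open>Generic properties\<close>

text \<open>
  Genericity witnessed by a single regular function. By irreducibility this implies
  \<open>generic_in_cell\<close>, and it is easier to combine: products of witnesses are witnesses.
\<close>

definition generic_regular :: "nat list \<Rightarrow> ('k::field xy_poly set \<Rightarrow> bool) \<Rightarrow> bool" where
  "generic_regular P Q \<longleftrightarrow> (\<exists>\<phi>\<in>regular_functions P. (\<exists>I\<in>cell P. \<phi> I \<noteq> 0) \<and> (\<forall>I\<in>cell P. \<phi> I \<noteq> 0 \<longrightarrow> Q I))"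

lemma generic_regular_True:
  assumes "is_partition P" shows "generic_regular P (\<lambda>I :: 'k::field xy_poly set. True)"
  unfolding generic_regular_def
  using regular_functions.const[of 1 P] cell_ideal_in_cell[OF assms, of "\<lambda>b c. 0"]
  by (intro bexI[of _ "\<lambda>_. 1"]) auto

lemma generic_regular_conj:
  fixes Q Q' :: "'k::field xy_poly set \<Rightarrow> bool"
  assumes inf: "infinite (UNIV :: 'k set)" and P: "is_partition P"
    and "generic_regular P Q" "generic_regular P Q'"
  shows "generic_regular P (\<lambda>I. Q I \<and> Q' I)"
proof -
  obtain \<phi> I where \<phi>: "\<phi> \<in> regular_functions P" "I \<in> cell P" "\<phi> I \<noteq> 0" "\<And>I. I \<in> cell P \<Longrightarrow> \<phi> I \<noteq> 0 \<Longrightarrow> Q I"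
    using assms(3) unfolding generic_regular_def by blast
  obtain \<psi> J where \<psi>: "\<psi> \<in> regular_functions P" "J \<in> cell P" "\<psi> J \<noteq> 0" "\<And>I. I \<in> cell P \<Longrightarrow> \<psi> I \<noteq> 0 \<Longrightarrow> Q' I"
    using assms(4) unfolding generic_regular_def by blast
  show ?thesis
    unfolding generic_regular_def
    using regular_functions_irreducible[OF inf P \<phi>(1-3) \<psi>(1-3)] \<phi>(4) \<psi>(4)
    by (intro bexI[OF _ regular_functions.mult[OF \<phi>(1) \<psi>(1)]]) auto
qed

lemma generic_regular_finite:
  fixes Q :: "'a \<Rightarrow> 'k::field xy_poly set \<Rightarrow> bool"
  assumes inf: "infinite (UNIV :: 'k set)" and P: "is_partition P"
    and "finite A" "\<And>x. x \<in> A \<Longrightarrow> generic_regular P (Q x)"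
  shows "generic_regular P (\<lambda>I. \<forall>x\<in>A. Q x I)"
  using assms(3,4)
proof (induction A rule: finite_induct)
  case (insert x A)
  then show ?case using generic_regular_conj[OF inf P, of "Q x" "\<lambda>I. \<forall>x\<in>A. Q x I"] by simp
qed (simp add: generic_regular_True[OF P])

lemma generic_regular_mono:
  assumes "generic_regular P Q" "\<And>I. I \<in> cell P \<Longrightarrow> Q I \<Longrightarrow> Q' I"
  shows "generic_regular P Q'"
  using assms unfolding generic_regular_def by blast

lemma topspace_cell_topology: "topspace (cell_topology P) = cell P"
proof -
  have "(\<lambda>I. 1) \<in> regular_functions P" by (rule regular_functions.const)
  then show ?thesis unfolding cell_topology_def topology_generated_by_topspace
    by force
qed

lemma openin_cell_topology_basis:
  assumes "openin (cell_topology P) V" "I \<in> V"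
  shows "\<exists>\<phi>\<in>regular_functions P. \<phi> I \<noteq> 0 \<and> {J \<in> cell P. \<phi> J \<noteq> 0} \<subseteq> V"
proof -
  have "generate_topology_on ((\<lambda>\<phi>. {I \<in> cell P. \<phi> I \<noteq> 0}) ` regular_functions P) V"
    using assms(1) unfolding cell_topology_def openin_topology_generated_by_iff .
  then show ?thesis using assms(2)
  proof (induction arbitrary: I)
    case (Int a b)
    obtain \<phi> where \<phi>: "\<phi> \<in> regular_functions P" "\<phi> I \<noteq> 0" "{J \<in> cell P. \<phi> J \<noteq> 0} \<subseteq> a"
      using Int.IH(1)[of I] Int.prems by auto
    obtain \<psi> where \<psi>: "\<psi> \<in> regular_functions P" "\<psi> I \<noteq> 0" "{J \<in> cell P. \<psi> J \<noteq> 0} \<subseteq> b"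
      using Int.IH(2)[of I] Int.prems by auto
    note * = \<phi> \<psi>
    then show ?case by (intro bexI[OF _ regular_functions.mult[OF *(1,4)]]) auto
  next
    case (UN K)
    then show ?case by (meson UnionE Union_upper order_trans)
  qed auto
qed

lemma generic_in_cellI:
  fixes Q :: "'k::field xy_poly set \<Rightarrow> bool"
  assumes inf: "infinite (UNIV :: 'k set)" and P: "is_partition P" and Q: "generic_regular P Q"
  shows "generic_in_cell P Q"
proof -
  obtain \<phi> I where \<phi>: "\<phi> \<in> regular_functions P" "I \<in> cell P" "\<phi> I \<noteq> 0" "\<And>I. I \<in> cell P \<Longrightarrow> \<phi> I \<noteq> 0 \<Longrightarrow> Q I"
    using Q unfolding generic_regular_def by blast
  define U where "U = {I \<in> cell P. \<phi> I \<noteq> 0}"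
  have "openin (cell_topology P) U"
    unfolding cell_topology_def openin_topology_generated_by_iff U_def
    using \<phi>(1) by (intro generate_topology_on.Basis) auto
  moreover have "cell_topology P closure_of U = cell P"
  proof
    show "cell_topology P closure_of U \<subseteq> cell P"
      using closure_of_subset_topspace[of "cell_topology P" U] by (simp add: topspace_cell_topology)
    show "cell P \<subseteq> cell_topology P closure_of U"
    proof
      fix J :: "'k xy_poly set" assume J: "J \<in> cell P"
      show "J \<in> cell_topology P closure_of U"
        unfolding in_closure_of topspace_cell_topology
      proof (intro conjI allI impI J)
        fix V assume V: "J \<in> V \<and> openin (cell_topology P) V"
        then obtain \<psi> where \<psi>: "\<psi> \<in> regular_functions P" "\<psi> J \<noteq> 0" "{J \<in> cell P. \<psi> J \<noteq> 0} \<subseteq> V"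
          using openin_cell_topology_basis[of P V J] by auto
        then obtain K where "K \<in> cell P" "\<phi> K \<noteq> 0" "\<psi> K \<noteq> 0"
          using regular_functions_irreducible[OF inf P \<phi>(1-3) \<psi>(1) J \<psi>(2)] by blast
        then show "\<exists>y. y \<in> U \<and> y \<in> V" using \<psi>(3) unfolding U_def by blast
      qed
    qed
  qed
  ultimately show ?thesis unfolding generic_in_cell_def
    using \<phi> by (intro exI[of _ U]) (auto simp: U_def)
qed

text \<open>
  The number is determined because a nonempty open set meets every dense set.
\<close>

lemma kappa_eqI:
  assumes inf: "infinite (UNIV :: 'k::field set)" and P: "is_partition P"
    and Q: "generic_regular P (\<lambda>I :: 'k xy_poly set. min_num_gens I = n)"
  shows "kappa TYPE('k) P = n"
  unfolding kappa_def
proof (rule the_equality)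
  show g: "generic_in_cell P (\<lambda>I :: 'k xy_poly set. min_num_gens I = n)" by (rule generic_in_cellI[OF inf P Q])
  fix m assume "generic_in_cell P (\<lambda>I :: 'k xy_poly set. min_num_gens I = m)"
  then obtain U :: "'k xy_poly set set" where U: "openin (cell_topology P) U" "U \<noteq> {}"
      "cell_topology P closure_of U = cell P" "\<forall>I\<in>U. min_num_gens I = m"
    unfolding generic_in_cell_def by blast
  obtain V :: "'k xy_poly set set" where V: "openin (cell_topology P) V" "V \<noteq> {}"
      "\<forall>I\<in>V. min_num_gens I = n"
    using g unfolding generic_in_cell_def by blast
  obtain I where "I \<in> V" using V by blast
  then have "I \<in> cell_topology P closure_of U"
    using openin_subset[OF V(1)] U(3) by (auto simp: topspace_cell_topology)
  then obtain J where "J \<in> U" "J \<in> V" using \<open>I \<in> V\<close> V(1) unfolding in_closure_of by blast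
  then show "m = n" using U V by auto
qed


section \<open>Lower semicontinuity of rank\<close>

lemma regular_functions_diff:
  assumes "\<phi> \<in> regular_functions P" "\<psi> \<in> regular_functions P"
  shows "(\<lambda>I. \<phi> I - \<psi> I) \<in> regular_functions P"
  using regular_functions.add[OF assms(1) regular_functions.mult[OF regular_functions.const[of "-1"] assms(2)]]
  by simp

text \<open>
  The function \<open>\<phi>\<close> plays the role of a minor that does not vanish at \<open>I\<^sub>0\<close>. It is built by
  fraction-free elimination: choose a coordinate \<open>\<mu>\<close> in which the last vector is nonzero at \<open>I\<^sub>0\<close>, clear
  it in the other vectors by cross multiplication, recurse, and multiply by the pivot.
\<close>

lemma regular_function_detecting_independence:
  fixes v :: "nat \<Rightarrow> 'k::field xy_poly set \<Rightarrow> 'k poly"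
  assumes "\<And>k c. k < r \<Longrightarrow> (\<lambda>I. coeff (v k I) c) \<in> regular_functions P"
    and "\<And>a. (\<Sum>k<r. smult (a k) (v k I\<^sub>0)) = 0 \<Longrightarrow> \<forall>k<r. a k = 0"
  shows "\<exists>\<phi>\<in>regular_functions P. \<phi> I\<^sub>0 \<noteq> 0 \<and>
    (\<forall>I. \<phi> I \<noteq> 0 \<longrightarrow> (\<forall>a. (\<Sum>k<r. smult (a k) (v k I)) = 0 \<longrightarrow> (\<forall>k<r. a k = 0)))"
  using assms
proof (induction r arbitrary: v)
  case 0
  show ?case by (intro bexI[of _ "\<lambda>_. 1"] regular_functions.const) auto
next
  case (Suc r)
  have "v r I\<^sub>0 \<noteq> 0"
  proof
    assume "v r I\<^sub>0 = 0"
    then have "(\<Sum>k<Suc r. smult ((\<lambda>k. if k = r then 1 else 0) k) (v k I\<^sub>0)) = 0"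
      by (intro sum.neutral) auto
    from Suc.prems(2)[OF this] show False by auto
  qed
  then obtain \<mu> where \<mu>: "coeff (v r I\<^sub>0) \<mu> \<noteq> 0" by (metis leading_coeff_0_iff)
  define p where "p = (\<lambda>I. coeff (v r I) \<mu>)"
  define w where "w = (\<lambda>k I. smult (p I) (v k I) - smult (coeff (v k I) \<mu>) (v r I))"
  have w_sum: "(\<Sum>k<r. smult (a k) (w k I))
     = smult (p I) (\<Sum>k<r. smult (a k) (v k I)) - smult (\<Sum>k<r. a k * coeff (v k I) \<mu>) (v r I)" for a I
  proof -
    have "(\<Sum>k<m. smult (a k) (w k I))
       = smult (p I) (\<Sum>k<m. smult (a k) (v k I)) - smult (\<Sum>k<m. a k * coeff (v k I) \<mu>) (v r I)" for m
      by (induction m) (simp_all add: w_def smult_diff_right smult_add_right smult_add_left algebra_simps)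
    then show ?thesis .
  qed
  have p: "p \<in> regular_functions P" unfolding p_def using Suc.prems(1) by simp
  have "\<exists>\<phi>\<in>regular_functions P. \<phi> I\<^sub>0 \<noteq> 0 \<and>
    (\<forall>I. \<phi> I \<noteq> 0 \<longrightarrow> (\<forall>a. (\<Sum>k<r. smult (a k) (w k I)) = 0 \<longrightarrow> (\<forall>k<r. a k = 0)))"
  proof (rule Suc.IH)
    fix k c assume "k < r"
    then show "(\<lambda>I. coeff (w k I) c) \<in> regular_functions P"
      unfolding w_def coeff_diff coeff_smult
      using Suc.prems(1) p by (intro regular_functions_diff regular_functions.mult) auto
  next
    fix a assume a: "(\<Sum>k<r. smult (a k) (w k I\<^sub>0)) = 0"
    \<comment> \<open>the relation between the \<open>v k I\<^sub>0\<close> obtained by expanding the \<open>w k I\<^sub>0\<close>\<close>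
    define a' where "a' = (\<lambda>k. if k < r then p I\<^sub>0 * a k else - (\<Sum>k<r. a k * coeff (v k I\<^sub>0) \<mu>))"
    have "(\<Sum>k<r. smult (a' k) (v k I\<^sub>0)) = smult (p I\<^sub>0) (\<Sum>k<r. smult (a k) (v k I\<^sub>0))"
      unfolding kpoly.scale_sum_right by (intro sum.cong) (auto simp: a'_def)
    then have "(\<Sum>k<Suc r. smult (a' k) (v k I\<^sub>0)) = (\<Sum>k<r. smult (a k) (w k I\<^sub>0))"
      unfolding w_sum by (simp add: a'_def)
    then have "(\<Sum>k<Suc r. smult (a' k) (v k I\<^sub>0)) = 0" using a by (rule trans)
    then have *: "\<forall>k<Suc r. a' k = 0" by (rule Suc.prems(2))
    show "\<forall>k<r. a k = 0"
    proof (intro allI impI)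
      fix k assume "k < r"
      then show "a k = 0" using *[rule_format, of k] \<mu> by (simp add: a'_def p_def)
    qed
  qed
  then obtain \<phi> where \<phi>: "\<phi> \<in> regular_functions P" "\<phi> I\<^sub>0 \<noteq> 0"
    "\<And>I a. \<phi> I \<noteq> 0 \<Longrightarrow> (\<Sum>k<r. smult (a k) (w k I)) = 0 \<Longrightarrow> \<forall>k<r. a k = 0" by blast
  show ?case
  proof (rule bexI[OF _ regular_functions.mult[OF p \<phi>(1)]], intro conjI allI impI)
    show "p I\<^sub>0 * \<phi> I\<^sub>0 \<noteq> 0" using \<mu> \<phi> by (simp add: p_def)
    fix I a k assume I: "p I * \<phi> I \<noteq> 0" and a: "(\<Sum>k<Suc r. smult (a k) (v k I)) = 0" and k: "k < Suc r"
    have S: "(\<Sum>k<r. smult (a k) (v k I)) = - smult (a r) (v r I)"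
      using a by (simp add: eq_neg_iff_add_eq_0)
    have "(\<Sum>k<r. a k * coeff (v k I) \<mu>) = coeff (\<Sum>k<r. smult (a k) (v k I)) \<mu>"
      by (simp add: coeff_sum)
    also have "\<dots> = - a r * p I" by (simp add: S p_def)
    finally have "(\<Sum>k<r. smult (a k) (w k I)) = 0"
      unfolding w_sum S by (simp add: mult.commute)
    then have z: "\<forall>k<r. a k = 0" using \<phi>(3)[of I a] I by simp
    then have "smult (a r) (v r I) = 0" using a by simp
    moreover have "v r I \<noteq> 0" using I by (auto simp: p_def)
    ultimately have "a r = 0" by simp
    then show "a k = 0" using z k by (auto simp: less_Suc_eq)
  qed
qed

text \<open>
  On the cell this is the slice of the reduced element. Its coefficients at \<open>lead_set P n\<close> are written
  as constants because the coordinate functions are taken at monomials of \<open>C_set P\<close> only, so that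
  the coefficients are regular functions as they stand, not only after restriction to the cell.
\<close>

definition reduced_slice :: "nat list \<Rightarrow> nat \<Rightarrow> nat \<Rightarrow> 'k::field xy_poly set \<Rightarrow> 'k poly" where
  "reduced_slice P n b I = monom 1 b
     + (\<Sum>c\<in>{c. c \<le> n \<and> c \<notin> lead_set P n}. monom (Poly_Mapping.lookup (reduced_element P I (n - b, b)) (n - c, c)) c)"

lemma coeff_reduced_slice:
  "coeff (reduced_slice P n b I) k = (if k = b then 1 else 0)
     + (if k \<le> n \<and> k \<notin> lead_set P n then Poly_Mapping.lookup (reduced_element P I (n - b, b)) (n - k, k) else 0)"
  by (auto simp: reduced_slice_def coeff_sum)

lemma coeff_reduced_slice_regular:
  assumes "b \<in> lead_set P n"
  shows "(\<lambda>I. coeff (reduced_slice P n b I) k) \<in> regular_functions P"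
proof -
  have b: "(n - b, b) \<in> E_set P" using assms lead_set_le[OF assms] by (simp add: E_set_iff lead_set_def)
  have k: "(n - k, k) \<in> C_set P" if "k \<le> n" "k \<notin> lead_set P n"
  proof -
    have "(n - k, k) \<notin> E_set P" using that by (simp add: E_set_iff lead_set_def)
    then show ?thesis by (simp add: E_set_def)
  qed
  have "(\<lambda>I. if k \<le> n \<and> k \<notin> lead_set P n then Poly_Mapping.lookup (reduced_element P I (n - b, b)) (n - k, k) else 0)
      \<in> regular_functions P"
  proof (cases "k \<le> n \<and> k \<notin> lead_set P n")
    case True
    then show ?thesis using regular_functions.coord[OF b k] by simp
  next
    case False
    then show ?thesis by (simp only: if_False regular_functions.const)
  qed
  then show ?thesis unfolding coeff_reduced_slice by (rule regular_functions.add[OF regular_functions.const])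
qed

lemma reduced_slice_cell_ideal:
  assumes P: "is_partition P" and b: "b \<in> lead_set P n"
  shows "reduced_slice P n b (cell_ideal P u) = reduce (gen_poly P u) (lead_set P n) b"
proof (rule poly_eqI)
  fix k
  let ?p = "reduce (gen_poly P u) (lead_set P n) b"
  have deg: "coeff ?p k = 0" if "k > n"
  proof -
    have "?p \<in> cell_slices P u n" unfolding cell_slices_def by (rule reduce_in_span[OF b])
    then have "degree ?p \<le> n" by (rule slice_systemD(2)[OF slice_system_cell_slices[OF P]])
    then show ?thesis using that by (intro coeff_eq_0) simp
  qed
  show "coeff (reduced_slice P n b (cell_ideal P u)) k = coeff ?p k"
    using coeff_reduce[OF monic_gen_poly b, of k] deg b lead_set_le[of k P n]
    by (auto simp: coeff_reduced_slice reduced_element_cell_ideal[OF P b] lookup_homog)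
qed

lemma span_reduce:
  assumes "finite D"
  shows "kpoly.span (reduce g D ` D) = kpoly.span (g ` D)"
proof
  show "kpoly.span (reduce g D ` D) \<subseteq> kpoly.span (g ` D)"
    by (rule kpoly.span_minimal) (auto intro: reduce_in_span)
  have "g b \<in> kpoly.span (reduce g D ` D)" if "b \<in> D" for b
  proof -
    have "g b = reduce g D b + (\<Sum>c\<in>{c. c < b \<and> c \<in> D}. smult (coeff (g b) c) (reduce g D c))"
      unfolding reduce.simps[of g D b] by simp
    also have "\<dots> \<in> kpoly.span (reduce g D ` D)"
      using that by (intro kpoly.span_add kpoly.span_sum kpoly.span_scale kpoly.span_base) auto
    finally show ?thesis .
  qed
  then show "kpoly.span (g ` D) \<subseteq> kpoly.span (reduce g D ` D)" by (intro kpoly.span_minimal) auto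
qed

lemma (in vector_space) card_le_dim:
  assumes "independent B" "B \<subseteq> V" "V \<subseteq> span S" "finite S"
  shows "card B \<le> dim V"
proof -
  obtain C where C: "C \<subseteq> V" "independent C" "V \<subseteq> span C" "card C = dim V" using basis_exists by blast
  have "finite C" using independent_span_bound[OF assms(4) C(2)] C assms by blast
  then show ?thesis using independent_span_bound[of C B] assms C by auto
qed

lemma lower_part_Suc_span:
  assumes "W n = kpoly.span S"
  shows "lower_part W (Suc n) = kpoly.span (S \<union> pCons 0 ` S)"
proof -
  let ?S = "kpoly.span (S \<union> pCons 0 ` S)"
  have "pCons 0 p \<in> ?S" if "p \<in> kpoly.span S" for p
    by (rule pCons_span[OF that]) (auto intro: kpoly.span_base)
  moreover have "kpoly.span S \<subseteq> ?S" by (rule kpoly.span_mono) auto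
  ultimately have "kpoly.span (kpoly.span S \<union> pCons 0 ` kpoly.span S) \<subseteq> ?S"
    by (intro kpoly.span_minimal) auto
  moreover have "?S \<subseteq> kpoly.span (kpoly.span S \<union> pCons 0 ` kpoly.span S)"
    by (intro kpoly.span_mono Un_mono image_mono kpoly.span_superset)
  ultimately have "kpoly.span (kpoly.span S \<union> pCons 0 ` kpoly.span S) = ?S"
    by (rule antisym)
  then show ?thesis by (simp only: lower_part_def assms nat.case)
qed

lemmas lower_part_cell_slices = lower_part_Suc_span[of "cell_slices P u" for P u, OF cell_slices_def]

lemma lower_part_reduce:
  "lower_part (cell_slices P u) (Suc n) =
    kpoly.span (reduce (gen_poly P u) (lead_set P n) ` lead_set P n
      \<union> pCons 0 ` reduce (gen_poly P u) (lead_set P n) ` lead_set P n)"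
  by (rule lower_part_Suc_span) (simp add: cell_slices_def span_reduce)

text \<open>
  Lower semicontinuity of the dimension of \<open>W n + y W n\<close>: a basis at one point, chosen among reduced
  elements and their multiples by \<open>y\<close>, stays independent where a suitable regular function is nonzero.
\<close>

lemma generic_dim_lower_part:
  fixes u\<^sub>0 :: "nat \<Rightarrow> nat \<Rightarrow> 'k::field"
  assumes P: "is_partition P"
  shows "generic_regular P (\<lambda>I :: 'k xy_poly set.
    kpoly.dim (lower_part (slices I) (Suc n)) \<ge> kpoly.dim (lower_part (cell_slices P u\<^sub>0) (Suc n)))"
proof -
  define I\<^sub>0 where "I\<^sub>0 = cell_ideal P u\<^sub>0"
  define V where "V = (\<lambda>(e, b) I. (if e then pCons 0 else id) (reduced_slice P n b I) :: 'k poly)"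
  define K where "K = (UNIV :: bool set) \<times> lead_set P n"
  have Vimg: "(\<lambda>x. V x (cell_ideal P u)) ` K = reduce (gen_poly P u) (lead_set P n) ` lead_set P n
     \<union> pCons 0 ` reduce (gen_poly P u) (lead_set P n) ` lead_set P n" for u
  proof -
    have "(\<lambda>x. V x (cell_ideal P u)) ` K = (\<lambda>b. reduced_slice P n b (cell_ideal P u)) ` lead_set P n
      \<union> (\<lambda>b. pCons 0 (reduced_slice P n b (cell_ideal P u))) ` lead_set P n"
      by (force simp: V_def K_def UNIV_bool)
    then show ?thesis by (simp add: reduced_slice_cell_ideal[OF P] image_image)
  qed
  have span: "kpoly.span ((\<lambda>x. V x (cell_ideal P u)) ` K) = lower_part (cell_slices P u) (Suc n)" for u
    unfolding Vimg lower_part_reduce ..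
  have reg: "(\<lambda>I. coeff (V x I) c) \<in> regular_functions P" if K: "x \<in> K" for x c
  proof -
    obtain e b where x: "x = (e, b)" "b \<in> lead_set P n" using K by (cases x) (auto simp: K_def)
    show ?thesis
      using coeff_reduced_slice_regular[OF x(2)] regular_functions.const[of 0 P]
      by (cases e; cases c) (auto simp: V_def x(1))
  qed
  \<comment> \<open>a basis at \<open>I\<^sub>0\<close> made of reduced elements and their multiples by \<open>y\<close>\<close>
  obtain B where B: "B \<subseteq> (\<lambda>x. V x I\<^sub>0) ` K" "kpoly.independent B" "(\<lambda>x. V x I\<^sub>0) ` K \<subseteq> kpoly.span B"
      "card B = kpoly.dim ((\<lambda>x. V x I\<^sub>0) ` K)"
    using kpoly.basis_exists by blast
  have finB: "finite B" using B(1) by (rule finite_subset) (auto simp: K_def)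
  define r where "r = card B"
  have r: "r = kpoly.dim (lower_part (cell_slices P u\<^sub>0) (Suc n))"
    unfolding r_def B(4) span[symmetric] I\<^sub>0_def by simp
  obtain h where h: "bij_betw h {..<r} B" using ex_bij_betw_nat_finite[OF finB] by (auto simp: r_def atLeast0LessThan)
  have "\<exists>x\<in>K. V x I\<^sub>0 = h k" if "k < r" for k
  proof -
    have "h k \<in> B" using h that by (auto simp: bij_betw_def)
    then show ?thesis using B(1) by force
  qed
  then obtain x where x: "\<And>k. k < r \<Longrightarrow> x k \<in> K" "\<And>k. k < r \<Longrightarrow> V (x k) I\<^sub>0 = h k" by metis
  have "\<exists>\<phi>\<in>regular_functions P. \<phi> I\<^sub>0 \<noteq> 0 \<and>
    (\<forall>I. \<phi> I \<noteq> 0 \<longrightarrow> (\<forall>a. (\<Sum>k<r. smult (a k) (V (x k) I)) = 0 \<longrightarrow> (\<forall>k<r. a k = 0)))"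
  proof (rule regular_function_detecting_independence)
    fix a assume "(\<Sum>k<r. smult (a k) (V (x k) I\<^sub>0)) = 0"
    then have "(\<Sum>k<r. smult (a k) (h k)) = 0" using x(2) by simp
    moreover have "(\<Sum>v\<in>B. smult (a (inv_into {..<r} h v)) v) = (\<Sum>k<r. smult (a k) (h k))"
      using h by (subst sum.reindex_bij_betw[OF h, symmetric]) (auto intro!: sum.cong simp: bij_betw_inv_into_left)
    ultimately have *: "(\<Sum>v\<in>B. smult (a (inv_into {..<r} h v)) v) = 0" by simp
    have **: "a (inv_into {..<r} h v) = 0" if "v \<in> B" for v
      by (rule kpoly.independentD[OF B(2) finB order_refl * that])
    show "\<forall>k<r. a k = 0"
    proof (intro allI impI)
      fix k assume "k < r"
      then show "a k = 0" using **[of "h k"] h bij_betw_inv_into_left[OF h, of k] by (auto simp: bij_betw_def)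
    qed
  qed (use reg x in auto)
  then obtain \<phi> where \<phi>: "\<phi> \<in> regular_functions P" "\<phi> I\<^sub>0 \<noteq> 0"
    "\<And>I a. \<phi> I \<noteq> 0 \<Longrightarrow> (\<Sum>k<r. smult (a k) (V (x k) I)) = 0 \<Longrightarrow> \<forall>k<r. a k = 0" by blast
  have "kpoly.dim (lower_part (slices I) (Suc n)) \<ge> r" if I: "I \<in> cell P" "\<phi> I \<noteq> 0" for I
  proof -
    obtain u where u: "I = cell_ideal P u" using cell_eq_range[OF P I(1)] by blast
    let ?v = "\<lambda>k. V (x k) I"
    have inj: "inj_on ?v {..<r}"
    proof (rule inj_onI, rule ccontr)
      fix i j assume ij: "i \<in> {..<r}" "j \<in> {..<r}" "?v i = ?v j" "i \<noteq> j"
      have "(\<Sum>k<r. smult ((\<lambda>k. if k = i then 1 else if k = j then -1 else 0) k) (?v k))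
         = (\<Sum>k\<in>{i, j}. smult ((\<lambda>k. if k = i then 1 else if k = j then -1 else 0) k) (?v k))"
        using ij by (intro sum.mono_neutral_right) auto
      also have "\<dots> = 0" using ij by simp
      finally show False using \<phi>(3)[OF I(2), of "\<lambda>k. if k = i then 1 else if k = j then -1 else 0"] ij by auto
    qed
    have ind: "kpoly.independent (?v ` {..<r})"
    proof (rule kpoly.independent_if_scalars_zero)
      fix f y assume f: "(\<Sum>y\<in>?v ` {..<r}. smult (f y) y) = 0" "y \<in> ?v ` {..<r}"
      have "(\<Sum>k<r. smult (f (?v k)) (?v k)) = 0" using f(1) by (simp add: sum.reindex[OF inj])
      then show "f y = 0" using \<phi>(3)[OF I(2), of "\<lambda>k. f (?v k)"] f(2) by auto
    qed simp
    have L: "lower_part (slices I) (Suc n) = kpoly.span ((\<lambda>x. V x I) ` K)"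
    proof -
      have "slices I = cell_slices P u" using slices_cell_ideal[OF P] u by (intro ext) simp
      then show ?thesis using span[of u] u by simp
    qed
    have "card (?v ` {..<r}) \<le> kpoly.dim (kpoly.span ((\<lambda>x. V x I) ` K))"
    proof (rule kpoly.card_le_dim[OF ind])
      show "?v ` {..<r} \<subseteq> kpoly.span ((\<lambda>x. V x I) ` K)" using x(1) by (auto intro!: kpoly.span_base)
      show "finite ((\<lambda>x. V x I) ` K)" by (simp add: K_def)
    qed simp
    then show ?thesis using card_image[OF inj] unfolding L by simp
  qed
  then show ?thesis
    unfolding generic_regular_def r[symmetric] using \<phi>(1,2) cell_ideal_in_cell[OF P] unfolding I\<^sub>0_def by blast
qed


section \<open>Staircase matrices\<close>

text \<open>
  The generic rank of a matrix with rows \<open>B\<close> and columns \<open>C\<close> whose entry at \<open>(b, c)\<close> can be nonzero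
  only if \<open>c \<le> b + 1\<close>. For each threshold \<open>z\<close>, the rows counted by the first summand and the columns counted by
  the second cover all such entries; \<open>card B\<close> and \<open>card C\<close> belong to thresholds below and above
  everything.
\<close>

definition staircase_rank :: "nat set \<Rightarrow> nat set \<Rightarrow> nat" where
  "staircase_rank B C = Min (insert (card B) (insert (card C)
     ((\<lambda>z. card {b \<in> B. z \<le> Suc b} + card {c \<in> C. c < z}) ` C)))"

lemma staircase_rank_le:
  assumes "finite C"
  shows "staircase_rank B C \<le> card B" "staircase_rank B C \<le> card C"
    "z \<in> C \<Longrightarrow> staircase_rank B C \<le> card {b \<in> B. z \<le> Suc b} + card {c \<in> C. c < z}"
  unfolding staircase_rank_def using assms by (intro Min_le; simp)+

lemma staircase_rank_attained:
  assumes "finite B" "finite C"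
  shows "\<exists>z. staircase_rank B C = card {b \<in> B. z \<le> Suc b} + card {c \<in> C. c < z}"
proof -
  have "staircase_rank B C \<in> insert (card B) (insert (card C)
     ((\<lambda>z. card {b \<in> B. z \<le> Suc b} + card {c \<in> C. c < z}) ` C))"
    unfolding staircase_rank_def using assms by (intro Min_in) auto
  then consider "staircase_rank B C = card B" | "staircase_rank B C = card C"
    | z where "staircase_rank B C = card {b \<in> B. z \<le> Suc b} + card {c \<in> C. c < z}" by auto
  then show ?thesis
  proof cases
    case 1
    then show ?thesis by (intro exI[of _ 0]) simp
  next
    case 2
    obtain z where z: "\<forall>x\<in>Suc ` B \<union> C. x < z"
      using finite_nat_set_iff_bounded[of "Suc ` B \<union> C"] assms by auto
    have "Suc b < z" if "b \<in> B" for b using z that by auto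
    then have z': "{b \<in> B. z \<le> Suc b} = {}" "{c \<in> C. c < z} = C" using z by (auto simp: not_le)
    show ?thesis unfolding 2 by (intro exI[of _ z], unfold z') simp
  qed blast
qed

lemma nth_sorted_list_of_set:
  assumes "finite A"
  shows "i < card A \<Longrightarrow> sorted_list_of_set A ! i \<in> A"
    "i < j \<Longrightarrow> j < card A \<Longrightarrow> sorted_list_of_set A ! i < sorted_list_of_set A ! j"
    "x \<in> A \<Longrightarrow> \<exists>i<card A. x = sorted_list_of_set A ! i"
proof -
  have len: "length (sorted_list_of_set A) = card A" using assms by simp
  have st: "set (sorted_list_of_set A) = A" using assms by simp
  show "i < card A \<Longrightarrow> sorted_list_of_set A ! i \<in> A" using nth_mem[of i "sorted_list_of_set A"] len st by metis
  show "i < j \<Longrightarrow> j < card A \<Longrightarrow> sorted_list_of_set A ! i < sorted_list_of_set A ! j"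
    using strict_sorted_list_of_set[of A] len unfolding sorted_wrt_iff_nth_less by metis
  show "x \<in> A \<Longrightarrow> \<exists>i<card A. x = sorted_list_of_set A ! i"
    using len st by (metis in_set_conv_nth)
qed

text \<open>
  Match the largest \<open>r\<close> elements of \<open>B\<close> with the smallest \<open>r\<close> elements of \<open>C\<close> in increasing order. If
  the pair with index \<open>k\<close> violated the staircase condition, the threshold \<open>\<gamma> k\<close> would give a cover with
  fewer than \<open>r\<close> lines.
\<close>

lemma staircase_matching:
  assumes B: "finite B" and C: "finite C"
  defines "r \<equiv> staircase_rank B C"
  obtains \<beta> \<gamma> where "\<And>k. k < r \<Longrightarrow> \<beta> k \<in> B" "\<And>k. k < r \<Longrightarrow> \<gamma> k \<in> C" "\<And>k. k < r \<Longrightarrow> \<gamma> k \<le> Suc (\<beta> k)"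
    "\<And>k l. k < l \<Longrightarrow> l < r \<Longrightarrow> \<beta> k < \<beta> l" "\<And>k l. k < l \<Longrightarrow> l < r \<Longrightarrow> \<gamma> k < \<gamma> l"
proof -
  define p where "p = card B"
  define \<beta> where "\<beta> = (\<lambda>k. sorted_list_of_set B ! (p - r + k))"
  define \<gamma> where "\<gamma> = (\<lambda>k. sorted_list_of_set C ! k)"
  note xB = nth_sorted_list_of_set[OF B] and xC = nth_sorted_list_of_set[OF C]
  have r: "r \<le> p" "r \<le> card C" using staircase_rank_le[OF C] by (auto simp: r_def p_def)
  have "\<gamma> k \<le> Suc (\<beta> k)" if k: "k < r" for k
  proof (rule ccontr)
    assume neg: "\<not> \<gamma> k \<le> Suc (\<beta> k)"
    have kC: "k < card C" using k r by simp
    have "{b \<in> B. \<gamma> k \<le> Suc b} \<subseteq> (\<lambda>i. sorted_list_of_set B ! i) ` {p - r + k<..<p}"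
    proof
      fix b assume b: "b \<in> {b \<in> B. \<gamma> k \<le> Suc b}"
      then obtain i where i: "i < p" "b = sorted_list_of_set B ! i" using xB(3) unfolding p_def by blast
      have "p - r + k < i"
      proof (rule ccontr)
        assume "\<not> p - r + k < i"
        then have "b \<le> \<beta> k" unfolding \<beta>_def i(2)
          using xB(2)[of i "p - r + k"] k r by (cases "i = p - r + k") (simp_all add: p_def less_imp_le)
        then show False using b neg by simp
      qed
      then show "b \<in> (\<lambda>i. sorted_list_of_set B ! i) ` {p - r + k<..<p}" using i by auto
    qed
    then have "card {b \<in> B. \<gamma> k \<le> Suc b} \<le> card {p - r + k<..<p}"
      by (meson card_image_le card_mono finite_greaterThanLessThan finite_imageI le_trans)
    moreover have "{c \<in> C. c < \<gamma> k} \<subseteq> \<gamma> ` {..<k}"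
    proof
      fix c assume c: "c \<in> {c \<in> C. c < \<gamma> k}"
      then obtain i where i: "i < card C" "c = \<gamma> i" using xC(3) unfolding \<gamma>_def by blast
      have "\<not> k < i" using c i xC(2)[of k i] unfolding \<gamma>_def by auto
      then show "c \<in> \<gamma> ` {..<k}" using c i by (cases "i = k") auto
    qed
    then have "card {c \<in> C. c < \<gamma> k} \<le> card {..<k}"
      by (meson card_image_le card_mono finite_lessThan finite_imageI le_trans)
    moreover have "r \<le> card {b \<in> B. \<gamma> k \<le> Suc b} + card {c \<in> C. c < \<gamma> k}"
      unfolding r_def using xC(1)[OF kC] by (intro staircase_rank_le(3)[OF C]) (simp add: \<gamma>_def)
    ultimately show False using k r by simp
  qed
  moreover have "\<beta> k \<in> B" "\<gamma> k \<in> C" if "k < r" for k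
    using xB(1)[of "p - r + k"] xC(1)[of k] that r by (auto simp: \<beta>_def \<gamma>_def p_def)
  moreover have "\<beta> k < \<beta> l" "\<gamma> k < \<gamma> l" if "k < l" "l < r" for k l
    using xB(2)[of "p - r + k" "p - r + l"] xC(2)[of k l] that r by (auto simp: \<beta>_def \<gamma>_def p_def)
  ultimately show ?thesis by (intro that[of \<beta> \<gamma>]) auto
qed


section \<open>The generic number of generators in each degree\<close>

text \<open>
  The \<open>y\<close>-degrees of leading terms that occur in the slice of degree \<open>n\<close> for the first time; they index a
  basis of \<open>W n / W (n - 1)\<close>.
\<close>

definition new_lead :: "nat list \<Rightarrow> nat \<Rightarrow> nat set" where
  "new_lead P n = {b. row_degree P b = n}"

lemma new_lead_subset: "new_lead P n \<subseteq> lead_set P n"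
  by (auto simp: new_lead_def lead_set_def)

lemma finite_new_lead [simp]: "finite (new_lead P n)"
  using finite_subset[OF new_lead_subset finite_lead_set] .

lemma lead_set_Suc_eq: "lead_set P (Suc n) = lead_set P n \<union> new_lead P (Suc n)"
  by (auto simp: new_lead_def lead_set_def)

lemma card_lead_set_Suc: "card (lead_set P (Suc n)) = card (lead_set P n) + card (new_lead P (Suc n))"
  unfolding lead_set_Suc_eq
  by (intro card_Un_disjoint finite_lead_set finite_new_lead) (auto simp: new_lead_def lead_set_def)

text \<open>
  For the optimal threshold \<open>z\<close>, the rows with \<open>z \<le> b + 1\<close> contribute one vector \<open>y g b\<close> each, and the
  remaining \<open>y g b\<close> only involve elements of \<open>W n\<close> and \<open>g c\<close> with \<open>c < z\<close>.
\<close>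

lemma dim_lower_part_le:
  assumes P: "is_partition P"
  shows "kpoly.dim (lower_part (cell_slices P u) (Suc n))
     \<le> card (lead_set P n) + staircase_rank (new_lead P n) (new_lead P (Suc n))"
proof -
  let ?L = "lead_set P n" and ?B = "new_lead P n" and ?C = "new_lead P (Suc n)" and ?g = "gen_poly P u"
  obtain z where z: "staircase_rank ?B ?C = card {b \<in> ?B. z \<le> Suc b} + card {c \<in> ?C. c < z}"
    using staircase_rank_attained[of ?B ?C] by auto
  define S where "S = ?g ` (?L \<union> {c \<in> ?C. c < z}) \<union> (\<lambda>b. pCons 0 (?g b)) ` {b \<in> ?B. z \<le> Suc b}"
  have g: "?g c \<in> kpoly.span S" if "c \<in> ?L \<union> {c \<in> ?C. c < z}" for c
    using that unfolding S_def by (intro kpoly.span_base) auto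
  have "pCons 0 (?g b) \<in> kpoly.span S" if b: "b \<in> ?L" for b
  proof (cases "b \<in> ?B \<and> z \<le> Suc b")
    case True
    then show ?thesis unfolding S_def by (intro kpoly.span_base) auto
  next
    case False
    have *: "c \<in> ?L \<union> {c \<in> ?C. c < z}" if "c \<le> Suc b" "row_degree P c \<le> Suc (row_degree P b)" for c
      using False b that by (auto simp: new_lead_def lead_set_def)
    show ?thesis unfolding gen_poly_rec
      by (intro kpoly.span_add kpoly.span_sum kpoly.span_scale g *) (auto simp: row_degree_Suc[OF P])
  qed
  then have "lower_part (cell_slices P u) (Suc n) \<subseteq> kpoly.span S"
    unfolding lower_part_cell_slices using g by (intro kpoly.span_minimal) auto
  moreover have finS: "finite S" unfolding S_def by simp
  ultimately have "kpoly.dim (lower_part (cell_slices P u) (Suc n)) \<le> card S" by (rule kpoly.dim_le_card)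
  also have "card S \<le> card (?g ` (?L \<union> {c \<in> ?C. c < z})) + card ((\<lambda>b. pCons 0 (?g b)) ` {b \<in> ?B. z \<le> Suc b})"
    unfolding S_def by (rule card_Un_le)
  also have "\<dots> \<le> card (?L \<union> {c \<in> ?C. c < z}) + card {b \<in> ?B. z \<le> Suc b}"
    by (intro add_mono card_image_le) auto
  also have "\<dots> \<le> card ?L + card {c \<in> ?C. c < z} + card {b \<in> ?B. z \<le> Suc b}"
    by (intro add_mono card_Un_le order_refl)
  finally show ?thesis using z by simp
qed

text \<open>
  Let \<open>u\<close> be the indicator of an order preserving matching. Then \<open>y g (\<beta> k)\<close> is \<open>g (\<gamma> k)\<close>, possibly
  plus \<open>g (\<beta> k + 1)\<close>, and modulo \<open>W n\<close> these vectors are independent: \<open>g (\<gamma> k)\<close> occurs neither in the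
  vectors with larger index \<open>k\<close>, as there \<open>\<gamma> l > \<gamma> k\<close> and \<open>\<beta> l + 1 > \<beta> k + 1 \<ge> \<gamma> k\<close>, nor in \<open>W n\<close>.
\<close>

lemma dim_lower_part_attained:
  assumes P: "is_partition P"
  shows "\<exists>u :: nat \<Rightarrow> nat \<Rightarrow> 'k::field. kpoly.dim (lower_part (cell_slices P u) (Suc n))
     \<ge> card (lead_set P n) + staircase_rank (new_lead P n) (new_lead P (Suc n))"
proof -
  let ?L = "lead_set P n" and ?B = "new_lead P n" and ?C = "new_lead P (Suc n)"
  define r where "r = staircase_rank ?B ?C"
  obtain \<beta> \<gamma> where bg: "\<And>k. k < r \<Longrightarrow> \<beta> k \<in> ?B" "\<And>k. k < r \<Longrightarrow> \<gamma> k \<in> ?C"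
    "\<And>k. k < r \<Longrightarrow> \<gamma> k \<le> Suc (\<beta> k)"
    "\<And>k l. k < l \<Longrightarrow> l < r \<Longrightarrow> \<beta> k < \<beta> l" "\<And>k l. k < l \<Longrightarrow> l < r \<Longrightarrow> \<gamma> k < \<gamma> l"
    unfolding r_def by (rule staircase_matching[of ?B ?C]) auto
  have inj: "k = l" if "k < r" "l < r" "\<beta> k = \<beta> l" for k l
    using bg(4)[of k l] bg(4)[of l k] that by (cases k l rule: linorder_cases) auto
  define u :: "nat \<Rightarrow> nat \<Rightarrow> 'k" where "u = (\<lambda>b c. if \<exists>k<r. b = \<beta> k \<and> c = \<gamma> k then 1 else 0)"
  let ?g = "gen_poly P u"
  define v where "v = (\<lambda>k. pCons 0 (?g (\<beta> k)))"
  have rd: "row_degree P (\<beta> k) = n" "row_degree P (\<gamma> k) = Suc n" if "k < r" for k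
    using bg(1,2)[OF that] by (auto simp: new_lead_def)
  have v: "v k = ?g (Suc (\<beta> k)) + (if \<gamma> k \<le> \<beta> k then ?g (\<gamma> k) else 0)" if k: "k < r" for k
  proof -
    have "(\<Sum>c\<in>{c. c \<le> \<beta> k \<and> row_degree P c \<le> Suc (row_degree P (\<beta> k))}. smult (u (\<beta> k) c) (?g c))
        = (\<Sum>c\<in>{c. c \<le> \<beta> k \<and> row_degree P c \<le> Suc n}. if c = \<gamma> k then ?g (\<gamma> k) else 0)"
      using inj k by (intro sum.cong) (auto simp: u_def rd[OF k])
    also have "\<dots> = (if \<gamma> k \<le> \<beta> k then ?g (\<gamma> k) else 0)" using rd(2)[OF k] by (subst sum.delta) auto
    finally show ?thesis unfolding v_def gen_poly_rec by simp
  qed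
  have mg: "monic_family ?g" by (rule monic_gen_poly)
  have le: "\<beta> k \<le> n" "\<gamma> k \<le> Suc n" if "k < r" for k
    using rd[OF that] row_degree_ge[of "\<beta> k" P] row_degree_ge[of "\<gamma> k" P] by auto
  have new: "v k \<notin> kpoly.span (?g ` ?L \<union> v ` {k<..<r})" if k: "k < r" for k
  proof
    assume vk: "v k \<in> kpoly.span (?g ` ?L \<union> v ` {k<..<r})"
    \<comment> \<open>the other vectors do not involve \<open>?g (\<gamma> k)\<close>\<close>
    define D where "D = {..Suc n} - {\<gamma> k}"
    have gD: "?g c \<in> kpoly.span (?g ` D)" if "c \<le> Suc n" "c \<noteq> \<gamma> k" for c
      using that by (intro kpoly.span_base) (auto simp: D_def)
    have "?g ` ?L \<subseteq> kpoly.span (?g ` D)"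
    proof safe
      fix c assume "c \<in> ?L"
      then show "?g c \<in> kpoly.span (?g ` D)"
        using rd(2)[OF k] lead_set_le[of c P n] by (intro gD) (auto simp: lead_set_def)
    qed
    moreover have "v l \<in> kpoly.span (?g ` D)" if l: "l \<in> {k<..<r}" for l
    proof -
      have "Suc (\<beta> l) \<noteq> \<gamma> k" "\<gamma> l \<noteq> \<gamma> k" using bg(3)[OF k] bg(4)[of k l] bg(5)[of k l] l by auto
      then show ?thesis using v[of l] le[of l] l
        by (auto intro!: kpoly.span_add gD intro: kpoly.span_zero)
    qed
    ultimately have "?g ` ?L \<union> v ` {k<..<r} \<subseteq> kpoly.span (?g ` D)" by blast
    then have "v k \<in> kpoly.span (?g ` D)"
      using vk kpoly.span_minimal[OF _ kpoly.subspace_span] by blast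
    moreover have "?g (\<gamma> k) = (if \<gamma> k \<le> \<beta> k then v k - ?g (Suc (\<beta> k)) else v k)"
    proof (cases "\<gamma> k \<le> \<beta> k")
      case False
      then have "\<gamma> k = Suc (\<beta> k)" using bg(3)[OF k] by simp
      then show ?thesis using v[OF k] by simp
    qed (use v[OF k] in simp)
    ultimately have "?g (\<gamma> k) \<in> kpoly.span (?g ` D)"
      using le[OF k] by (auto intro!: kpoly.span_diff gD)
    moreover have "?g (\<gamma> k) \<noteq> 0" using mg unfolding monic_family_def by (metis coeff_0 zero_neq_one)
    ultimately have "degree (?g (\<gamma> k)) \<in> D" using degree_in_span_monic[OF mg, of D] by (simp add: D_def)
    then show False using mg by (simp add: monic_family_def D_def)
  qed
  have ind: "kpoly.independent (?g ` ?L \<union> v ` {k..<r}) \<and> card (?g ` ?L \<union> v ` {k..<r}) = card ?L + (r - k)"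
    if "k \<le> r" for k
    using that
  proof (induction rule: inc_induct)
    case base
    show ?case using independent_monic[OF mg finite_lead_set, of P n] by (simp add: card_image)
  next
    case (step k)
    have e: "{Suc k..<r} = {k<..<r}" by auto
    have "{k..<r} = insert k {k<..<r}" using \<open>k < r\<close> by auto
    then have e': "?g ` ?L \<union> v ` {k..<r} = insert (v k) (?g ` ?L \<union> v ` {k<..<r})" by simp
    have ns: "v k \<notin> kpoly.span (?g ` ?L \<union> v ` {k<..<r})" using \<open>k < r\<close> by (rule new)
    then have "v k \<notin> ?g ` ?L \<union> v ` {k<..<r}" by (rule contrapos_nn) (rule kpoly.span_base)
    then have "card (insert (v k) (?g ` ?L \<union> v ` {k<..<r})) = Suc (card (?g ` ?L \<union> v ` {k<..<r}))"
      by (intro card_insert_disjoint) auto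
    moreover have "Suc (card ?L + (r - Suc k)) = card ?L + (r - k)" using \<open>k < r\<close> by simp
    ultimately show ?case
      unfolding e' using step.IH[unfolded e] kpoly.independent_insertI[OF ns] by metis
  qed
  let ?S = "?g ` ?L \<union> v ` {0..<r}"
  have "v ` {0..<r} \<subseteq> pCons 0 ` ?g ` ?L"
  proof safe
    fix k assume "k \<in> {0..<r}"
    then have "\<beta> k \<in> ?L" using bg(1)[of k] new_lead_subset[of P n] by auto
    then show "v k \<in> pCons 0 ` ?g ` ?L" unfolding v_def by (intro imageI)
  qed
  then have "?S \<subseteq> lower_part (cell_slices P u) (Suc n)"
    unfolding lower_part_cell_slices using kpoly.span_superset[of "?g ` ?L \<union> pCons 0 ` ?g ` ?L"] by blast
  then have "card ?S \<le> kpoly.dim (lower_part (cell_slices P u) (Suc n))"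
    using lower_part_cell_slices[of P u n]
    by (intro kpoly.card_le_dim[OF conjunct1[OF ind[of 0]], where S = "?g ` ?L \<union> pCons 0 ` ?g ` ?L"]) auto
  then show ?thesis using ind[of 0] unfolding r_def by auto
qed

text \<open>
  In degree \<open>0\<close> there is no lower part; the only ideal with a generator there is the unit ideal.
\<close>

definition generic_new_gens :: "nat list \<Rightarrow> nat \<Rightarrow> nat" where
  "generic_new_gens P n = (case n of 0 \<Rightarrow> card (new_lead P 0)
     | Suc k \<Rightarrow> card (new_lead P (Suc k)) - staircase_rank (new_lead P k) (new_lead P (Suc k)))"

lemma num_new_gens_cell_slices:
  fixes u :: "nat \<Rightarrow> nat \<Rightarrow> 'k::field"
  shows "num_new_gens (cell_slices P u) n
    = card (lead_set P n) - kpoly.dim (lower_part (cell_slices P u) n)"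
  unfolding num_new_gens_def cell_slices_def
  by (simp only: dim_span_monic[OF monic_gen_poly finite_lead_set])

lemma slices_cell_eq:
  fixes I :: "'k::field xy_poly set"
  assumes "is_partition P" "I \<in> cell P"
  obtains u :: "nat \<Rightarrow> nat \<Rightarrow> 'k" where "slices I = cell_slices P u"
proof -
  obtain u where "I = cell_ideal P u" by (rule cell_eq_range[OF assms])
  then have "slices I = cell_slices P u" using slices_cell_ideal[OF assms(1), where u = u] by (intro ext) simp
  then show ?thesis by (rule that)
qed

lemma generic_num_new_gens:
  assumes P: "is_partition P"
  shows "generic_regular P (\<lambda>I :: 'k::field xy_poly set. num_new_gens (slices I) n = generic_new_gens P n)"
proof (cases n)
  case 0
  have "num_new_gens (slices I) 0 = generic_new_gens P 0" if I: "I \<in> cell P" for I :: "'k xy_poly set"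
  proof -
    obtain u where u: "slices I = cell_slices P u" by (rule slices_cell_eq[OF P I])
    have "lead_set P 0 = new_lead P 0" by (auto simp: lead_set_def new_lead_def)
    moreover have "kpoly.dim {0 :: 'k poly} = 0" using kpoly.dim_le_card[of "{0}" "{}"] by simp
    ultimately show ?thesis unfolding u num_new_gens_cell_slices generic_new_gens_def by (simp add: lower_part_def)
  qed
  then show ?thesis unfolding 0 by (intro generic_regular_mono[OF generic_regular_True[OF P]])
next
  case (Suc k)
  let ?r = "staircase_rank (new_lead P k) (new_lead P (Suc k))"
  obtain u\<^sub>0 :: "nat \<Rightarrow> nat \<Rightarrow> 'k" where u\<^sub>0:
    "kpoly.dim (lower_part (cell_slices P u\<^sub>0) (Suc k)) \<ge> card (lead_set P k) + ?r"
    using dim_lower_part_attained[OF P] by blast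
  show ?thesis
  proof (rule generic_regular_mono[OF generic_dim_lower_part[OF P, where n = k and u\<^sub>0 = u\<^sub>0]])
    fix I :: "'k xy_poly set"
    assume I: "I \<in> cell P" and d: "kpoly.dim (lower_part (cell_slices P u\<^sub>0) (Suc k)) \<le> kpoly.dim (lower_part (slices I) (Suc k))"
    obtain u where u: "slices I = cell_slices P u" by (rule slices_cell_eq[OF P I])
    show "num_new_gens (slices I) n = generic_new_gens P n"
      using d u\<^sub>0 dim_lower_part_le[OF P, of u k]
      unfolding u num_new_gens_cell_slices Suc generic_new_gens_def by (simp add: card_lead_set_Suc)
  qed
qed

lemma lead_set_all:
  assumes P: "is_partition P" and N: "lead_set P N = {..N}" "N \<le> n"
  shows "lead_set P n = {..n}"
proof
  show "{..n} \<subseteq> lead_set P n"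
    using N(2)
  proof (induction rule: dec_induct)
    case (step n)
    show ?case
    proof
      fix b assume b: "b \<in> {..Suc n}"
      show "b \<in> lead_set P (Suc n)"
      proof (cases "b = Suc n")
        case True
        then show ?thesis using step.IH lead_set_Suc[OF P, of n n] by auto
      next
        case False
        then have "b \<in> {..n}" using b by simp
        then show ?thesis using step.IH lead_set_mono[of b P n "Suc n"] by auto
      qed
    qed
  qed (use N in simp)
qed (auto dest: lead_set_le)

text \<open>
  Once a slice is everything, the next one is obtained by multiplication with \<open>x\<close> and \<open>y\<close>.
\<close>

lemma num_new_gens_eventually_zero:
  assumes P: "is_partition P" and N: "lead_set P N = {..N}" "N < n" and I: "I \<in> cell P"
  shows "num_new_gens (slices I) n = 0"
proof -
  obtain k where k: "n = Suc k" "N \<le> k" using N(2) by (cases n) auto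
  obtain u where u: "slices I = cell_slices P u" by (rule slices_cell_eq[OF P I])
  let ?g = "gen_poly P u"
  have L: "lead_set P k = {..k}" "lead_set P (Suc k) = {..Suc k}"
    using lead_set_all[OF P N(1)] k by auto
  let ?M = "lower_part (cell_slices P u) (Suc k)"
  have M: "?M = kpoly.span (?g ` {..k} \<union> pCons 0 ` ?g ` {..k})" using lower_part_cell_slices[of P u k] L by simp
  have g: "?g c \<in> ?M" if "c \<le> k" for c unfolding M using that by (intro kpoly.span_base) auto
  have "?g (Suc k) = pCons 0 (?g k)
     - (\<Sum>c\<in>{c. c \<le> k \<and> row_degree P c \<le> Suc (row_degree P k)}. smult (u k c) (?g c))"
    by (simp add: gen_poly.simps(2))
  also have "\<dots> \<in> ?M"
    using g by (intro kpoly.subspace_diff[OF subspace_lower_part] kpoly.subspace_sum[OF subspace_lower_part]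
        kpoly.subspace_scale[OF subspace_lower_part]) (auto simp: M intro: kpoly.span_base)
  finally have "?g c \<in> ?M" if "c \<le> Suc k" for c using g that by (cases "c = Suc k") auto
  then have "cell_slices P u (Suc k) \<subseteq> ?M"
    unfolding cell_slices_def[of P u "Suc k"] L by (intro kpoly.span_minimal subspace_lower_part) auto
  then have "cell_slices P u (Suc k) = ?M" using lower_part_subset[OF slice_system_cell_slices[OF P]] by blast
  then show ?thesis unfolding u k num_new_gens_def by simp
qed

lemma generic_gens_upto:
  assumes inf: "infinite (UNIV :: 'k::field set)" and P: "is_partition P"
  shows "generic_regular P (\<lambda>I :: 'k xy_poly set. \<forall>n\<in>{..N}. num_new_gens (slices I) n = generic_new_gens P n)"
  by (rule generic_regular_finite[OF inf P]) (auto intro: generic_num_new_gens[OF P])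

lemma kappa_formula:
  assumes inf: "infinite (UNIV :: 'k::field set)" and P: "is_partition P" and N: "lead_set P N = {..N}"
  shows "kappa TYPE('k) P = (\<Sum>n\<le>N. generic_new_gens P n)"
proof (rule kappa_eqI[OF inf P], rule generic_regular_mono[OF generic_gens_upto[OF inf P, of N]])
  fix I :: "'k xy_poly set"
  assume I: "I \<in> cell P" and "\<forall>n\<in>{..N}. num_new_gens (slices I) n = generic_new_gens P n"
  then have "(\<Sum>n\<le>N. num_new_gens (slices I) n) = (\<Sum>n\<le>N. generic_new_gens P n)" by (intro sum.cong) auto
  moreover have "min_num_gens I = (\<Sum>n\<le>N. num_new_gens (slices I) n)"
    using I cell_iff[OF P] num_new_gens_eventually_zero[OF P N _ I] by (intro min_num_gens_eq) auto
  ultimately show "min_num_gens I = (\<Sum>n\<le>N. generic_new_gens P n)" by simp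
qed


section \<open>Combinatorics of the component partitions\<close>

text \<open>
  With \<open>D' = lead_set P (i - 1)\<close> and \<open>D = lead_set P i\<close>, the \<open>y\<close>-degrees of the horizontal border.
\<close>

definition border_start :: "nat set \<Rightarrow> nat set \<Rightarrow> nat set" where
  "border_start D' D = {b \<in> D. b > 0 \<and> b - 1 \<notin> D'}"

text \<open>
  The \<open>y\<close>-degrees of the vertical-border monomials that lie above all of the horizontal border;
  \<open>b < i\<close> excludes the monomial with \<open>x\<close>-degree \<open>0\<close>.
\<close>

definition border_last :: "nat \<Rightarrow> nat set \<Rightarrow> nat set \<Rightarrow> nat set" where
  "border_last i D' D = {b \<in> D - D'. b < i \<and> (\<forall>u\<in>border_start D' D. b < u)}"

definition V1_degrees :: "nat \<Rightarrow> nat set \<Rightarrow> nat set \<Rightarrow> nat set" where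
  "V1_degrees i D' D = (if 0 \<notin> D then border_start D' D
     else border_start D' D \<union> {v \<in> border_last i D' D. \<forall>u\<in>border_last i D' D. \<not> v < u})"

text \<open>
  Remove \<open>D'\<close> from \<open>D\<close> below \<open>x\<close>, or remove its shift \<open>Suc ` D'\<close>. Both have the same
  number of elements below \<open>x\<close>, because \<open>x\<close> itself is not in the shift.
\<close>

lemma card_split_below:
  assumes "finite D" "D' \<subseteq> D" "Suc ` D' \<subseteq> D" "x \<notin> D"
  shows "card {b \<in> D. (b = 0 \<or> b - 1 \<notin> D') \<and> b < x} = card {b \<in> D - D'. b < x}"
proof -
  let ?A = "{b \<in> D. (b = 0 \<or> b - 1 \<notin> D') \<and> b < x}" and ?D' = "{b \<in> D'. b < x}"
  have fin: "finite ?D'" "finite ?A" "finite {b \<in> D - D'. b < x}" using assms finite_subset by auto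
  have e1: "{b \<in> D. b < x} = ?D' \<union> {b \<in> D - D'. b < x}" using assms by auto
  have "card (?D' \<union> {b \<in> D - D'. b < x}) = card ?D' + card {b \<in> D - D'. b < x}"
    by (rule card_Un_disjoint) (use fin in auto)
  then have 1: "card {b \<in> D. b < x} = card ?D' + card {b \<in> D - D'. b < x}"
    by (rule trans[OF arg_cong[OF e1, of card]])
  have e2: "{b \<in> D. b < x} = ?A \<union> Suc ` ?D'"
  proof
    show "{b \<in> D. b < x} \<subseteq> ?A \<union> Suc ` ?D'"
    proof
      fix b assume "b \<in> {b \<in> D. b < x}"
      then show "b \<in> ?A \<union> Suc ` ?D'" by (cases b) auto
    qed
    have "Suc b < x" if "b \<in> D'" "b < x" for b
    proof -
      have "Suc b \<in> D" using that assms(3) by blast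
      then have "Suc b \<noteq> x" using assms(4) by blast
      then show ?thesis using that by simp
    qed
    then have "Suc ` ?D' \<subseteq> {b \<in> D. b < x}" using assms(3) by blast
    then show "?A \<union> Suc ` ?D' \<subseteq> {b \<in> D. b < x}" by blast
  qed
  have "card (?A \<union> Suc ` ?D') = card ?A + card (Suc ` ?D')"
    by (rule card_Un_disjoint) (use fin in auto)
  then have "card {b \<in> D. b < x} = card ?A + card (Suc ` ?D')"
    by (rule trans[OF arg_cong[OF e2, of card]])
  then show ?thesis using 1 by (simp add: card_image)
qed

lemma exists_next_start:
  fixes x v :: nat
  assumes "x \<notin> D" "v \<in> D" "x < v"
  obtains s where "x < s" "s \<le> v" "s \<in> D" "s - 1 \<notin> D"
proof -
  define s where "s = (LEAST y. x < y \<and> y \<in> D)"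
  have s: "x < s \<and> s \<in> D" unfolding s_def by (rule LeastI[of _ v]) (use assms in auto)
  have "s \<le> v" unfolding s_def by (rule Least_le) (use assms in auto)
  moreover have "s - 1 \<notin> D"
  proof
    assume "s - 1 \<in> D"
    moreover have "s - 1 < s" using s by simp
    ultimately show False using not_less_Least[of "s - 1" "\<lambda>y. x < y \<and> y \<in> D"] s assms(1)
      unfolding s_def[symmetric] by (cases "s - 1 = x") auto
  qed
  ultimately show ?thesis using s that by blast
qed

lemma exists_next_gap:
  fixes b c :: nat
  assumes "b \<in> D" "c \<notin> D" "b < c"
  obtains f where "b < f" "f \<le> c" "f \<notin> D" "f - 1 \<in> D"
  by (rule exists_next_start[of b "- D" c]) (use assms in auto)

text \<open>
  If \<open>0 \<in> D\<close>, then \<open>0\<close> is the start of an interval of \<open>D\<close> but not a horizontal-border monomial. The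
  extra element of \<open>V1\<close> takes its place: it lies in the same first interval of \<open>D\<close>, below every gap.
\<close>

lemma border_last_singleton:
  assumes D: "D \<subset> {..i}" "D' \<subseteq> D" "Suc ` D' \<subseteq> D" "0 \<in> D"
  shows "\<exists>v. {v \<in> border_last i D' D. \<forall>u\<in>border_last i D' D. \<not> v < u} = {v}
    \<and> v \<in> D \<and> v \<notin> border_start D' D \<and> (\<forall>x. x \<notin> D \<longrightarrow> v < x)"
proof -
  let ?A = "border_start D' D" and ?V = "border_last i D' D"
  have fin: "finite ?V" by (rule finite_subset[of _ "{..i}"]) (auto simp: border_last_def)
  obtain c where c: "c \<notin> D" "c \<le> i" using D by auto
  \<comment> \<open>the first gap of \<open>D\<close>; the wanted element is \<open>f - 1\<close> or, if there is a start below \<open>f\<close>,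
    the predecessor of the first start\<close>
  define f where "f = (LEAST c. c \<notin> D)"
  have f: "f \<notin> D" unfolding f_def by (rule LeastI[of _ c]) (rule c)
  have fi: "f \<le> i" using Least_le[of "\<lambda>c. c \<notin> D" c] c unfolding f_def by auto
  have below: "y \<in> D" if "y < f" for y using not_less_Least[of y "\<lambda>c. c \<notin> D"] that unfolding f_def by blast
  have f0: "0 < f" using f D(4) by (cases f) auto
  have "?V \<noteq> {}"
  proof (cases "\<exists>\<alpha>\<in>?A. \<alpha> \<le> f - 1")
    case False
    have "f - 1 \<notin> D'"
    proof
      assume "f - 1 \<in> D'"
      then have "Suc (f - 1) \<in> D" using D(3) by blast
      then show False using f f0 by simp
    qed
    then have "f - 1 \<in> ?V" using False fi f0 below[of "f - 1"] by (auto simp: border_last_def not_le)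
    then show ?thesis by blast
  next
    case True
    define \<alpha> where "\<alpha> = (LEAST \<alpha>. \<alpha> \<in> ?A)"
    have \<alpha>: "\<alpha> \<in> ?A" unfolding \<alpha>_def by (rule LeastI_ex) (use True in auto)
    have le: "\<alpha> \<le> u" if "u \<in> ?A" for u unfolding \<alpha>_def
      by (rule Least_le[where P = "\<lambda>\<alpha>. \<alpha> \<in> ?A"]) (rule that)
    have a: "\<alpha> \<in> D" "0 < \<alpha>" "\<alpha> - 1 \<notin> D'" using \<alpha> by (auto simp: border_start_def)
    have "\<alpha> - 1 \<in> D" using True le f0 by (intro below) force
    moreover have "\<alpha> - 1 < i" using a D(1) by auto
    moreover have "\<alpha> - 1 < u" if "u \<in> ?A" for u using le[OF that] a(2) by simp
    ultimately have "\<alpha> - 1 \<in> ?V" using a(3) by (auto simp: border_last_def)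
    then show ?thesis by blast
  qed
  then have v: "Max ?V \<in> ?V" using fin by (rule Max_in[rotated])
  have "{v \<in> ?V. \<forall>u\<in>?V. \<not> v < u} = {Max ?V}"
  proof
    show "{v \<in> ?V. \<forall>u\<in>?V. \<not> v < u} \<subseteq> {Max ?V}"
      using v Max_ge[OF fin] by (fastforce simp: not_less)
    show "{Max ?V} \<subseteq> {v \<in> ?V. \<forall>u\<in>?V. \<not> v < u}" using v Max_ge[OF fin] by (auto simp: not_less)
  qed
  moreover have "Max ?V \<in> D" "\<And>u. u \<in> ?A \<Longrightarrow> Max ?V < u" using v by (auto simp: border_last_def)
  moreover have "Max ?V < x" if x: "x \<notin> D" for x
  proof (rule ccontr)
    assume "\<not> Max ?V < x"
    then have "x < Max ?V" using x \<open>Max ?V \<in> D\<close> by (cases "x = Max ?V") auto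
    then obtain s where s: "x < s" "s \<le> Max ?V" "s \<in> D" "s - 1 \<notin> D"
      using exists_next_start[OF x \<open>Max ?V \<in> D\<close>] by blast
    then have "s \<in> ?A" using D(2) by (auto simp: border_start_def)
    then show False using \<open>\<And>u. u \<in> ?A \<Longrightarrow> Max ?V < u\<close>[of s] s(2) by simp
  qed
  ultimately show ?thesis by blast
qed

text \<open>
  Each maximal interval of \<open>D\<close> contains as many elements of \<open>V1\<close> as of \<open>D - D'\<close>. Counting below a gap
  \<open>x\<close> of \<open>D\<close> says the same without mentioning the intervals.
\<close>

lemma V1_degrees_counts:
  assumes D: "D \<subset> {..i}" "D' \<subseteq> D" "Suc ` D' \<subseteq> D"
  shows "V1_degrees i D' D \<subseteq> D"
    and "x \<notin> D \<Longrightarrow> card {b \<in> V1_degrees i D' D. b < x} = card {b \<in> D - D'. b < x}"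
proof -
  have finD: "finite D" using D(1) finite_subset by blast
  have A: "border_start D' D \<subseteq> D" by (auto simp: border_start_def)
  show sub: "V1_degrees i D' D \<subseteq> D"
  proof (cases "0 \<in> D")
    case True
    have "border_last i D' D \<subseteq> D" by (auto simp: border_last_def)
    then show ?thesis using A by (auto simp: V1_degrees_def)
  qed (simp add: V1_degrees_def A)
  assume x: "x \<notin> D"
  have "card {b \<in> V1_degrees i D' D. b < x} = card {b \<in> D. (b = 0 \<or> b - 1 \<notin> D') \<and> b < x}"
  proof (cases "0 \<in> D")
    case False
    then have "{b \<in> V1_degrees i D' D. b < x} = {b \<in> D. (b = 0 \<or> b - 1 \<notin> D') \<and> b < x}"
      by (auto simp: V1_degrees_def border_start_def intro: gr0I)
    then show ?thesis by simp
  next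
    case True
    let ?A = "{b \<in> border_start D' D. b < x}"
    obtain v where v: "{v \<in> border_last i D' D. \<forall>u\<in>border_last i D' D. \<not> v < u} = {v}"
      "v \<notin> border_start D' D" "v < x" using border_last_singleton[OF D True] x by metis
    have "x > 0" using True x by (cases x) auto
    have "{b \<in> V1_degrees i D' D. b < x} = insert v ?A"
      using True v(3) unfolding V1_degrees_def v(1) by auto
    moreover have "{b \<in> D. (b = 0 \<or> b - 1 \<notin> D') \<and> b < x} = insert 0 ?A"
      using True \<open>x > 0\<close> by (auto simp: border_start_def)
    moreover have "finite ?A" "v \<notin> ?A" "0 \<notin> ?A" using finD A v(2) finite_subset by (auto simp: border_start_def)
    ultimately show ?thesis by simp
  qed
  then show "card {b \<in> V1_degrees i D' D. b < x} = card {b \<in> D - D'. b < x}"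
    using card_split_below[OF finD D(2,3) x] by simp
qed

text \<open>
  On \<open>X\<close> this is the order isomorphism onto an initial segment of the natural numbers.
\<close>

definition rank_in :: "nat set \<Rightarrow> nat \<Rightarrow> nat" where
  "rank_in X x = card {y \<in> X. y < x}"

lemma rank_in_less:
  assumes "finite X" "x \<in> X" "x < y" shows "rank_in X x < rank_in X y"
  unfolding rank_in_def using assms by (intro psubset_card_mono) auto

lemma rank_in_mono:
  assumes "finite X" "x \<le> y" shows "rank_in X x \<le> rank_in X y"
  unfolding rank_in_def using assms by (intro card_mono) auto

lemma rank_in_less_iff:
  assumes "finite X" "x \<in> X" shows "rank_in X x < rank_in X y \<longleftrightarrow> x < y"
  using rank_in_less[OF assms] rank_in_mono[OF assms(1), of y x] by (meson not_le)

lemma rank_in_inj: "finite X \<Longrightarrow> inj_on (rank_in X) X"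
  by (rule inj_onI) (metis less_irrefl linorder_neqE_nat rank_in_less)

lemma rank_in_image:
  assumes "finite X" shows "rank_in X ` X = {..<card X}"
proof (rule card_subset_eq)
  show "rank_in X ` X \<subseteq> {..<card X}"
    unfolding rank_in_def using assms by (auto intro!: psubset_card_mono)
  show "card (rank_in X ` X) = card {..<card X}" using card_image[OF rank_in_inj[OF assms]] by simp
qed simp

text \<open>
  The staircase rank depends only on \<open>card B\<close>, on the order of \<open>C\<close>, and on the number of rows \<open>b\<close> with
  \<open>b + 1 < c\<close> for each \<open>c\<close>. If \<open>c\<close> does not directly follow an interval of \<open>D\<close>, these are all rows
  below \<open>c\<close>, before and after the compression: the interval of \<open>b\<close> is followed by another element of \<open>C\<close>.
  If \<open>c\<close> directly follows an interval, exactly one row below \<open>c\<close> is excluded, namely the end of the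
  interval before the compression, and the last element of \<open>B\<close> in it afterwards.
\<close>

lemma staircase_rank_compress:
  assumes fin: "finite D" "finite C" and sub: "\<Gamma> \<subseteq> D" "B \<subseteq> D" "C \<inter> D = {}"
    and gap: "\<And>e. e \<in> D \<Longrightarrow> Suc e \<notin> D \<Longrightarrow> Suc e \<in> C"
    and last: "\<And>e. e \<in> D \<Longrightarrow> Suc e \<notin> D \<Longrightarrow> e \<in> \<Gamma>"
    and counts: "\<And>x. x \<notin> D \<Longrightarrow> card {b \<in> B. b < x} = card {b \<in> \<Gamma>. b < x}"
  shows "staircase_rank (rank_in (B \<union> C) ` B) (rank_in (B \<union> C) ` C) = staircase_rank \<Gamma> C"
    and "card B = card \<Gamma>"
proof -
  define r where "r = rank_in (B \<union> C)"
  have finX: "finite (B \<union> C)" "finite B" "finite \<Gamma>" using fin sub finite_subset by auto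
  note less_iff = rank_in_less_iff[OF finX(1), folded r_def]
  note mono = rank_in_mono[OF finX(1), folded r_def]
  have inj: "inj_on r B" "inj_on r C" using rank_in_inj[OF finX(1)] unfolding r_def by (auto intro: inj_on_subset)
  show cards: "card B = card \<Gamma>"
  proof -
    obtain M where M: "\<forall>x\<in>D. x < M" using finite_nat_set_iff_bounded[of D] fin by auto
    then have "M \<notin> D" by auto
    moreover have "{b \<in> B. b < M} = B" "{b \<in> \<Gamma>. b < M} = \<Gamma>" using M sub by auto
    ultimately show ?thesis using counts[of M] by simp
  qed
  have key: "card {b \<in> B. Suc (r b) < r c} = card {b \<in> \<Gamma>. Suc b < c}" if c: "c \<in> C" for c
  proof -
    have cD: "c \<notin> D" using c sub by auto
    show ?thesis
    proof (cases "c > 0 \<and> c - 1 \<in> D")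
      case True
      define e where "e = c - 1"
      have e: "c = Suc e" "e \<in> D" "e \<in> \<Gamma>" using True last[of "c - 1"] cD by (auto simp: e_def)
      have "{b \<in> \<Gamma>. b < c} = insert e {b \<in> \<Gamma>. Suc b < c}" using e by auto
      then have 1: "card {b \<in> \<Gamma>. b < c} = Suc (card {b \<in> \<Gamma>. Suc b < c})" using finX e by simp
      have "{b \<in> B. b < c} \<noteq> {}" using counts[OF cD] 1 by (metis card.empty nat.distinct(1))
      \<comment> \<open>the last row in the interval that ends at \<open>e\<close>; nothing of \<open>B \<union> C\<close> lies between it and \<open>c\<close>\<close>
      define b\<^sub>0 where "b\<^sub>0 = Max {b \<in> B. b < c}"
      have b0: "b\<^sub>0 \<in> B" "b\<^sub>0 < c" using Max_in[of "{b \<in> B. b < c}"] finX \<open>_ \<noteq> {}\<close> by (auto simp: b\<^sub>0_def)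
      have max: "b \<le> b\<^sub>0" if "b \<in> B" "b < c" for b unfolding b\<^sub>0_def using that finX by (intro Max_ge) auto
      have noC: "f < b\<^sub>0" if f: "f \<in> C" "f < c" for f
      proof (rule ccontr)
        assume nf: "\<not> f < b\<^sub>0"
        have fD: "f \<notin> D" using f sub by auto
        have "b\<^sub>0 \<in> D" using b0(1) sub(2) by blast
        then have "b\<^sub>0 \<noteq> f" using fD by blast
        then have "b\<^sub>0 < f" using nf by linarith
        have "f \<noteq> e" using fD e(2) by blast
        then have "f < e" using f(2) e(1) by linarith
        have "b < f" if "b \<in> B" "b < c" for b using max[OF that] \<open>b\<^sub>0 < f\<close> by simp
        then have "{b \<in> B. b < c} = {b \<in> B. b < f}" using f by auto
        then have "card {b \<in> \<Gamma>. b < c} = card {b \<in> \<Gamma>. b < f}" using counts[OF cD] counts[OF fD] by simp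
        moreover have "card {b \<in> \<Gamma>. b < f} < card {b \<in> \<Gamma>. b < c}"
        proof (rule psubset_card_mono)
          have "e \<in> {b \<in> \<Gamma>. b < c}" "e \<notin> {b \<in> \<Gamma>. b < f}" using e(1,3) \<open>f < e\<close> by simp_all
          moreover have "{b \<in> \<Gamma>. b < f} \<subseteq> {b \<in> \<Gamma>. b < c}" using f(2) by force
          ultimately show "{b \<in> \<Gamma>. b < f} \<subset> {b \<in> \<Gamma>. b < c}" by blast
        qed (use finX(3) in simp)
        ultimately show False by simp
      qed
      have "{y \<in> B \<union> C. y < c} = insert b\<^sub>0 {y \<in> B \<union> C. y < b\<^sub>0}"
      proof (intro set_eqI iffI)
        fix y assume "y \<in> {y \<in> B \<union> C. y < c}"
        then show "y \<in> insert b\<^sub>0 {y \<in> B \<union> C. y < b\<^sub>0}"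
          using max[of y] noC[of y] by (cases "y = b\<^sub>0") (auto simp: le_less)
      qed (use b0 in auto)
      then have rc: "r c = Suc (r b\<^sub>0)" unfolding r_def rank_in_def using finX by simp
      have "{b \<in> B. b < c} = insert b\<^sub>0 {b \<in> B. Suc (r b) < r c}"
      proof (intro set_eqI iffI)
        fix b assume "b \<in> {b \<in> B. b < c}"
        then show "b \<in> insert b\<^sub>0 {b \<in> B. Suc (r b) < r c}"
          using max[of b] less_iff[of b b\<^sub>0] unfolding rc by (cases "b = b\<^sub>0") auto
      next
        fix b assume "b \<in> insert b\<^sub>0 {b \<in> B. Suc (r b) < r c}"
        then consider "b = b\<^sub>0" | "b \<in> B" "r b < r b\<^sub>0" unfolding rc by auto
        then show "b \<in> {b \<in> B. b < c}"
        proof cases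
          case 2
          then have "b < b\<^sub>0" using less_iff[of b b\<^sub>0] by simp
          then show ?thesis using 2 b0 by simp
        qed (use b0 in simp)
      qed
      moreover have "b\<^sub>0 \<notin> {b \<in> B. Suc (r b) < r c}" unfolding rc by simp
      ultimately have "card {b \<in> B. b < c} = Suc (card {b \<in> B. Suc (r b) < r c})" using finX by simp
      then show ?thesis using 1 counts[OF cD] by simp
    next
      case False
      have "Suc b < c" if "b \<in> \<Gamma>" "b < c" for b
      proof -
        have "b \<in> D" using that sub(1) by blast
        then have "c \<noteq> Suc b" using False by auto
        then show ?thesis using that by simp
      qed
      then have "{b \<in> \<Gamma>. Suc b < c} = {b \<in> \<Gamma>. b < c}" using Suc_lessD by blast
      moreover have "{b \<in> B. Suc (r b) < r c} = {b \<in> B. b < c}"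
      proof
        show "{b \<in> B. Suc (r b) < r c} \<subseteq> {b \<in> B. b < c}"
          using less_iff[of _ c] by (auto dest: Suc_lessD)
        show "{b \<in> B. b < c} \<subseteq> {b \<in> B. Suc (r b) < r c}"
        proof
          fix b assume b: "b \<in> {b \<in> B. b < c}"
          then obtain f where f: "b < f" "f \<le> c" "f \<notin> D" "f - 1 \<in> D"
            using exists_next_gap[of b D c] cD sub by auto
          have "f \<noteq> c" using f False by auto
          have "f \<in> C" using gap[of "f - 1"] f by simp
          then have "r b < r f" "r f < r c" using less_iff[of b f] less_iff[of f c] b f \<open>f \<noteq> c\<close> by auto
          then show "b \<in> {b \<in> B. Suc (r b) < r c}" using b by simp
        qed
      qed
      ultimately show ?thesis using counts[OF cD] by simp
    qed
  qed
  have F: "card {s \<in> r ` B. r c \<le> Suc s} + card {s \<in> r ` C. s < r c}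
      = card {b \<in> \<Gamma>. c \<le> Suc b} + card {x \<in> C. x < c}" if c: "c \<in> C" for c
  proof -
    have "{s \<in> r ` B. r c \<le> Suc s} = r ` (B - {b \<in> B. Suc (r b) < r c})" by auto
    then have "card {s \<in> r ` B. r c \<le> Suc s} = card (B - {b \<in> B. Suc (r b) < r c})"
      by (simp only:) (rule card_image, rule inj_on_subset[OF inj(1)], auto)
    also have "\<dots> = card B - card {b \<in> B. Suc (r b) < r c}" using finX by (intro card_Diff_subset) auto
    also have "\<dots> = card \<Gamma> - card {b \<in> \<Gamma>. Suc b < c}" using key[OF c] cards by simp
    also have "\<dots> = card (\<Gamma> - {b \<in> \<Gamma>. Suc b < c})" using finX by (intro card_Diff_subset[symmetric]) auto
    also have "\<Gamma> - {b \<in> \<Gamma>. Suc b < c} = {b \<in> \<Gamma>. c \<le> Suc b}" by auto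
    finally have 1: "card {s \<in> r ` B. r c \<le> Suc s} = card {b \<in> \<Gamma>. c \<le> Suc b}" .
    have "{s \<in> r ` C. s < r c} = r ` {x \<in> C. x < c}" using less_iff by auto
    then have "card {s \<in> r ` C. s < r c} = card {x \<in> C. x < c}"
      by (simp only:) (rule card_image, rule inj_on_subset[OF inj(2)], auto)
    then show ?thesis using 1 by simp
  qed
  have "(\<lambda>z. card {b \<in> r ` B. z \<le> Suc b} + card {c \<in> r ` C. c < z}) ` (r ` C)
      = (\<lambda>z. card {b \<in> \<Gamma>. z \<le> Suc b} + card {c \<in> C. c < z}) ` C"
    unfolding image_image using F by (intro image_cong) auto
  moreover have "card (r ` B) = card \<Gamma>" "card (r ` C) = card C" using inj cards by (auto simp: card_image)
  ultimately show "staircase_rank (rank_in (B \<union> C) ` B) (rank_in (B \<union> C) ` C) = staircase_rank \<Gamma> C"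
    unfolding staircase_rank_def r_def[symmetric] by simp
qed


section \<open>Partitions with prescribed rows\<close>

lemma exists_partition_rows:
  fixes f :: "nat \<Rightarrow> nat"
  assumes "\<And>b. f (Suc b) \<le> f b" "f N = 0"
  shows "\<exists>Q. is_partition Q \<and> (\<forall>b. row_degree Q b = b + f b)"
proof -
  define M where "M = (LEAST b. f b = 0)"
  have M: "f M = 0" unfolding M_def by (rule LeastI) (rule assms)
  have pos: "f b > 0" if "b < M" for b using not_less_Least[of b "\<lambda>b. f b = 0"] that unfolding M_def by auto
  have anti: "f c \<le> f b" if "b \<le> c" for b c using lift_Suc_antimono_le[of f b c] assms that by blast
  have z: "f b = 0" if "M \<le> b" for b using anti[OF that] M by simp
  define Q where "Q = map f [0..<M]"
  have "is_partition Q"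
    unfolding is_partition_def Q_def using pos anti by (auto simp: sorted_wrt_iff_nth_less)
  moreover have "row_degree Q b = b + f b" for b
    using z[of b] by (simp add: row_degree_def Q_def)
  ultimately show ?thesis by blast
qed

lemma partition_eqI:
  assumes P: "is_partition P" and Q: "is_partition Q" and e: "\<And>b. row_degree P b = row_degree Q b"
  shows "P = Q"
proof (rule nth_equalityI)
  have *: "b < length R \<longleftrightarrow> row_degree R b \<noteq> b" if "is_partition R" for R b
    using that nth_mem[of b R] unfolding is_partition_def row_degree_def by auto
  have "b < length P \<longleftrightarrow> b < length Q" for b using *[OF P] *[OF Q] e by simp
  then show l: "length P = length Q" by (meson linorder_neqE_nat less_irrefl)
  fix i assume "i < length P"
  then show "P ! i = Q ! i" using e[of i] l by (simp add: row_degree_def)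
qed

lemma E_set_inject:
  assumes P: "is_partition P" and Q: "is_partition Q" and e: "E_set P = E_set Q"
  shows "P = Q"
proof (rule partition_eqI[OF P Q])
  fix b
  have "row_degree P b \<le> n \<longleftrightarrow> row_degree Q b \<le> n" if "b \<le> n" for n
    using e E_set_iff[of "n - b" b P] E_set_iff[of "n - b" b Q] that by simp
  from this[of "row_degree P b"] this[of "row_degree Q b"] show "row_degree P b = row_degree Q b"
    using row_degree_ge[of b P] row_degree_ge[of b Q] by simp
qed

lemma prod_list_keys_mdeg:
  assumes "set fs \<subseteq> {f :: 'k::field xy_poly. Poly_Mapping.keys f \<subseteq> {m. 1 \<le> mdeg m}}"
  shows "Poly_Mapping.keys (prod_list fs) \<subseteq> {m. length fs \<le> mdeg m}"
  using assms
proof (induction fs)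
  case (Cons f fs)
  then have IH: "Poly_Mapping.keys (prod_list fs) \<subseteq> {m. length fs \<le> mdeg m}"
    and f: "Poly_Mapping.keys f \<subseteq> {m. 1 \<le> mdeg m}" by auto
  show ?case
  proof
    fix m assume "m \<in> Poly_Mapping.keys (prod_list (f # fs))"
    then obtain u v where "m = u + v" "u \<in> Poly_Mapping.keys f" "v \<in> Poly_Mapping.keys (prod_list fs)"
      using keys_mult[of f "prod_list fs"] by auto
    then show "m \<in> {m. length (f # fs) \<le> mdeg m}" using IH f by (fastforce simp: mdeg_def)
  qed
qed simp

lemma upward_closed_mdeg: "upward_closed {m. n \<le> mdeg m}"
  by (auto simp: upward_closed_def mdeg_def)

lemma mono_poly_mult: "mono_poly u * mono_poly v = (mono_poly (u + v) :: 'k::field xy_poly)"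
  by (simp add: mono_poly_def mult_single)

lemma mono_poly_power: "mono_poly u ^ n = (mono_poly (n * fst u, n * snd u) :: 'k::field xy_poly)"
proof (induction n)
  case 0
  show ?case unfolding mono_poly_def by (simp flip: zero_prod_def)
next
  case (Suc n)
  have "u + (n * fst u, n * snd u) = (Suc n * fst u, Suc n * snd u)" by (cases u) simp
  then show ?case unfolding power_Suc Suc.IH mono_poly_mult by simp
qed

lemma ideal_power_max_ideal:
  "ideal_power max_ideal n = ideal.span (mono_poly ` {m. n \<le> mdeg m} :: 'k::field xy_poly set)"
proof
  note sp = span_monomials[OF upward_closed_mdeg, where 'k = 'k]
  have mi: "max_ideal \<subseteq> {f :: 'k xy_poly. Poly_Mapping.keys f \<subseteq> {m. 1 \<le> mdeg m}}"
  proof -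
    have "max_ideal \<subseteq> ideal.span (mono_poly ` {m. 1 \<le> mdeg m} :: 'k xy_poly set)"
      unfolding max_ideal_def by (rule ideal.span_mono) (auto simp: mdeg_def)
    then show ?thesis by (simp only: sp)
  qed
  show "ideal_power max_ideal n \<subseteq> ideal.span (mono_poly ` {m. n \<le> mdeg m} :: 'k xy_poly set)"
    unfolding ideal_power_def
  proof (rule ideal.span_minimal)
    show "{prod_list fs |fs. length fs = n \<and> set fs \<subseteq> max_ideal} \<subseteq> ideal.span (mono_poly ` {m. n \<le> mdeg m} :: 'k xy_poly set)"
      unfolding sp using prod_list_keys_mdeg mi by blast
  qed simp
  show "ideal.span (mono_poly ` {m. n \<le> mdeg m}) \<subseteq> (ideal_power max_ideal n :: 'k xy_poly set)"
  proof (rule ideal.span_minimal)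
    show "mono_poly ` {m. n \<le> mdeg m} \<subseteq> (ideal_power max_ideal n :: 'k xy_poly set)"
    proof safe
      fix a b assume ab: "n \<le> mdeg (a, b)"
      define a' where "a' = min a n"
      define b' where "b' = n - a'"
      have le: "a' \<le> a" "b' \<le> b" "a' + b' = n" using ab by (auto simp: a'_def b'_def mdeg_def)
      have "(mono_poly (a', b') :: 'k xy_poly) \<in> {prod_list fs |fs. length fs = n \<and> set fs \<subseteq> max_ideal}"
      proof (intro CollectI exI conjI)
        let ?fs = "replicate a' (mono_poly (1, 0)) @ replicate b' (mono_poly (0, 1)) :: 'k xy_poly list"
        show "mono_poly (a', b') = prod_list ?fs" by (simp add: mono_poly_power mono_poly_mult)
        show "length ?fs = n" using le by simp
        show "set ?fs \<subseteq> max_ideal" unfolding max_ideal_def by (auto intro: ideal.span_base)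
      qed
      then have "mono_poly (a - a', b - b') * mono_poly (a', b') \<in> (ideal_power max_ideal n :: 'k xy_poly set)"
        unfolding ideal_power_def by (intro ideal.span_scale ideal.span_base)
      then show "mono_poly (a, b) \<in> (ideal_power max_ideal n :: 'k xy_poly set)"
        using le by (simp add: mono_poly_def mult_single)
    qed
  qed (simp add: ideal_power_def)
qed

lemma ideal_span_plus: "ideal.span A + ideal.span B = ideal.span (A \<union> B)"
  unfolding ideal.span_Un set_plus_def by auto


section \<open>The component partitions\<close>

lemma V1_eq:
  assumes "0 < i"
  shows "V1 P i = (\<lambda>b. (i - b, b)) ` V1_degrees i (lead_set P (i - 1)) (lead_set P i)"
proof -
  let ?e = "\<lambda>b. (i - b, b)" and ?D' = "lead_set P (i - 1)" and ?D = "lead_set P i"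
  have e: "(a, b) \<in> ?e ` A \<longleftrightarrow> a + b = i \<and> b \<in> A" if "A \<subseteq> ?D" for A a b
    using that lead_set_le[of b P i] by (auto simp: image_iff)
  have sub: "border_start ?D' ?D \<subseteq> ?D" "border_last i ?D' ?D \<subseteq> ?D"
    by (auto simp: border_start_def border_last_def)
  have hb: "horizontal_border P i = ?e ` border_start ?D' ?D"
  proof (intro set_eqI)
    fix m :: monomial
    obtain a b where m: "m = (a, b)" by force
    show "m \<in> horizontal_border P i \<longleftrightarrow> m \<in> ?e ` border_start ?D' ?D"
      unfolding m e[OF sub(1)] by (auto simp: horizontal_border_def E_set_iff border_start_def lead_set_def)
  qed
  have vb: "{v \<in> vertical_border P i. \<forall>u\<in>horizontal_border P i. lex_less v u} = ?e ` border_last i ?D' ?D"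
  proof (intro set_eqI)
    fix m :: monomial
    obtain a b where m: "m = (a, b)" by force
    have "m \<in> vertical_border P i \<longleftrightarrow> a + b = i \<and> b \<in> ?D - ?D' \<and> b < i"
      by (auto simp: m vertical_border_def E_set_iff lead_set_def)
    then show "m \<in> {v \<in> vertical_border P i. \<forall>u\<in>horizontal_border P i. lex_less v u} \<longleftrightarrow> m \<in> ?e ` border_last i ?D' ?D"
      unfolding m e[OF sub(2)] hb by (auto simp: border_last_def lex_less_def)
  qed
  have ll: "lex_last (?e ` A) = ?e ` {v \<in> A. \<forall>u\<in>A. \<not> v < u}" for A
    by (auto simp: lex_last_def lex_less_def)
  have z: "(i, 0) \<in> C_set P \<longleftrightarrow> 0 \<notin> ?D"
    using E_set_iff[of i 0 P] by (auto simp: E_set_def lead_set_def)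
  show ?thesis unfolding V1_def vb unfolding V1_degrees_def hb ll z by (simp add: image_Un)
qed

lemma hand_monomials_eq: "hand_monomials P i = (\<lambda>b. (i - b, b)) ` (new_lead P (Suc i) - {Suc i})"
proof (intro set_eqI)
  fix m :: monomial
  obtain a b where m: "m = (a, b)" by force
  have "m \<in> hand_monomials P i \<longleftrightarrow> a + b = i \<and> row_degree P b = Suc i"
    using E_set_iff[of a b P] E_set_iff[of "Suc a" b P] by (auto simp: m hand_monomials_def E_set_def)
  also have "\<dots> \<longleftrightarrow> m \<in> (\<lambda>b. (i - b, b)) ` (new_lead P (Suc i) - {Suc i})"
    using row_degree_ge[of b P] by (auto simp: m new_lead_def image_iff)
  finally show "m \<in> hand_monomials P i \<longleftrightarrow> m \<in> (\<lambda>b. (i - b, b)) ` (new_lead P (Suc i) - {Suc i})" .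
qed

text \<open>
  The hand monomials omit \<open>y\<^sup>i\<^sup>+\<^sup>1\<close>. If \<open>Suc i\<close> is new in degree \<open>Suc i\<close>, it is the maximum and all hand
  monomials are selected; if not, there is one hand monomial too many and the last is dropped. Either
  way the maximum is missing.
\<close>

lemma V2_eq:
  assumes c: "card (new_lead P (Suc i)) = Suc (delta t (i + 1))"
  shows "V2 t P i = (\<lambda>b. (i - b, b)) ` (new_lead P (Suc i) - {Max (new_lead P (Suc i))})"
proof -
  let ?C = "new_lead P (Suc i)" and ?e = "\<lambda>b. (i - b, b)"
  define H where "H = ?C - {Suc i}"
  have ne: "?C \<noteq> {}" using c by auto
  have le: "x \<le> Max ?C" if "x \<in> ?C" for x using that by simp
  have mC: "Max ?C \<in> ?C" using ne by simp
  have leS: "x \<le> Suc i" if "x \<in> ?C" for x using that row_degree_ge[of x P] by (simp add: new_lead_def)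
  have "{v \<in> H. card {u \<in> H. u < v} < delta t (i + 1)} = ?C - {Max ?C}"
  proof (cases "Suc i \<in> ?C")
    case True
    then have m: "Max ?C = Suc i" by (intro antisym[OF leS[OF mC]] le)
    have "card H = delta t (i + 1)" using c True by (simp add: H_def)
    moreover have "card {u \<in> H. u < v} < card H" if "v \<in> H" for v
      using that by (intro psubset_card_mono) (auto simp: H_def)
    ultimately show ?thesis unfolding m by (auto simp: H_def)
  next
    case False
    then have H: "H = ?C" by (auto simp: H_def)
    have "card {u \<in> ?C. u < v} < delta t (i + 1) \<longleftrightarrow> v \<noteq> Max ?C" if v: "v \<in> ?C" for v
    proof
      assume l: "card {u \<in> ?C. u < v} < delta t (i + 1)"
      show "v \<noteq> Max ?C"
      proof
        assume "v = Max ?C"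
        then have "{u \<in> ?C. u < v} = ?C - {v}" using le by (auto simp: le_less)
        then show False using l c v by simp
      qed
    next
      assume "v \<noteq> Max ?C"
      then have "v < Max ?C" using le[OF v] by simp
      then have "{u \<in> ?C. u < v} \<subset> ?C - {Max ?C}" using v by auto
      then have "card {u \<in> ?C. u < v} < card (?C - {Max ?C})" by (intro psubset_card_mono) auto
      then show "card {u \<in> ?C. u < v} < delta t (i + 1)" using c mC by simp
    qed
    then show ?thesis unfolding H by auto
  qed
  moreover have "lex_first n (?e ` H) = ?e ` {v \<in> H. card {u \<in> H. u < v} < n}" for n
  proof -
    have "card {u \<in> ?e ` H. lex_less u (?e v)} = card {u \<in> H. u < v}" for v
    proof -
      have "{u \<in> ?e ` H. lex_less u (?e v)} = ?e ` {u \<in> H. u < v}" by (auto simp: lex_less_def)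
      moreover have "card (?e ` {u \<in> H. u < v}) = card {u \<in> H. u < v}"
        by (rule card_image) (auto simp: inj_on_def)
      ultimately show ?thesis by metis
    qed
    then show ?thesis by (auto simp: lex_first_def)
  qed
  ultimately show ?thesis unfolding V2_def hand_monomials_eq H_def by simp
qed

definition monomial_of_degree :: "nat \<Rightarrow> nat \<Rightarrow> monomial" where
  "monomial_of_degree k r = (k - r, r)"

lemma bij_betw_monomial_of_degree: "bij_betw (monomial_of_degree k) {..k} (monomials_of_degree k)"
  by (rule bij_betwI[of _ _ _ snd]) (auto simp: monomial_of_degree_def monomials_of_degree_def mdeg_def)

text \<open>
  An order isomorphism sends an element to its rank.
\<close>

lemma order_bijection_unique:
  assumes V: "finite V" "inj_on snd V" "card V = Suc k"
  shows "(THE s. s \<in> extensional V \<and> bij_betw s V (monomials_of_degree k) \<and>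
      (\<forall>u\<in>V. \<forall>v\<in>V. lex_less u v \<longrightarrow> lex_less (s u) (s v)))
    = restrict (\<lambda>m. monomial_of_degree k (rank_in (snd ` V) (snd m))) V" (is "_ = ?s0")
proof (rule the_equality)
  let ?Y = "snd ` V"
  have Y: "finite ?Y" "card ?Y = Suc k" using V by (auto simp: card_image)
  have "bij_betw snd V ?Y" using V(2) by (simp add: bij_betw_def)
  moreover have "bij_betw (rank_in ?Y) ?Y {..k}"
    using rank_in_inj[OF Y(1)] rank_in_image[OF Y(1)] Y(2) by (simp add: bij_betw_def lessThan_Suc_atMost)
  ultimately have "bij_betw (monomial_of_degree k \<circ> (rank_in ?Y \<circ> snd)) V (monomials_of_degree k)"
    using bij_betw_monomial_of_degree by (blast intro: bij_betw_trans)
  then have "bij_betw ?s0 V (monomials_of_degree k)" by (rule bij_betw_cong[THEN iffD1, rotated]) simp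
  moreover have "lex_less (?s0 u) (?s0 v)" if "u \<in> V" "v \<in> V" "lex_less u v" for u v
    using that rank_in_less[OF Y(1), of "snd u" "snd v"] by (simp add: lex_less_def monomial_of_degree_def)
  ultimately show "?s0 \<in> extensional V \<and> bij_betw ?s0 V (monomials_of_degree k) \<and>
      (\<forall>u\<in>V. \<forall>v\<in>V. lex_less u v \<longrightarrow> lex_less (?s0 u) (?s0 v))" by simp
next
  fix s
  assume s: "s \<in> extensional V \<and> bij_betw s V (monomials_of_degree k) \<and>
      (\<forall>u\<in>V. \<forall>v\<in>V. lex_less u v \<longrightarrow> lex_less (s u) (s v))"
  then have inj: "inj_on s V" and img: "s ` V = monomials_of_degree k" by (auto simp: bij_betw_def)
  have mono: "snd (s u) < snd (s v)" if "u \<in> V" "v \<in> V" "snd u < snd v" for u v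
    using s that by (simp add: lex_less_def)
  have "s v = monomial_of_degree k (rank_in (snd ` V) (snd v))" if v: "v \<in> V" for v
  proof -
    have sv: "mdeg (s v) = k" using img v by (auto simp: monomials_of_degree_def)
    have "s ` {u \<in> V. snd u < snd v} = monomial_of_degree k ` {..<snd (s v)}"
    proof
      show "s ` {u \<in> V. snd u < snd v} \<subseteq> monomial_of_degree k ` {..<snd (s v)}"
      proof (rule image_subsetI)
        fix u assume u: "u \<in> {u \<in> V. snd u < snd v}"
        then have "mdeg (s u) = k" using img by (auto simp: monomials_of_degree_def)
        then have "s u = monomial_of_degree k (snd (s u))"
          by (cases "s u") (auto simp: monomial_of_degree_def mdeg_def)
        moreover have "snd (s u) \<in> {..<snd (s v)}" using mono[OF _ v] u by simp
        ultimately show "s u \<in> monomial_of_degree k ` {..<snd (s v)}" by (rule image_eqI)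
      qed
      show "monomial_of_degree k ` {..<snd (s v)} \<subseteq> s ` {u \<in> V. snd u < snd v}"
      proof (rule image_subsetI)
        fix r assume "r \<in> {..<snd (s v)}"
        then have r: "r < snd (s v)" by simp
        then have "monomial_of_degree k r \<in> s ` V"
          unfolding img using sv by (auto simp: monomial_of_degree_def monomials_of_degree_def mdeg_def)
        then obtain u where u: "u \<in> V" "s u = monomial_of_degree k r" by force
        have "snd u < snd v"
        proof (rule ccontr)
          assume "\<not> snd u < snd v"
          then consider "u = v" | "snd v < snd u" using V(2) u(1) v by (auto simp: inj_on_def not_less le_less)
          then have "snd (s v) \<le> snd (s u)" using mono[OF v u(1)] by cases auto
          then show False using r u(2) by (simp add: monomial_of_degree_def)
        qed
        then show "monomial_of_degree k r \<in> s ` {u \<in> V. snd u < snd v}" using u by force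
      qed
    qed
    then have "card {u \<in> V. snd u < snd v} = card (monomial_of_degree k ` {..<snd (s v)})"
      using card_image[OF inj_on_subset[OF inj, of "{u \<in> V. snd u < snd v}"]] by simp
    also have "\<dots> = snd (s v)"
      by (subst card_image) (auto simp: inj_on_def monomial_of_degree_def)
    finally have "snd (s v) = card {u \<in> V. snd u < snd v}" by simp
    moreover have "card {y \<in> snd ` V. y < snd v} = card {u \<in> V. snd u < snd v}"
    proof -
      have e: "{y \<in> snd ` V. y < snd v} = snd ` {u \<in> V. snd u < snd v}" by auto
      show ?thesis unfolding e by (rule card_image) (rule inj_on_subset[OF V(2)], auto)
    qed
    ultimately have "rank_in (snd ` V) (snd v) = snd (s v)" by (simp add: rank_in_def)
    then show ?thesis using sv by (cases "s v") (auto simp: monomial_of_degree_def mdeg_def)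
  qed
  then show "s = ?s0" using s by (intro extensionalityI[of s V]) auto
qed

text \<open>
  The map \<open>s\<^sub>i\<close> closes the gaps in the union of \<open>V1 P i\<close> with the new leading degrees of degree \<open>i + 1\<close>, except
  that the maximum of the latter is not in its domain; it would be sent to \<open>d\<^sub>i + 1\<close>. So the
  complement of \<open>S\<close> in \<open>{..d\<^sub>i + 1}\<close> is the image of all the new leading degrees.
\<close>

lemma component_structure:
  assumes P: "is_partition P" and i: "0 < i" and D: "lead_set P i \<subset> {..i}"
    and c0: "card (new_lead P i) = Suc (delta t i)"
    and c1: "card (new_lead P (Suc i)) = Suc (delta t (i + 1))"
  shows "\<exists>S. S \<subseteq> {..component_degree t i} \<and> card S = Suc (delta t i) \<and>
     staircase_rank S ({..Suc (component_degree t i)} - S) = staircase_rank (new_lead P i) (new_lead P (Suc i)) \<and>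
     component_map t P i ` V1 P i = monomial_of_degree (component_degree t i) ` S"
proof -
  define k where "k = component_degree t i"
  let ?D' = "lead_set P (i - 1)" and ?D = "lead_set P i" and ?\<Gamma> = "new_lead P i" and ?C = "new_lead P (Suc i)"
  let ?e = "\<lambda>b. (i - b, b)"
  define B where "B = V1_degrees i ?D' ?D"
  define X where "X = B \<union> ?C"
  \<comment> \<open>the new leading degree that \<open>V2\<close> leaves out; it lies above all of \<open>V1\<close> since every interval of
    \<open>lead_set P i\<close> is followed by an element of \<open>new_lead P (Suc i)\<close>\<close>
  define m where "m = Max ?C"
  have DD: "?D' \<subseteq> ?D" using i by (auto intro: lead_set_mono)
  have SD: "Suc ` ?D' \<subseteq> ?D" using lead_set_Suc[OF P, of _ "i - 1"] i by auto
  have \<Gamma>: "?\<Gamma> = ?D - ?D'" using i by (auto simp: new_lead_def lead_set_def)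
  note B = V1_degrees_counts[OF D DD SD, folded B_def \<Gamma>]
  have CD: "?C \<inter> ?D = {}" by (auto simp: new_lead_def lead_set_def)
  have gap: "Suc e \<in> ?C" if "e \<in> ?D" "Suc e \<notin> ?D" for e
    using lead_set_Suc[OF P that(1)] that(2) unfolding lead_set_Suc_eq[of P i] by blast
  have last: "e \<in> ?\<Gamma>" if "e \<in> ?D" "Suc e \<notin> ?D" for e
    using that SD unfolding \<Gamma> by blast
  have \<Gamma>D: "?\<Gamma> \<subseteq> ?D" unfolding \<Gamma> by blast
  note compress = staircase_rank_compress[OF finite_lead_set finite_new_lead \<Gamma>D B(1) CD gap last B(2), folded X_def]
  have BD: "B \<subseteq> ?D" by (rule B(1))
  have finB: "finite B" using finite_subset[OF BD] by simp
  have finX: "finite X" using finB by (simp add: X_def)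
  have disj: "B \<inter> ?C = {}" using BD CD by blast
  have cardX: "card X = Suc (Suc k)"
    unfolding X_def using card_Un_disjoint[OF finB finite_new_lead disj] compress(2) c0 c1
    by (simp add: k_def component_degree_def)
  have mC: "m \<in> ?C" using c1 Max_in[of ?C] unfolding m_def by fastforce
  have mB: "b < m" if b: "b \<in> B" for b
  proof -
    have "b \<in> ?D" "Suc i \<notin> ?D" "b < Suc i" using b BD D lead_set_le[of _ P i] by (auto simp: less_Suc_eq_le)
    then obtain f where f: "b < f" "f \<notin> ?D" "f - 1 \<in> ?D" using exists_next_gap[of b ?D "Suc i"] by blast
    then have "f \<in> ?C" using gap[of "f - 1"] by simp
    then have "f \<le> m" unfolding m_def by simp
    then show ?thesis using f by simp
  qed
  have mX: "x \<le> m" if "x \<in> X" for x using that mB unfolding X_def m_def by (fastforce simp: less_imp_le)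
  define Y where "Y = X - {m}"
  have BY: "B \<subseteq> Y" using mB unfolding Y_def X_def by auto
  have Yi: "Y \<subseteq> {..i}"
  proof
    fix x assume x: "x \<in> Y"
    show "x \<in> {..i}"
    proof (cases "x \<in> B")
      case True
      then show ?thesis using BD lead_set_le[of x P i] by auto
    next
      case False
      then have "x < m" using x mX[of x] unfolding Y_def by auto
      moreover have "m \<le> Suc i" using mC row_degree_ge[of m P] by (simp add: new_lead_def)
      ultimately show ?thesis by simp
    qed
  qed
  have cardY: "card Y = Suc k" using cardX mC finX by (simp add: Y_def X_def)
  have rank: "rank_in Y x = rank_in X x" if "x \<in> X" for x
  proof -
    have "{y \<in> Y. y < x} = {y \<in> X. y < x}" using mX[OF that] by (auto simp: Y_def)
    then show ?thesis by (simp add: rank_in_def)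
  qed
  have V1: "V1 P i = ?e ` B" unfolding B_def by (rule V1_eq[OF i])
  have V12: "V1 P i \<union> V2 t P i = ?e ` Y"
    unfolding V1 V2_eq[OF c1] m_def[symmetric] Y_def X_def using mB by auto
  have injV: "inj_on snd (?e ` Y)" "snd ` ?e ` Y = Y" "card (?e ` Y) = Suc k"
    using cardY by (auto simp: inj_on_def image_image card_image)
  have finV: "finite (?e ` Y)" using finX by (simp add: Y_def)
  have cm: "component_map t P i = restrict (\<lambda>u. monomial_of_degree k (rank_in Y (snd u))) (?e ` Y)"
    using order_bijection_unique[OF finV injV(1,3)]
    unfolding component_map_def V12 k_def[symmetric] injV(2) .
  define S where "S = rank_in X ` B"
  have BX: "B \<subseteq> X" and CX: "?C \<subseteq> X" by (auto simp: X_def)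
  have "component_map t P i ` V1 P i = monomial_of_degree k ` S"
  proof -
    have "component_map t P i (?e b) = monomial_of_degree k (rank_in X b)" if "b \<in> B" for b
      using that BY BX rank[of b] unfolding cm by auto
    then show ?thesis unfolding V1 S_def image_image by (rule image_cong[OF refl])
  qed
  moreover have SC: "S \<inter> rank_in X ` ?C = {}" "S \<union> rank_in X ` ?C = {..Suc k}"
  proof -
    show "S \<inter> rank_in X ` ?C = {}"
      unfolding S_def using inj_on_image_Int[OF rank_in_inj[OF finX] BX CX] disj by simp
    show "S \<union> rank_in X ` ?C = {..Suc k}"
      using rank_in_image[OF finX] cardX unfolding S_def image_Un[symmetric] X_def[symmetric]
      by (simp add: lessThan_Suc_atMost)
  qed
  then have "rank_in X ` ?C = {..Suc k} - S" by blast
  then have "staircase_rank S ({..Suc k} - S) = staircase_rank ?\<Gamma> ?C"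
    using compress(1) by (simp add: S_def)
  moreover have "S \<subseteq> {..k}"
  proof
    fix s assume "s \<in> S"
    then obtain b where b: "b \<in> B" "s = rank_in X b" by (auto simp: S_def)
    have "rank_in X b < rank_in X m" using rank_in_less[OF finX _ mB[OF b(1)]] b BX by blast
    moreover have "rank_in X m \<in> {..Suc k}" using SC(2) mC by blast
    ultimately show "s \<in> {..k}" using b by simp
  qed
  moreover have "card S = Suc (delta t i)"
    unfolding S_def using card_image[OF inj_on_subset[OF rank_in_inj[OF finX] BX]] compress(2) c0 by simp
  ultimately show ?thesis unfolding k_def[symmetric] by blast
qed

lemma partition_of_top_degree:
  assumes S: "S \<subseteq> {..k}"
  obtains Q where "is_partition Q"
    "E_set Q = monomial_of_degree k ` S \<union> {m. k + 1 \<le> mdeg m}"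
    "\<And>n. new_lead Q n = (if n < k then {} else if n = k then S else if n = Suc k then {..Suc k} - S else {n})"
    "lead_set Q (Suc k) = {..Suc k}"
proof -
  \<comment> \<open>row \<open>b\<close> ends before degree \<open>k\<close> for \<open>b \<in> S\<close> and before degree \<open>k + 1\<close> otherwise; for \<open>b > k\<close> the
    subtraction truncates to an empty row\<close>
  define f where "f = (\<lambda>b. if b \<in> S then k - b else Suc k - b)"
  have "f (Suc b) \<le> f b" for b using S by (auto simp: f_def)
  moreover have "f (Suc k) = 0" using S by (auto simp: f_def)
  ultimately obtain Q where Q: "is_partition Q" "\<And>b. row_degree Q b = b + f b"
    using exists_partition_rows[of f] by blast
  have rd: "row_degree Q b = (if b \<in> S then k else if b \<le> k then Suc k else b)" for b
    using S unfolding Q(2) f_def by (auto simp: subset_iff)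
  have "E_set Q = monomial_of_degree k ` S \<union> {m. k + 1 \<le> mdeg m}"
  proof (intro set_eqI)
    fix m :: monomial
    obtain a b where m: "m = (a, b)" by force
    have "(a, b) \<in> monomial_of_degree k ` S \<longleftrightarrow> a + b = k \<and> b \<in> S"
      using S by (force simp: monomial_of_degree_def)
    then show "m \<in> E_set Q \<longleftrightarrow> m \<in> monomial_of_degree k ` S \<union> {m. k + 1 \<le> mdeg m}"
      using S unfolding m E_set_iff rd by (auto simp: mdeg_def)
  qed
  moreover have "new_lead Q n = (if n < k then {} else if n = k then S else if n = Suc k then {..Suc k} - S else {n})" for n
    using S unfolding new_lead_def rd by (auto split: if_splits)
  moreover have "lead_set Q (Suc k) = {..Suc k}"
    using S unfolding lead_set_def rd by (auto split: if_splits)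
  ultimately show ?thesis using Q(1) that by blast
qed

text \<open>
  The component only has generators in its two top degrees, and its corank in the last one is the
  corank of \<open>P\<close> in degree \<open>i + 1\<close> by \<open>component_structure\<close>.
\<close>

lemma kappa_component:
  assumes inf: "infinite (UNIV :: 'k::field set)"
    and P: "is_partition P" and i: "0 < i" and D: "lead_set P i \<subset> {..i}"
    and c0: "card (new_lead P i) = Suc (delta t i)"
    and c1: "card (new_lead P (Suc i)) = Suc (delta t (i + 1))"
  shows "kappa TYPE('k) (component TYPE('k) t P i) = Suc (delta t i) + generic_new_gens P (Suc i)"
proof -
  define k where "k = component_degree t i"
  obtain S where S: "S \<subseteq> {..k}" "card S = Suc (delta t i)"
    "staircase_rank S ({..Suc k} - S) = staircase_rank (new_lead P i) (new_lead P (Suc i))"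
    "component_map t P i ` V1 P i = monomial_of_degree k ` S"
    using component_structure[OF P i D c0 c1] unfolding k_def by blast
  obtain Q where Q: "is_partition Q"
    "E_set Q = monomial_of_degree k ` S \<union> {m. k + 1 \<le> mdeg m}"
    "\<And>n. new_lead Q n = (if n < k then {} else if n = k then S else if n = Suc k then {..Suc k} - S else {n})"
    "lead_set Q (Suc k) = {..Suc k}"
    using partition_of_top_degree[OF S(1)] by blast
  have "component TYPE('k) t P i = Q"
    unfolding component_def
  proof (rule the_equality)
    let ?J = "ideal.span (mono_poly ` component_map t P i ` V1 P i)
          + ideal_power max_ideal (component_degree t i + 1)"
    have E: "(E_ideal Q :: 'k xy_poly set) = ?J"
      unfolding S(4) ideal_power_max_ideal ideal_span_plus E_ideal_def Q(2) k_def[symmetric] image_Un ..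
    then show "is_partition Q \<and> (E_ideal Q :: 'k xy_poly set) = ?J" using Q(1) by blast
    fix Q' assume Q': "is_partition Q' \<and> (E_ideal Q' :: 'k xy_poly set) = ?J"
    then have "(E_ideal Q' :: 'k xy_poly set) = E_ideal Q" using E by simp
    then have "E_set Q' = E_set Q"
      unfolding E_ideal_def using span_monomials_eq_iff[OF upward_closed_E_set upward_closed_E_set] Q' Q(1) by blast
    then show "Q' = Q" using E_set_inject Q' Q(1) by blast
  qed
  moreover have "kappa TYPE('k) Q = Suc (delta t i) + generic_new_gens P (Suc i)"
  proof -
    have r0: "staircase_rank {} A = 0" if "finite A" for A using staircase_rank_le(1)[OF that, of "{}"] by simp
    have finS: "finite S" using S(1) finite_subset by blast
    have z: "generic_new_gens Q n = 0" if "n < k" for n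
      using that unfolding generic_new_gens_def Q(3) by (cases n) auto
    have gk: "generic_new_gens Q k = card S"
      using r0[OF finS] unfolding generic_new_gens_def Q(3) by (cases k) auto
    have "card ({..Suc k} - S) = Suc (Suc k) - card S"
      using card_Diff_subset[OF finS, of "{..Suc k}"] subset_trans[OF S(1), of "{..Suc k}"] by simp
    also have "\<dots> = card (new_lead P (Suc i))"
      unfolding S(2) c1 by (simp add: k_def component_degree_def)
    finally have gSk: "generic_new_gens Q (Suc k) = generic_new_gens P (Suc i)"
      unfolding generic_new_gens_def Q(3) using S(3) by simp
    have "(\<Sum>n\<le>Suc k. generic_new_gens Q n) = (\<Sum>n\<in>{k, Suc k}. generic_new_gens Q n)"
      using z by (intro sum.mono_neutral_right) (auto simp: not_less_eq_eq le_less)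
    also have "\<dots> = Suc (delta t i) + generic_new_gens P (Suc i)" using gk gSk S(2) by simp
    finally show ?thesis unfolding kappa_formula[OF inf Q(1,4)] .
  qed
  ultimately show ?thesis by simp
qed


section \<open>The number of generators of a generic ideal in the cell\<close>

lemma infinite_field:
  assumes "CHAR('k::field) = 0 \<or> (infinite (UNIV :: 'k set) \<and> CHAR('k) > j)"
  shows "infinite (UNIV :: 'k set)"
  using assms finite_imp_CHAR_pos[where 'a = 'k] by auto

theorem theorem5p15:
  fixes P :: "nat list" and t :: "nat \<Rightarrow> nat" and d j :: nat
  assumes field: "CHAR('k::field) = 0 \<or> (infinite (UNIV :: 'k set) \<and> CHAR('k) > j)"
    and P: "is_partition P"
    and diag: "diagonal_lengths TYPE('k) P = t"
    and T: "d \<le> j" "\<forall>i<d. t i = i + 1" "t d \<le> d"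
      "\<forall>i. d \<le> i \<and> i < j \<longrightarrow> t (i + 1) \<le> t i" "t j > 0" "\<forall>i>j. t i = 0"
  shows "int (kappa TYPE('k) P) =
      (\<Sum>i=d..j. int (kappa TYPE('k) (component TYPE('k) t P i)))
        - (int (t d) - int (t j)) - (int j - int d)
    \<and> generic_in_cell P (\<lambda>I :: 'k xy_poly set.
        \<forall>G. minimal_homogeneous_gens I G \<longrightarrow>
          int (card {g \<in> G. g \<in> forms d}) = int d + 1 - int (t d) \<and>
          (\<forall>i\<in>{d..j}. int (card {g \<in> G. g \<in> forms (i + 1)}) =
             int (kappa TYPE('k) (component TYPE('k) t P i)) - (int (delta t i) + 1)))"
proof -
  have inf: "infinite (UNIV :: 'k set)" by (rule infinite_field[OF field])
  have sub: "lead_set P n \<subseteq> {..n}" for n by (auto dest: lead_set_le)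
  have cle: "card (lead_set P n) \<le> Suc n" for n using card_mono[OF _ sub[of n]] by simp
  have tn: "t n = Suc n - card (lead_set P n)" for n using diagonal_lengths_eq[OF P, where 'k = 'k] diag by simp
  have cl: "card (lead_set P n) = Suc n - t n" for n using tn[of n] cle[of n] by simp
  have tle: "t n \<le> Suc n" for n using tn[of n] by simp
  have anti: "t n \<le> t m" if "d \<le> m" "m \<le> n" "n \<le> j" for m n
    using that(2,1,3)
  proof (induction rule: dec_induct)
    case (step n)
    then have "t (n + 1) \<le> t n" using T(4) by simp
    then show ?case using step by simp
  qed simp
  have d0: "d > 0" using anti[of d j] T(1,3,5) by (cases d) auto
  have tpos: "t i > 0" if "d \<le> i" "i \<le> j" for i using anti[OF that order_refl] T(5) by simp
  have tdec: "t i \<le> t (i - 1)" if i: "d \<le> i" "i \<le> Suc j" for i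
  proof (cases "i = d")
    case True
    then show ?thesis using T(2,3) d0 by simp
  next
    case False
    then obtain i' where i': "i = Suc i'" "d \<le> i'" using i(1) d0 by (cases i) auto
    then show ?thesis using T(4)[rule_format, of i'] T(6) i(2) by (cases "i = Suc j") auto
  qed
  have empty: "lead_set P n = {}" if "n < d" for n
    using cl[of n] T(2) that by simp
  have all: "lead_set P (Suc j) = {..Suc j}"
    using cl[of "Suc j"] T(6) sub[of "Suc j"] by (intro card_subset_eq) auto
  have proper: "lead_set P i \<subset> {..i}" if "d \<le> i" "i \<le> j" for i
    using cl[of i] tpos[OF that] sub[of i] by (intro psubsetI) auto
  have new: "card (new_lead P i) = Suc (delta t i)" if i: "d \<le> i" "i \<le> Suc j" for i
  proof -
    obtain i' where i': "i = Suc i'" using i d0 by (cases i) auto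
    have "card (new_lead P i) = card (lead_set P i) - card (lead_set P i')"
      using card_lead_set_Suc[of P i'] by (simp add: i')
    also have "\<dots> = Suc (delta t i)"
      unfolding cl using tdec[OF i] tle[of i] tle[of i'] by (simp add: delta_def i')
    finally show ?thesis .
  qed
  have comp: "kappa TYPE('k) (component TYPE('k) t P i) = Suc (delta t i) + generic_new_gens P (Suc i)"
    if "i \<in> {d..j}" for i
    using that d0 new[of i] new[of "Suc i"] by (intro kappa_component[OF inf P] proper) auto
  have gen_less: "generic_new_gens P n = 0" if "n < d" for n
  proof -
    have "new_lead P n = {}" using empty[OF that] new_lead_subset[of P n] by simp
    then show ?thesis by (cases n) (simp_all add: generic_new_gens_def)
  qed
  have gen_d: "generic_new_gens P d = Suc d - t d"
  proof -
    obtain d' where d': "d = Suc d'" using d0 by (cases d) auto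
    have "new_lead P d' = {}" using empty[of d'] new_lead_subset[of P d'] d' by simp
    then have "staircase_rank (new_lead P d') (new_lead P d) = 0"
      using staircase_rank_le(1)[of "new_lead P d" "{}"] by simp
    moreover have "card (new_lead P d) = Suc d - t d"
      using new[of d] T(1,2,3) d' by (simp add: delta_def Suc_diff_le)
    ultimately show ?thesis by (simp add: generic_new_gens_def d')
  qed
  have "kappa TYPE('k) P = (\<Sum>n\<le>Suc j. generic_new_gens P n)" by (rule kappa_formula[OF inf P all])
  also have "\<dots> = (\<Sum>n\<in>{d..Suc j}. generic_new_gens P n)"
    using gen_less by (intro sum.mono_neutral_right) auto
  also have "\<dots> = generic_new_gens P d + (\<Sum>n\<in>{Suc d..Suc j}. generic_new_gens P n)"
    using T(1) by (intro sum.atLeast_Suc_atMost) simp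
  also have "(\<Sum>n\<in>{Suc d..Suc j}. generic_new_gens P n) = (\<Sum>i=d..j. generic_new_gens P (Suc i))"
    by (rule sum.shift_bounds_cl_Suc_ivl)
  finally have k1: "int (kappa TYPE('k) P) = int d + 1 - int (t d) + (\<Sum>i=d..j. int (generic_new_gens P (Suc i)))"
    using gen_d T(3) by simp
  have tele: "(\<Sum>i=d..n. int (Suc (delta t i))) = int d - int (t n) + (int n - int d + 1)" if "d \<le> n" "n \<le> j" for n
    using that
  proof (induction rule: dec_induct)
    case base
    show ?case using T(2,3) d0 by (simp add: delta_def)
  next
    case (step n)
    have "int (delta t (Suc n)) = int (t n) - int (t (Suc n))" using tdec[of "Suc n"] step by (simp add: delta_def)
    then show ?case using step by simp
  qed
  have "(\<Sum>i=d..j. int (kappa TYPE('k) (component TYPE('k) t P i)))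
      = (\<Sum>i=d..j. int (Suc (delta t i)) + int (generic_new_gens P (Suc i)))"
    using comp by (intro sum.cong) auto
  also have "\<dots> = int d - int (t j) + (int j - int d + 1) + (\<Sum>i=d..j. int (generic_new_gens P (Suc i)))"
    unfolding sum.distrib tele[OF T(1) order_refl] ..
  finally have 1: "int (kappa TYPE('k) P) =
      (\<Sum>i=d..j. int (kappa TYPE('k) (component TYPE('k) t P i)))
        - (int (t d) - int (t j)) - (int j - int d)"
    using k1 by simp
  show ?thesis
  proof (rule conjI[OF 1], rule generic_in_cellI[OF inf P], rule generic_regular_mono[OF generic_gens_upto[OF inf P, of "Suc j"]],
      intro allI impI)
    fix I :: "'k xy_poly set" and G
    assume gens: "\<forall>n\<in>{..Suc j}. num_new_gens (slices I) n = generic_new_gens P n"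
      and G: "minimal_homogeneous_gens I G"
    have card: "card {g \<in> G. g \<in> forms n} = generic_new_gens P n" if "n \<le> Suc j" for n
      using card_minimal_gens[OF G] gens that by simp
    show "int (card {g \<in> G. g \<in> forms d}) = int d + 1 - int (t d) \<and>
          (\<forall>i\<in>{d..j}. int (card {g \<in> G. g \<in> forms (i + 1)}) =
             int (kappa TYPE('k) (component TYPE('k) t P i)) - (int (delta t i) + 1))"
      using card[of d] gen_d T(1,3) comp card by auto
  qed
qed

end
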